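(* Let $k$ be a field. Let $W_n$ ($n\ge3$) be the wheel with $n$ spokes; set $w_0=0$, $w_1=\mathbb{L}$, $w_2=\mathbb{L}^3$, and $w_n=[W_n]\in K_0(\mathrm{Var}_k)$ for $n\ge3$. Let $W(t)=\sum_{n\ge0}w_nt^n$, and let $B(t)=\sum_{n\ge0}b_nt^n$ and $\widehat{W}(t)=\sum_{n\ge0}\widehat{w}_nt^n$, where $b_0=0$, $b_1=1$, $b_n=[B_n]$ for $n\ge2$, and $\widehat{w}_n=0$ for $n\le2$, $\widehat{w}_n=\langle W_n\rangle$ for $n\ge3$. Then in $K_0(\mathrm{Var}_k)[[t]]$, $$W(t)=\frac{(\mathbb{L}^4-\mathbb{L}^3)\,\widehat{W}(t)+(\mathbb{L}-1)(1-\mathbb{L}^2t^2)B(t)+\dfrac{1-\mathbb{L}t^2+\mathbb{L}^2t^2}{1-\mathbb{L}^2t}}{1+(\mathbb{L}-1)t}\;\mathbb{L}\,t .$$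
   Context: $K_0(\mathrm{Var}_k)$ is the Grothendieck ring of varieties over $k$, $\mathbb{L}=[\mathbb{A}^1_k]$. For a connected graph $G$ with $N_G$ edges, $\Psi_G=\sum_T\prod_{e\notin T}\alpha_e$ (sum over spanning trees $T$), with $\Psi_G=0$ if $G$ is disconnected, and $[G]=[\Psi_G]$ is the class of $\{\Psi_G=0\}\subset\mathbb{A}^{N_G}_k$. $G\backslash e$ and $G/\!\!/e$ denote deletion and contraction of $e$; contracting a self-loop gives the zero graph, whose polynomial is $0$. $W_n$: a cycle of $n$ rim vertices together with a hub vertex joined to each rim vertex by one spoke ($2n$ edges). $B_n$: the graph obtained by contracting one spoke of $W_n$; it has $n$ vertices $r_1,\dots,r_n$ and $2n-1$ edges, namely the cycle edges $r_ir_{i+1}$ (indices mod $n$; for $n=2$ two parallel edges) and one further edge from $r_1$ to each of $r_2,\dots,r_n$. For a three-valent vertex $v$ of $G$ with incident edges $1,2,3$, put $f_0=\Psi_{G\backslash\{1,2\}/\!\!/3}$, $f_1=\Psi^{2,3}_{G,1}$, $f_2=\Psi^{1,3}_{G,2}$, $f_3=\Psi^{1,2}_{G,3}$, $f_{123}=\Psi_{G/\!\!/\{1,2,3\}}$, and $\langle G\rangle_v=[f_0,f_1,f_2,f_3,f_{123}]$, the class of their common zero locus in $\mathbb{A}^{N_G-3}_k$. Here $\Psi^{i,j}_{G,l}$ (well defined up to sign) is the determinant of the matrix obtained from $M_G$ by deleting row $i$ and column $j$ and setting $\alpha_l=0$, where $M_G$ is $\begin{pmatrix}A&\mathcal{E}_G\\-\mathcal{E}_G^T&0\end{pmatrix}$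 with the row and column of one vertex deleted, $A=\mathrm{diag}(\alpha_e)$, and $\mathcal{E}_G$ is the oriented edge-by-vertex incidence matrix of $G$. $\langle W_n\rangle$ denotes $\langle W_n\rangle_v$ for $v$ a rim vertex. *)

theory Defs
  imports
    "HOL-Library.Poly_Mapping"
    "HOL-Computational_Algebra.Formal_Power_Series"
    "HOL-Algebra.Algebraic_Closure_Type"
    "HOL-Analysis.Abstract_Topology"
    "Jordan_Normal_Form.Determinant"
    "Graph_Theory.Digraph_Component"
begin

no_notation Polynomials.var (\<open>X\<index>\<close>)

section \<open>Polynomials\<close>

type_synonym 'k mpoly = "(nat \<Rightarrow>\<^sub>0 nat) \<Rightarrow>\<^sub>0 'k"
type_synonym 'k point = "nat \<Rightarrow> 'k alg_closure"

definition mvar :: "nat \<Rightarrow> 'k::comm_semiring_1 mpoly" where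
  "mvar i = Poly_Mapping.single (Poly_Mapping.single i 1) 1"

definition mp_eval :: "'k::field mpoly \<Rightarrow> 'k point \<Rightarrow> 'k alg_closure" where
  "mp_eval p x = (\<Sum>m\<in>Poly_Mapping.keys p. to_ac (Poly_Mapping.lookup p m) * (\<Prod>i\<in>Poly_Mapping.keys m. x i ^ Poly_Mapping.lookup m i))"

lemma mp_eval_superset:
  assumes "finite A" "Poly_Mapping.keys p \<subseteq> A"
  shows "mp_eval p x = (\<Sum>m\<in>A. to_ac (Poly_Mapping.lookup p m) * (\<Prod>i\<in>Poly_Mapping.keys m. x i ^ Poly_Mapping.lookup m i))"
  unfolding mp_eval_def using assms
  by (intro sum.mono_neutral_left) (auto simp: in_keys_iff)

lemma mp_eval_zero [simp]: "mp_eval 0 x = 0"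
  by (simp add: mp_eval_def)

lemma mp_eval_add [simp]: "mp_eval (p + q) x = mp_eval p x + mp_eval q x"
proof -
  define A where "A = Poly_Mapping.keys p \<union> Poly_Mapping.keys q"
  have A: "finite A" "Poly_Mapping.keys p \<subseteq> A" "Poly_Mapping.keys q \<subseteq> A" "Poly_Mapping.keys (p + q) \<subseteq> A"
    using Poly_Mapping.keys_add[of p q] by (auto simp: A_def)
  show ?thesis
    unfolding mp_eval_superset[OF A(1,2)] mp_eval_superset[OF A(1,3)] mp_eval_superset[OF A(1,4)]
    by (simp add: lookup_add algebra_simps sum.distrib)
qed

lemma mp_eval_single:
  "mp_eval (Poly_Mapping.single m c) x = to_ac c * (\<Prod>i\<in>Poly_Mapping.keys m. x i ^ Poly_Mapping.lookup m i)"
  by (simp add: mp_eval_def)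

lemma monom_eval_add:
  fixes m n :: "nat \<Rightarrow>\<^sub>0 nat" and x :: "nat \<Rightarrow> 'a::comm_semiring_1"
  shows "(\<Prod>i\<in>Poly_Mapping.keys (m + n). x i ^ Poly_Mapping.lookup (m + n) i) =
    (\<Prod>i\<in>Poly_Mapping.keys m. x i ^ Poly_Mapping.lookup m i) * (\<Prod>i\<in>Poly_Mapping.keys n. x i ^ Poly_Mapping.lookup n i)"
proof -
  define A where "A = Poly_Mapping.keys m \<union> Poly_Mapping.keys n"
  have A: "finite A" "Poly_Mapping.keys m \<subseteq> A" "Poly_Mapping.keys n \<subseteq> A" "Poly_Mapping.keys (m + n) \<subseteq> A"
    using Poly_Mapping.keys_add[of m n] by (auto simp: A_def)
  have *: "(\<Prod>i\<in>Poly_Mapping.keys k. x i ^ Poly_Mapping.lookup k i) = (\<Prod>i\<in>A. x i ^ Poly_Mapping.lookup k i)" if "Poly_Mapping.keys k \<subseteq> A" for k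
    using that A(1) by (intro prod.mono_neutral_left) (auto simp: in_keys_iff)
  show ?thesis
    unfolding *[OF A(2)] *[OF A(3)] *[OF A(4)]
    by (simp add: lookup_add power_add prod.distrib)
qed

lemma poly_mapping_add_induct [case_names single add]:
  fixes p :: "'a \<Rightarrow>\<^sub>0 'b::comm_monoid_add"
  assumes single: "\<And>m c. P (Poly_Mapping.single m c)"
    and add: "\<And>f g. P f \<Longrightarrow> P g \<Longrightarrow> P (f + g)"
  shows "P p"
proof (induction p rule: update_induct)
  case const
  show ?case using single[of undefined 0] by simp
next
  case (update f a b)
  have "Poly_Mapping.update a b f = f + Poly_Mapping.single a b"
    using update(1)
    by (intro poly_mapping_eqI) (auto simp: lookup_add lookup_single lookup_update when_def in_keys_iff)
  then show ?case using add[OF update(3) single] by simp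
qed

lemma mp_eval_single_times:
  "mp_eval (Poly_Mapping.single m c * q) x = mp_eval (Poly_Mapping.single m c) x * mp_eval q x"
proof (induction q rule: poly_mapping_add_induct)
  case (single n d)
  then show ?case
    by (simp add: mult_single mp_eval_single monom_eval_add algebra_simps)
next
  case (add f g)
  then show ?case by (simp add: algebra_simps)
qed

lemma mp_eval_times [simp]: "mp_eval (p * q) x = mp_eval p x * mp_eval q x"
proof (induction p rule: poly_mapping_add_induct)
  case (single n d)
  then show ?case by (rule mp_eval_single_times)
next
  case (add f g)
  then show ?case by (simp add: algebra_simps)
qed

lemma mp_eval_const [simp]: "mp_eval (Poly_Mapping.single 0 c) x = to_ac c"
  by (simp add: mp_eval_single)

lemma mp_eval_one [simp]: "mp_eval 1 x = 1"
  by (metis mp_eval_const single_one to_ac_1)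

lemma mp_eval_mvar [simp]: "mp_eval (mvar i) x = x i"
  by (simp add: mvar_def mp_eval_single)

lemma mp_eval_uminus [simp]: "mp_eval (- p) x = - mp_eval p x"
  by (metis add_eq_0_iff mp_eval_add mp_eval_zero)

lemma mp_eval_diff [simp]: "mp_eval (p - q) x = mp_eval p x - mp_eval q x"
  by (metis add_uminus_conv_diff mp_eval_add mp_eval_uminus)

lemma mp_eval_sum [simp]: "mp_eval (sum f A) x = (\<Sum>a\<in>A. mp_eval (f a) x)"
  by (induction A rule: infinite_finite_induct) auto

lemma mp_eval_prod [simp]: "mp_eval (prod f A) x = (\<Prod>a\<in>A. mp_eval (f a) x)"
  by (induction A rule: infinite_finite_induct) auto

lemma mp_eval_power [simp]: "mp_eval (p ^ n) x = mp_eval p x ^ n"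
  by (induction n) auto

lemma mp_eval_subst:
  "\<exists>p'. \<forall>x. mp_eval p' x = mp_eval p (\<lambda>i. mp_eval (s i) x)"
  by (rule exI[of _ "\<Sum>m\<in>Poly_Mapping.keys p. Poly_Mapping.single 0 (Poly_Mapping.lookup p m) *
        (\<Prod>i\<in>Poly_Mapping.keys m. s i ^ Poly_Mapping.lookup m i)"]) (simp add: mp_eval_def[of p])


section \<open>Varieties over a field\<close>

text \<open>
  A variety over \<open>k\<close> is a reduced separated scheme of finite type over \<open>k\<close>, presented
  classically: its points are the points over an algebraic closure of \<open>k\<close>, its topology is the
  Zariski topology defined over \<open>k\<close> (so conjugate points are not separated by open sets), and
  its structure sheaf is a sheaf of \<open>k\<close>-algebras of functions with values in the algebraic
  closure. No perfectness assumption is needed: a reduced finitely generated \<open>k\<close>-algebra embeds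
  into the functions on its geometric points.

  The ambient type of points contains an isomorphic copy of every variety, because a variety has
  at most as many points as the (infinite) algebraic closure has elements.
\<close>

record (overloaded) 'k fspace =
  space :: "'k point topology"
  regular :: "'k point set \<Rightarrow> ('k point \<Rightarrow> 'k alg_closure) set"

definition space_with_functions :: "'k::field fspace \<Rightarrow> bool" where
  "space_with_functions X \<longleftrightarrow>
    (\<forall>U V f. openin (space X) U \<and> openin (space X) V \<and> V \<subseteq> U \<and> f \<in> regular X U
        \<longrightarrow> f \<in> regular X V) \<and>
    (\<forall>U f. openin (space X) U \<and>
        (\<forall>x\<in>U. \<exists>V. openin (space X) V \<and> x \<in> V \<and> V \<subseteq> U \<and> (\<exists>g\<in>regular X V. \<forall>y\<in>V. f y = g y))
        \<longrightarrow> f \<in> regular X U) \<and>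
    (\<forall>U. openin (space X) U \<longrightarrow>
        (\<forall>c. (\<lambda>_. to_ac c) \<in> regular X U) \<and>
        (\<forall>f\<in>regular X U. \<forall>g\<in>regular X U.
            (\<lambda>x. f x + g x) \<in> regular X U \<and> (\<lambda>x. f x * g x) \<in> regular X U) \<and>
        (\<forall>f\<in>regular X U. openin (space X) {x\<in>U. f x \<noteq> 0} \<and>
            (\<lambda>x. inverse (f x)) \<in> regular X {x\<in>U. f x \<noteq> 0}))"

definition morphism :: "'k::field fspace \<Rightarrow> 'k fspace \<Rightarrow> ('k point \<Rightarrow> 'k point) \<Rightarrow> bool" where
  "morphism X Y \<phi> \<longleftrightarrow> continuous_map (space X) (space Y) \<phi> \<and>
    (\<forall>V f. openin (space Y) V \<and> f \<in> regular Y V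
        \<longrightarrow> f \<circ> \<phi> \<in> regular X {x\<in>topspace (space X). \<phi> x \<in> V})"

definition isomorphic :: "'k::field fspace \<Rightarrow> 'k fspace \<Rightarrow> bool" where
  "isomorphic X Y \<longleftrightarrow> (\<exists>\<phi> \<psi>. morphism X Y \<phi> \<and> morphism Y X \<psi> \<and>
    (\<forall>x\<in>topspace (space X). \<psi> (\<phi> x) = x) \<and> (\<forall>y\<in>topspace (space Y). \<phi> (\<psi> y) = y))"

text \<open>The functions induced on a subset are those extending locally to the ambient space. For an
  open subset this is the open subvariety, for a closed one the reduced closed subvariety.\<close>

definition induced :: "'k::field fspace \<Rightarrow> 'k point set \<Rightarrow> 'k fspace" where
  "induced X S = \<lparr>space = subtopology (space X) S,
    regular = (\<lambda>V. {f. \<forall>x\<in>V. \<exists>W g. openin (space X) W \<and> x \<in> W \<and> g \<in> regular X W \<and>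
                              (\<forall>y\<in>W \<inter> V. f y = g y)})\<rparr>"

text \<open>Affine space with coordinates indexed by \<open>E\<close>; a point has value \<open>0\<close> at all
  indices outside \<open>E\<close>.\<close>

definition affine_points :: "nat set \<Rightarrow> 'k::field point set" where
  "affine_points E = {x. \<forall>i. i \<notin> E \<longrightarrow> x i = 0}"

definition affine_space :: "nat set \<Rightarrow> 'k::field fspace" where
  "affine_space E = \<lparr>
    space = topology_generated_by (range (\<lambda>p. {x\<in>affine_points E. mp_eval p x \<noteq> 0})),
    regular = (\<lambda>U. {f. \<forall>x\<in>U. \<exists>p q. mp_eval q x \<noteq> 0 \<and>
                (\<forall>y\<in>U. mp_eval q y \<noteq> 0 \<longrightarrow> f y = mp_eval p y / mp_eval q y)})\<rparr>"

definition zero_set :: "nat set \<Rightarrow> 'k::field mpoly set \<Rightarrow> 'k point set" where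
  "zero_set E F = {x\<in>affine_points E. \<forall>p\<in>F. mp_eval p x = 0}"

definition zero_locus :: "nat set \<Rightarrow> 'k::field mpoly set \<Rightarrow> 'k fspace" where
  "zero_locus E F = induced (affine_space E) (zero_set E F)"

definition affine_variety :: "'k::field fspace \<Rightarrow> bool" where
  "affine_variety X \<longleftrightarrow> (\<exists>E F. finite E \<and> finite F \<and> isomorphic X (zero_locus E F))"

definition prevariety :: "'k::field fspace \<Rightarrow> bool" where
  "prevariety X \<longleftrightarrow> space_with_functions X \<and>
    (\<exists>\<U>. finite \<U> \<and> \<Union>\<U> = topspace (space X) \<and>
         (\<forall>U\<in>\<U>. openin (space X) U \<and> affine_variety (induced X U)))"

text \<open>Categorical product of prevarieties; it is the reduction of the fibre product over \<open>k\<close>.\<close>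

definition is_product ::
  "'k::field fspace \<Rightarrow> ('k point \<Rightarrow> 'k point) \<Rightarrow> ('k point \<Rightarrow> 'k point) \<Rightarrow>
   'k fspace \<Rightarrow> 'k fspace \<Rightarrow> bool" where
  "is_product P p q X Y \<longleftrightarrow> prevariety P \<and> morphism P X p \<and> morphism P Y q \<and>
    (\<forall>Z a b. prevariety Z \<and> morphism Z X a \<and> morphism Z Y b \<longrightarrow>
      (\<exists>c. (morphism Z P c \<and> (\<forall>z\<in>topspace (space Z). p (c z) = a z \<and> q (c z) = b z)) \<and>
        (\<forall>c'. morphism Z P c' \<and> (\<forall>z\<in>topspace (space Z). p (c' z) = a z \<and> q (c' z) = b z)
             \<longrightarrow> (\<forall>z\<in>topspace (space Z). c' z = c z))))"

definition separated :: "'k::field fspace \<Rightarrow> bool" where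
  "separated X \<longleftrightarrow> (\<exists>P p q. is_product P p q X X \<and>
     closedin (space P) {x\<in>topspace (space P). p x = q x})"

definition variety :: "'k::field fspace \<Rightarrow> bool" where
  "variety X \<longleftrightarrow> prevariety X \<and> separated X"


subsection \<open>Zero loci are varieties\<close>

definition basic_open :: "nat set \<Rightarrow> 'k::field mpoly \<Rightarrow> 'k point set" where
  "basic_open E p = {x\<in>affine_points E. mp_eval p x \<noteq> 0}"

lemma topspace_affine_space [simp]:
  "topspace (space (affine_space E :: 'k::field fspace)) = affine_points E"
proof -
  have "affine_points E \<subseteq> (\<Union>p::'k mpoly. {x\<in>affine_points E. mp_eval p x \<noteq> 0})"
    by (auto intro!: exI[of _ 1])
  then show ?thesis
    by (auto simp: affine_space_def)
qed

lemma openin_basic_open [simp]: "openin (space (affine_space E)) (basic_open E p)"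
  unfolding affine_space_def basic_open_def
  by (auto intro!: topology_generated_by_Basis)

lemma openin_affine_space:
  "openin (space (affine_space E)) U \<longleftrightarrow>
    (\<forall>x\<in>U. \<exists>p. x \<in> basic_open E p \<and> basic_open E p \<subseteq> U)" (is "?L \<longleftrightarrow> ?R")
proof
  assume ?L
  then have "generate_topology_on (range (\<lambda>p. basic_open E p)) U"
    by (simp add: affine_space_def basic_open_def openin_topology_generated_by_iff)
  then show ?R
  proof (induction rule: generate_topology_on.induct)
    case (Int a b)
    show ?case
    proof
      fix x assume "x \<in> a \<inter> b"
      then obtain p q where pq: "x \<in> basic_open E p" "basic_open E p \<subseteq> a"
        "x \<in> basic_open E q" "basic_open E q \<subseteq> b" using Int by blast
      then have "x \<in> basic_open E (p * q)" "basic_open E (p * q) \<subseteq> a \<inter> b"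
        by (auto simp: basic_open_def)
      then show "\<exists>p. x \<in> basic_open E p \<and> basic_open E p \<subseteq> a \<inter> b" by blast
    qed
  next
    case (UN K)
    then show ?case by (meson UnionE Union_upper order_trans)
  qed auto
next
  assume ?R
  then show ?L by (subst openin_subopen) (meson openin_basic_open)
qed

lemma regular_affine_space_iff:
  "f \<in> regular (affine_space E) U \<longleftrightarrow>
    (\<forall>x\<in>U. \<exists>p q. mp_eval q x \<noteq> 0 \<and>
       (\<forall>y\<in>U. mp_eval q y \<noteq> 0 \<longrightarrow> f y = mp_eval p y / mp_eval q y))"
  by (simp add: affine_space_def)

lemma topspace_zero_locus [simp]: "topspace (space (zero_locus E F)) = zero_set E F"
  by (auto simp: zero_locus_def induced_def zero_set_def)

lemma openin_zero_locus:
  "openin (space (zero_locus E F)) U \<longleftrightarrow> U \<subseteq> zero_set E F \<and>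
    (\<forall>x\<in>U. \<exists>p. mp_eval p x \<noteq> 0 \<and> {y\<in>zero_set E F. mp_eval p y \<noteq> 0} \<subseteq> U)" (is "?L \<longleftrightarrow> ?R")
proof
  assume ?L
  then obtain T where "openin (space (affine_space E)) T" "U = T \<inter> zero_set E F"
    by (auto simp: zero_locus_def induced_def openin_subtopology)
  moreover have "{y\<in>zero_set E F. mp_eval p y \<noteq> 0} \<subseteq> basic_open E p" for p
    by (auto simp: basic_open_def zero_set_def)
  moreover have "mp_eval p x \<noteq> 0" if "x \<in> basic_open E p" for p x
    using that by (simp add: basic_open_def)
  ultimately show ?R unfolding openin_affine_space by blast
next
  assume R: ?R
  define T where "T = \<Union>{basic_open E p | p. {y\<in>zero_set E F. mp_eval p y \<noteq> 0} \<subseteq> U}"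
  have "openin (space (affine_space E)) T" unfolding T_def by (rule openin_Union) auto
  moreover have "U = T \<inter> zero_set E F"
  proof (intro equalityI subsetI)
    fix x assume x: "x \<in> U"
    then obtain p where p: "mp_eval p x \<noteq> 0" "{y\<in>zero_set E F. mp_eval p y \<noteq> 0} \<subseteq> U"
      using R by blast
    have "x \<in> zero_set E F" using R x by blast
    moreover from this have "x \<in> basic_open E p" using p by (auto simp: basic_open_def zero_set_def)
    ultimately show "x \<in> T \<inter> zero_set E F" using p(2) by (auto simp: T_def)
  qed (auto simp: T_def basic_open_def)
  ultimately show ?L
    by (auto simp: zero_locus_def induced_def openin_subtopology)
qed

lemma regular_zero_locus_iff:
  assumes "openin (space (zero_locus E F)) U"
  shows "f \<in> regular (zero_locus E F) U \<longleftrightarrow>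
    (\<forall>x\<in>U. \<exists>p q. mp_eval q x \<noteq> 0 \<and>
       (\<forall>y\<in>U. mp_eval q y \<noteq> 0 \<longrightarrow> f y = mp_eval p y / mp_eval q y))" (is "?L \<longleftrightarrow> ?R")
proof
  assume L: ?L
  show ?R
  proof
    fix x assume x: "x \<in> U"
    then obtain W g where W: "openin (space (affine_space E)) W" "x \<in> W"
      "g \<in> regular (affine_space E) W" "\<forall>y\<in>W \<inter> U. f y = g y"
      using L by (auto simp: zero_locus_def induced_def)
    obtain p q where pq: "mp_eval q x \<noteq> 0"
      "\<forall>y\<in>W. mp_eval q y \<noteq> 0 \<longrightarrow> g y = mp_eval p y / mp_eval q y"
      using W(2,3) unfolding regular_affine_space_iff by blast
    obtain r where r: "x \<in> basic_open E r" "basic_open E r \<subseteq> W"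
      using W(1,2) by (auto simp: openin_affine_space)
    have "U \<subseteq> affine_points E" using assms by (auto simp: openin_zero_locus zero_set_def)
    then have "mp_eval (q * r) x \<noteq> 0 \<and>
       (\<forall>y\<in>U. mp_eval (q * r) y \<noteq> 0 \<longrightarrow> f y = mp_eval (p * r) y / mp_eval (q * r) y)"
      using pq r W(4) by (auto simp: basic_open_def)
    then show "\<exists>p q. mp_eval q x \<noteq> 0 \<and>
       (\<forall>y\<in>U. mp_eval q y \<noteq> 0 \<longrightarrow> f y = mp_eval p y / mp_eval q y)" by blast
  qed
next
  assume R: ?R
  have "\<exists>W g. openin (space (affine_space E)) W \<and> x \<in> W \<and> g \<in> regular (affine_space E) W \<and>
          (\<forall>y\<in>W \<inter> U. f y = g y)" if x: "x \<in> U" for x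
  proof -
    obtain p q where pq: "mp_eval q x \<noteq> 0"
      "\<forall>y\<in>U. mp_eval q y \<noteq> 0 \<longrightarrow> f y = mp_eval p y / mp_eval q y" using R x by blast
    have "U \<subseteq> affine_points E" using assms by (auto simp: openin_zero_locus zero_set_def)
    then have "x \<in> basic_open E q" using pq x by (auto simp: basic_open_def)
    moreover have "(\<lambda>y. mp_eval p y / mp_eval q y) \<in> regular (affine_space E) (basic_open E q)"
      by (auto simp: regular_affine_space_iff basic_open_def)
    moreover have "\<forall>y\<in>basic_open E q \<inter> U. f y = mp_eval p y / mp_eval q y"
      using pq by (auto simp: basic_open_def)
    ultimately show ?thesis using openin_basic_open by blast
  qed
  then show ?L by (simp add: zero_locus_def induced_def)
qed

lemma space_with_functions_zero_locus:
  "space_with_functions (zero_locus E F :: 'k::field fspace)"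
proof -
  let ?X = "zero_locus E F :: 'k fspace"
  let ?frac = "\<lambda>U f x. \<exists>p q. mp_eval q x \<noteq> 0 \<and>
       (\<forall>y\<in>U. mp_eval q y \<noteq> 0 \<longrightarrow> f y = mp_eval p y / mp_eval q y)"
  have restr: "f \<in> regular ?X V"
    if "openin (space ?X) U" "openin (space ?X) V" "V \<subseteq> U" "f \<in> regular ?X U" for U V f
    using that by (simp add: regular_zero_locus_iff) blast
  have glue: "f \<in> regular ?X U"
    if U: "openin (space ?X) U" and *: "\<forall>x\<in>U. \<exists>V. openin (space ?X) V \<and> x \<in> V \<and> V \<subseteq> U \<and>
          (\<exists>g\<in>regular ?X V. \<forall>y\<in>V. f y = g y)" for U f
    unfolding regular_zero_locus_iff[OF U]
  proof
    fix x assume x: "x \<in> U"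
    obtain V g where V: "openin (space ?X) V" "x \<in> V" "V \<subseteq> U" "g \<in> regular ?X V"
      "\<forall>y\<in>V. f y = g y" using * x by meson
    obtain p q where pq: "mp_eval q x \<noteq> 0"
      "\<forall>y\<in>V. mp_eval q y \<noteq> 0 \<longrightarrow> g y = mp_eval p y / mp_eval q y"
      using V(2,4) unfolding regular_zero_locus_iff[OF V(1)] by blast
    obtain r where r: "mp_eval r x \<noteq> 0" "{y\<in>zero_set E F. mp_eval r y \<noteq> 0} \<subseteq> V"
      using V(1,2) by (auto simp: openin_zero_locus)
    have "U \<subseteq> zero_set E F" using U by (auto simp: openin_zero_locus)
    then have "mp_eval (q * r) x \<noteq> 0 \<and>
       (\<forall>y\<in>U. mp_eval (q * r) y \<noteq> 0 \<longrightarrow> f y = mp_eval (p * r) y / mp_eval (q * r) y)"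
      using pq r V(5) by auto
    then show "?frac U f x" by blast
  qed
  have const: "(\<lambda>_. to_ac c) \<in> regular ?X U" if U: "openin (space ?X) U" for U c
    unfolding regular_zero_locus_iff[OF U]
    by (intro ballI exI[of _ "Poly_Mapping.single 0 c"] exI[of _ "1 :: 'k mpoly"]) simp
  have alg: "(\<lambda>x. f x + g x) \<in> regular ?X U \<and> (\<lambda>x. f x * g x) \<in> regular ?X U"
    if U: "openin (space ?X) U" and f: "f \<in> regular ?X U" and g: "g \<in> regular ?X U" for U f g
  proof -
    have "?frac U (\<lambda>x. f x + g x) x \<and> ?frac U (\<lambda>x. f x * g x) x" if x: "x \<in> U" for x
    proof -
      obtain p q where pq: "mp_eval q x \<noteq> 0"
        "\<forall>y\<in>U. mp_eval q y \<noteq> 0 \<longrightarrow> f y = mp_eval p y / mp_eval q y"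
        using f x unfolding regular_zero_locus_iff[OF U] by blast
      obtain r s where rs: "mp_eval s x \<noteq> 0"
        "\<forall>y\<in>U. mp_eval s y \<noteq> 0 \<longrightarrow> g y = mp_eval r y / mp_eval s y"
        using g x unfolding regular_zero_locus_iff[OF U] by blast
      have "mp_eval (q * s) x \<noteq> 0" using pq rs by simp
      moreover have "f y + g y = mp_eval (p * s + r * q) y / mp_eval (q * s) y"
        and "f y * g y = mp_eval (p * r) y / mp_eval (q * s) y"
        if "y \<in> U" "mp_eval (q * s) y \<noteq> 0" for y
      proof -
        have "mp_eval q y \<noteq> 0" "mp_eval s y \<noteq> 0" using that(2) by auto
        moreover from this have "f y = mp_eval p y / mp_eval q y" "g y = mp_eval r y / mp_eval s y"
          using pq(2) rs(2) that(1) by auto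
        ultimately show "f y + g y = mp_eval (p * s + r * q) y / mp_eval (q * s) y"
          and "f y * g y = mp_eval (p * r) y / mp_eval (q * s) y"
          by (simp_all add: add_frac_eq)
      qed
      ultimately show ?thesis by blast
    qed
    then show ?thesis unfolding regular_zero_locus_iff[OF U] by blast
  qed
  have inv: "openin (space ?X) {x\<in>U. f x \<noteq> 0} \<and>
      (\<lambda>x. inverse (f x)) \<in> regular ?X {x\<in>U. f x \<noteq> 0}"
    if U: "openin (space ?X) U" and f: "f \<in> regular ?X U" for U f
  proof -
    have *: "\<exists>p. mp_eval p x \<noteq> 0 \<and> {y\<in>zero_set E F. mp_eval p y \<noteq> 0} \<subseteq> {x\<in>U. f x \<noteq> 0}"
      if x: "x \<in> U" "f x \<noteq> 0" for x
    proof -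
      obtain p q where pq: "mp_eval q x \<noteq> 0"
        "\<forall>y\<in>U. mp_eval q y \<noteq> 0 \<longrightarrow> f y = mp_eval p y / mp_eval q y"
        using f x unfolding regular_zero_locus_iff[OF U] by blast
      obtain r where r: "mp_eval r x \<noteq> 0" "{y\<in>zero_set E F. mp_eval r y \<noteq> 0} \<subseteq> U"
        using U x(1) by (auto simp: openin_zero_locus)
      have "mp_eval p x \<noteq> 0" using pq x by auto
      then show ?thesis using pq r
        by (intro exI[of _ "p * q * r"]) auto
    qed
    have "U \<subseteq> zero_set E F" using U by (auto simp: openin_zero_locus)
    then have o: "openin (space ?X) {x\<in>U. f x \<noteq> 0}"
      using * unfolding openin_zero_locus by blast
    have "?frac {x\<in>U. f x \<noteq> 0} (\<lambda>x. inverse (f x)) x" if x: "x \<in> U" "f x \<noteq> 0" for x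
    proof -
      obtain p q where pq: "mp_eval q x \<noteq> 0"
        "\<forall>y\<in>U. mp_eval q y \<noteq> 0 \<longrightarrow> f y = mp_eval p y / mp_eval q y"
        using f x unfolding regular_zero_locus_iff[OF U] by blast
      have "mp_eval p x \<noteq> 0" using pq x by auto
      then show ?thesis using pq
        by (intro exI[of _ "q * q"] exI[of _ "p * q"]) auto
    qed
    then show ?thesis using o by (auto simp: regular_zero_locus_iff[OF o])
  qed
  show ?thesis
    unfolding space_with_functions_def
  proof (intro conjI allI impI ballI)
    fix U V f
    assume "openin (space ?X) U \<and> openin (space ?X) V \<and> V \<subseteq> U \<and> f \<in> regular ?X U"
    then show "f \<in> regular ?X V" using restr by blast
  qed (elim conjE, rule glue, assumption+ |
       rule const alg[THEN conjunct1] alg[THEN conjunct2] inv[THEN conjunct1] inv[THEN conjunct2],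
       assumption+)+
qed

lemma regular_restrict:
  assumes X: "space_with_functions X"
    and UV: "openin (space X) U" "openin (space X) V" "V \<subseteq> U" "f \<in> regular X U"
  shows "f \<in> regular X V"
proof -
  have "\<forall>U V f. openin (space X) U \<and> openin (space X) V \<and> V \<subseteq> U \<and> f \<in> regular X U
        \<longrightarrow> f \<in> regular X V"
    using X unfolding space_with_functions_def by (rule conjunct1)
  then show ?thesis using UV by blast
qed

lemma regular_glue:
  assumes X: "space_with_functions X" and U: "openin (space X) U"
    and loc: "\<And>x. x \<in> U \<Longrightarrow> \<exists>V. openin (space X) V \<and> x \<in> V \<and> V \<subseteq> U \<and>
      (\<exists>g\<in>regular X V. \<forall>y\<in>V. f y = g y)"
  shows "f \<in> regular X U"
proof -
  have "\<forall>U f. openin (space X) U \<and>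
        (\<forall>x\<in>U. \<exists>V. openin (space X) V \<and> x \<in> V \<and> V \<subseteq> U \<and> (\<exists>g\<in>regular X V. \<forall>y\<in>V. f y = g y))
        \<longrightarrow> f \<in> regular X U"
    using X unfolding space_with_functions_def by (elim conjE)
  then show ?thesis using U loc by blast
qed

lemma isomorphic_induced_topspace:
  assumes "space_with_functions X"
  shows "isomorphic (induced X (topspace (space X))) X"
proof -
  let ?Y = "induced X (topspace (space X))"
  have sp: "space ?Y = space X" by (simp add: induced_def)
  have reg: "f \<in> regular ?Y V \<longleftrightarrow> f \<in> regular X V" if V: "openin (space X) V" for f V
  proof
    assume L: "f \<in> regular ?Y V"
    have "\<exists>W. openin (space X) W \<and> x \<in> W \<and> W \<subseteq> V \<and> (\<exists>g\<in>regular X W. \<forall>y\<in>W. f y = g y)"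
      if "x \<in> V" for x
    proof -
      obtain W g where W: "openin (space X) W" "x \<in> W" "g \<in> regular X W" "\<forall>y\<in>W \<inter> V. f y = g y"
        using L \<open>x \<in> V\<close> by (auto simp: induced_def)
      moreover from this V have "openin (space X) (W \<inter> V)" by blast
      ultimately have "openin (space X) (W \<inter> V)" "g \<in> regular X (W \<inter> V)"
        using regular_restrict[OF assms, of W "W \<inter> V" g] by auto
      then show ?thesis using W \<open>x \<in> V\<close> by blast
    qed
    then show "f \<in> regular X V"
      using regular_glue[OF assms V] by blast
  next
    assume "f \<in> regular X V"
    then show "f \<in> regular ?Y V" using V by (auto simp: induced_def)
  qed
  have pre: "{x\<in>topspace (space X). x \<in> V} = V" if "openin (space X) V" for V
    using openin_subset[OF that] by auto
  have "morphism ?Y X (\<lambda>x. x)" "morphism X ?Y (\<lambda>x. x)"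
    unfolding morphism_def sp by (auto simp: pre reg comp_def)
  then show ?thesis unfolding isomorphic_def by (auto simp: sp)
qed

lemma prevariety_zero_locus:
  assumes "finite E" "finite F"
  shows "prevariety (zero_locus E F :: 'k::field fspace)"
  unfolding prevariety_def
proof (intro conjI exI)
  let ?X = "zero_locus E F :: 'k fspace"
  show "space_with_functions ?X" by (rule space_with_functions_zero_locus)
  show "finite {topspace (space ?X)}" "\<Union>{topspace (space ?X)} = topspace (space ?X)" by auto
  show "\<forall>U\<in>{topspace (space ?X)}. openin (space ?X) U \<and> affine_variety (induced ?X U)"
    using isomorphic_induced_topspace[OF space_with_functions_zero_locus[of E F]] assms
    unfolding affine_variety_def by blast
qed

lemma regular_algebra:
  assumes X: "space_with_functions X" and U: "openin (space X) U"
  shows regular_const: "(\<lambda>_. to_ac c) \<in> regular X U"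
    and regular_add: "f \<in> regular X U \<Longrightarrow> g \<in> regular X U \<Longrightarrow> (\<lambda>x. f x + g x) \<in> regular X U"
    and regular_mult: "f \<in> regular X U \<Longrightarrow> g \<in> regular X U \<Longrightarrow> (\<lambda>x. f x * g x) \<in> regular X U"
    and openin_nonzero: "f \<in> regular X U \<Longrightarrow> openin (space X) {x\<in>U. f x \<noteq> 0}"
    and regular_inverse: "f \<in> regular X U \<Longrightarrow>
      (\<lambda>x. inverse (f x)) \<in> regular X {x\<in>U. f x \<noteq> 0}"
proof -
  have *: "(\<forall>c. (\<lambda>_. to_ac c) \<in> regular X U) \<and>
        (\<forall>f\<in>regular X U. \<forall>g\<in>regular X U.
            (\<lambda>x. f x + g x) \<in> regular X U \<and> (\<lambda>x. f x * g x) \<in> regular X U) \<and>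
        (\<forall>f\<in>regular X U. openin (space X) {x\<in>U. f x \<noteq> 0} \<and>
            (\<lambda>x. inverse (f x)) \<in> regular X {x\<in>U. f x \<noteq> 0})"
    using X[unfolded space_with_functions_def, THEN conjunct2, THEN conjunct2] U by (elim allE[of _ U] impE)
  note c = *[THEN conjunct1] and a = *[THEN conjunct2, THEN conjunct1]
    and i = *[THEN conjunct2, THEN conjunct2]
  show "(\<lambda>_. to_ac c) \<in> regular X U" by (rule c[THEN spec])
  show "f \<in> regular X U \<Longrightarrow> g \<in> regular X U \<Longrightarrow> (\<lambda>x. f x + g x) \<in> regular X U"
    by (rule a[THEN bspec, THEN bspec, THEN conjunct1])
  show "f \<in> regular X U \<Longrightarrow> g \<in> regular X U \<Longrightarrow> (\<lambda>x. f x * g x) \<in> regular X U"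
    by (rule a[THEN bspec, THEN bspec, THEN conjunct2])
  show "f \<in> regular X U \<Longrightarrow> openin (space X) {x\<in>U. f x \<noteq> 0}"
    by (rule i[THEN bspec, THEN conjunct1])
  show "f \<in> regular X U \<Longrightarrow> (\<lambda>x. inverse (f x)) \<in> regular X {x\<in>U. f x \<noteq> 0}"
    by (rule i[THEN bspec, THEN conjunct2])
qed

lemma regular_mp_eval:
  assumes X: "space_with_functions X" and U: "openin (space X) U"
    and reg: "\<And>i. (\<lambda>x. \<phi> x i) \<in> regular X U"
  shows "(\<lambda>x. mp_eval p (\<phi> x)) \<in> regular X U"
proof -
  note c = regular_const[OF X U] and a = regular_add[OF X U] and m = regular_mult[OF X U]
  have pw: "(\<lambda>x. \<phi> x i ^ n) \<in> regular X U" for i n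
    using m[OF reg] c[of 1] by (induction n) auto
  have pr: "(\<lambda>x. \<Prod>i\<in>A. \<phi> x i ^ n i) \<in> regular X U" for A n
    using m[OF pw] c[of 1] by (induction A rule: infinite_finite_induct) auto
  have "(\<lambda>x. \<Sum>m\<in>A. to_ac (Poly_Mapping.lookup p m) * (\<Prod>i\<in>Poly_Mapping.keys m. \<phi> x i ^ Poly_Mapping.lookup m i)) \<in> regular X U" for A
    using a[OF m[OF c pr]] c[of 0] by (induction A rule: infinite_finite_induct) auto
  then show ?thesis by (simp add: mp_eval_def)
qed

lemma morphism_into_zero_locus:
  assumes X: "space_with_functions X"
    and pts: "\<And>x. x \<in> topspace (space X) \<Longrightarrow> \<phi> x \<in> zero_set E F"
    and reg: "\<And>i. (\<lambda>x. \<phi> x i) \<in> regular X (topspace (space X))"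
  shows "morphism X (zero_locus E F) \<phi>"
proof -
  let ?Y = "zero_locus E F"
  let ?T = "topspace (space X)"
  have ev: "(\<lambda>x. mp_eval p (\<phi> x)) \<in> regular X ?T" for p
    by (rule regular_mp_eval[OF X _ reg]) simp
  have restr: "f \<in> regular X V" if "f \<in> regular X U" "openin (space X) U" "openin (space X) V"
    "V \<subseteq> U" for f U V
    by (rule regular_restrict[OF X that(2,3,4,1)])
  have D: "openin (space X) {x\<in>?T. mp_eval p (\<phi> x) \<noteq> 0}"
    and Di: "(\<lambda>x. inverse (mp_eval p (\<phi> x))) \<in> regular X {x\<in>?T. mp_eval p (\<phi> x) \<noteq> 0}" for p
    by (rule openin_nonzero[OF X openin_topspace ev], rule regular_inverse[OF X openin_topspace ev])
  have cont: "openin (space X) {x\<in>?T. \<phi> x \<in> V}" if V: "openin (space ?Y) V" for V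
  proof (subst openin_subopen, intro ballI)
    fix x assume x: "x \<in> {x\<in>?T. \<phi> x \<in> V}"
    then obtain p where p: "mp_eval p (\<phi> x) \<noteq> 0" "{y\<in>zero_set E F. mp_eval p y \<noteq> 0} \<subseteq> V"
      using V by (auto simp: openin_zero_locus)
    then have "x \<in> {x\<in>?T. mp_eval p (\<phi> x) \<noteq> 0}" "{x\<in>?T. mp_eval p (\<phi> x) \<noteq> 0} \<subseteq> {x\<in>?T. \<phi> x \<in> V}"
      using x pts by auto
    then show "\<exists>T. openin (space X) T \<and> x \<in> T \<and> T \<subseteq> {x\<in>?T. \<phi> x \<in> V}" using D by blast
  qed
  have "f \<circ> \<phi> \<in> regular X {x\<in>?T. \<phi> x \<in> V}"
    if V: "openin (space ?Y) V" and f: "f \<in> regular ?Y V" for V f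
  proof -
    let ?U = "{x\<in>?T. \<phi> x \<in> V}"
    have "\<exists>W. openin (space X) W \<and> x \<in> W \<and> W \<subseteq> ?U \<and> (\<exists>g\<in>regular X W. \<forall>y\<in>W. (f \<circ> \<phi>) y = g y)"
      if x: "x \<in> ?U" for x
    proof -
      obtain p q where pq: "mp_eval q (\<phi> x) \<noteq> 0"
        "\<forall>y\<in>V. mp_eval q y \<noteq> 0 \<longrightarrow> f y = mp_eval p y / mp_eval q y"
        using f x unfolding regular_zero_locus_iff[OF V] by blast
      let ?D = "{x\<in>?T. mp_eval q (\<phi> x) \<noteq> 0}"
      have o: "openin (space X) (?U \<inter> ?D)" using cont[OF V] D by blast
      have "(\<lambda>x. mp_eval p (\<phi> x)) \<in> regular X (?U \<inter> ?D)"
        by (rule restr[OF ev]) (use o in auto)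
      moreover have "(\<lambda>x. inverse (mp_eval q (\<phi> x))) \<in> regular X (?U \<inter> ?D)"
        by (rule restr[OF Di]) (use o D in auto)
      ultimately have "(\<lambda>x. mp_eval p (\<phi> x) * inverse (mp_eval q (\<phi> x))) \<in> regular X (?U \<inter> ?D)"
        by (rule regular_mult[OF X o])
      moreover have "\<forall>y\<in>?U \<inter> ?D. (f \<circ> \<phi>) y = mp_eval p (\<phi> y) * inverse (mp_eval q (\<phi> y))"
        using pq by (auto simp: divide_inverse)
      ultimately show ?thesis using o x pq(1)
        by (intro exI[of _ "?U \<inter> ?D"]) auto
    qed
    then show ?thesis by (rule regular_glue[OF X cont[OF V]])
  qed
  moreover have "continuous_map (space X) (space ?Y) \<phi>"
    unfolding continuous_map using pts cont by auto
  ultimately show ?thesis unfolding morphism_def by blast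
qed

lemma coordinate_regular:
  assumes "morphism X (zero_locus E F) \<phi>"
  shows "(\<lambda>x. \<phi> x i) \<in> regular X (topspace (space X))"
proof -
  let ?Y = "zero_locus E F"
  have "(\<lambda>x. x i) \<in> regular ?Y (topspace (space ?Y))"
    unfolding regular_zero_locus_iff[OF openin_topspace]
    by (intro ballI exI[of _ "mvar i"] exI[of _ 1]) simp
  then have "(\<lambda>x. x i) \<circ> \<phi> \<in> regular X {x\<in>topspace (space X). \<phi> x \<in> topspace (space ?Y)}"
    using assms openin_topspace[of "space ?Y"] unfolding morphism_def by blast
  moreover have "{x\<in>topspace (space X). \<phi> x \<in> topspace (space ?Y)} = topspace (space X)"
    using assms unfolding morphism_def continuous_map by auto
  ultimately show ?thesis by (simp add: comp_def)
qed

lemma variety_zero_locus: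
  fixes F :: "'k::field mpoly set"
  assumes E: "finite E" and F: "finite F"
  shows "variety (zero_locus E F)"
proof -
  let ?X = "zero_locus E F"
  obtain m where m: "\<And>i. i \<in> E \<Longrightarrow> i < m" using E by (meson finite_nat_set_iff_bounded)
  have m_notin: "i + m \<notin> E" for i using m[of "i + m"] by auto
  define p :: "'k point \<Rightarrow> 'k point" where "p = (\<lambda>x i. if i \<in> E then x i else 0)"
  define q :: "'k point \<Rightarrow> 'k point" where "q = (\<lambda>x i. if i \<in> E then x (i + m) else 0)"
  define sp :: "nat \<Rightarrow> 'k mpoly" where "sp = (\<lambda>i. if i \<in> E then mvar i else 0)"
  define sq :: "nat \<Rightarrow> 'k mpoly" where "sq = (\<lambda>i. if i \<in> E then mvar (i + m) else 0)"
  have p_eq: "p x = (\<lambda>i. mp_eval (sp i) x)" and q_eq: "q x = (\<lambda>i. mp_eval (sq i) x)" for x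
    by (auto simp: p_def q_def sp_def sq_def)
  obtain P where P: "\<And>f x. mp_eval (P f) x = mp_eval f (p x)"
    using mp_eval_subst[of _ sp] unfolding p_eq by metis
  obtain Q where Q: "\<And>f x. mp_eval (Q f) x = mp_eval f (q x)"
    using mp_eval_subst[of _ sq] unfolding q_eq by metis
  define E2 where "E2 = E \<union> (\<lambda>i. i + m) ` E"
  define F2 where "F2 = P ` F \<union> Q ` F"
  let ?P = "zero_locus E2 F2"
  have fin: "finite E2" "finite F2" using E F by (auto simp: E2_def F2_def)
  have z2: "x \<in> zero_set E2 F2 \<longleftrightarrow> x \<in> affine_points E2 \<and> p x \<in> zero_set E F \<and> q x \<in> zero_set E F"
    for x
  proof -
    have "p x \<in> affine_points E" "q x \<in> affine_points E"
      by (auto simp: p_def q_def affine_points_def)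
    moreover have "(\<forall>f\<in>F2. mp_eval f x = 0) \<longleftrightarrow>
        (\<forall>f\<in>F. mp_eval f (p x) = 0) \<and> (\<forall>f\<in>F. mp_eval f (q x) = 0)"
      unfolding F2_def ball_Un by (simp add: P Q)
    ultimately show ?thesis by (auto simp: zero_set_def)
  qed
  have coord: "(\<lambda>x. mp_eval f x) \<in> regular ?P (topspace (space ?P))" for f
    unfolding regular_zero_locus_iff[OF openin_topspace]
    by (intro ballI exI[of _ f] exI[of _ 1]) simp
  have mp: "morphism ?P ?X p"
    by (rule morphism_into_zero_locus[OF space_with_functions_zero_locus])
       (use z2 coord in \<open>auto simp: p_eq\<close>)
  have mq: "morphism ?P ?X q"
    by (rule morphism_into_zero_locus[OF space_with_functions_zero_locus])
       (use z2 coord in \<open>auto simp: q_eq\<close>)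
  have prod: "is_product ?P p q ?X ?X"
    unfolding is_product_def
  proof (intro conjI allI impI prevariety_zero_locus fin mp mq)
    fix Z a b
    assume "prevariety Z \<and> morphism Z ?X a \<and> morphism Z ?X b"
    then have Z: "space_with_functions Z" and a: "morphism Z ?X a" and b: "morphism Z ?X b"
      by (auto simp: prevariety_def)
    define c where "c = (\<lambda>z i. if i \<in> E then a z i else if i \<in> (\<lambda>i. i + m) ` E then b z (i - m) else 0)"
    have ab: "a z \<in> zero_set E F" "b z \<in> zero_set E F" if "z \<in> topspace (space Z)" for z
      using a b that by (auto simp: morphism_def continuous_map)
    have pc: "p (c z) = a z \<and> q (c z) = b z" if z: "z \<in> topspace (space Z)" for z
    proof (intro conjI ext)
      fix i
      have "a z i = 0 \<and> b z i = 0" if "i \<notin> E"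
        using ab[OF z] that by (simp add: zero_set_def affine_points_def)
      moreover have "c z i = a z i \<and> c z (i + m) = b z i" if "i \<in> E"
        using that m_notin[of i] by (simp add: c_def)
      ultimately show "p (c z) i = a z i" "q (c z) i = b z i"
        by (simp_all add: p_def q_def)
    qed
    have "(\<lambda>z. to_ac 0) \<in> regular Z (topspace (space Z))"
      by (rule regular_const[OF Z openin_topspace])
    then have creg: "(\<lambda>z. c z i) \<in> regular Z (topspace (space Z))" for i
      using coordinate_regular[OF a] coordinate_regular[OF b]
      by (cases "i \<in> E"; cases "i \<in> (\<lambda>i. i + m) ` E") (simp_all add: c_def)
    have "morphism Z ?P c"
    proof (rule morphism_into_zero_locus[OF Z _ creg])
      fix z assume "z \<in> topspace (space Z)"
      then show "c z \<in> zero_set E2 F2"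
        unfolding z2 using pc ab by (auto simp: affine_points_def c_def E2_def)
    qed
    moreover have "c' z = c z"
      if c': "morphism Z ?P c'" and e: "\<forall>z\<in>topspace (space Z). p (c' z) = a z \<and> q (c' z) = b z"
        and z: "z \<in> topspace (space Z)" for c' z
    proof
      fix i
      have "c' z \<in> zero_set E2 F2" using c' z by (auto simp: morphism_def continuous_map)
      then have 1: "i \<notin> E \<Longrightarrow> i \<notin> (\<lambda>i. i + m) ` E \<Longrightarrow> c' z i = 0"
        by (simp add: zero_set_def affine_points_def E2_def)
      have "p (c' z) i = a z i" and qj: "q (c' z) j = b z j" for j using e z by auto
      then have 2: "c' z i = a z i" if "i \<in> E" using that by (simp add: p_def)
      have 3: "c' z (j + m) = b z j" if "j \<in> E" for j
        using that qj[of j] by (simp add: q_def)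
      show "c' z i = c z i"
        using 1 2 3 by (cases "i \<in> E"; cases "i \<in> (\<lambda>i. i + m) ` E") (auto simp: c_def)
    qed
    ultimately show "\<exists>c. (morphism Z ?P c \<and> (\<forall>z\<in>topspace (space Z). p (c z) = a z \<and> q (c z) = b z)) \<and>
        (\<forall>c'. morphism Z ?P c' \<and> (\<forall>z\<in>topspace (space Z). p (c' z) = a z \<and> q (c' z) = b z)
             \<longrightarrow> (\<forall>z\<in>topspace (space Z). c' z = c z))"
      using pc by blast
  qed
  have "openin (space ?P) {x\<in>zero_set E2 F2. p x \<noteq> q x}"
    unfolding openin_zero_locus
  proof (intro conjI ballI)
    fix x assume "x \<in> {x\<in>zero_set E2 F2. p x \<noteq> q x}"
    then obtain i where "p x i \<noteq> q x i" by fastforce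
    then show "\<exists>f. mp_eval f x \<noteq> 0 \<and>
        {y\<in>zero_set E2 F2. mp_eval f y \<noteq> 0} \<subseteq> {x\<in>zero_set E2 F2. p x \<noteq> q x}"
      by (intro exI[of _ "sp i - sq i"]) (auto simp: p_eq q_eq fun_eq_iff)
  qed auto
  moreover have "topspace (space ?P) - {x\<in>topspace (space ?P). p x = q x} = {x\<in>zero_set E2 F2. p x \<noteq> q x}"
    by auto
  ultimately have "closedin (space ?P) {x\<in>topspace (space ?P). p x = q x}"
    unfolding closedin_def by auto
  then have "separated ?X" unfolding separated_def using prod by blast
  then show ?thesis unfolding variety_def using prevariety_zero_locus[OF E F] by blast
qed


section \<open>The Grothendieck ring of varieties\<close>

typedef (overloaded) 'k variety = "{X :: 'k::field fspace. variety X}"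
  using variety_zero_locus[of "{}" "{}"] by blast

text \<open>
  The Grothendieck ring is the free commutative ring on the symbols of varieties, modulo
  isomorphism, the scissor relations, \<open>[X] [Y] = [X \<times> Y]\<close> and \<open>[point] = 1\<close>.
  Additively this is the free abelian group on isomorphism classes modulo the scissor relations,
  because products turn scissor relations into scissor relations.
\<close>

type_synonym 'k symring = "('k variety \<Rightarrow>\<^sub>0 nat) \<Rightarrow>\<^sub>0 int"

definition symb :: "'k::field variety \<Rightarrow> 'k symring" where
  "symb X = Poly_Mapping.single (Poly_Mapping.single X 1) 1"

inductive_set K0_relations :: "'k::field symring set" where
  iso: "isomorphic (Rep_variety X) (Rep_variety Y) \<Longrightarrow> symb X - symb Y \<in> K0_relations"
| scissor: "\<lbrakk>closedin (space (Rep_variety X)) S;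
     Rep_variety Z = induced (Rep_variety X) S;
     Rep_variety U = induced (Rep_variety X) (topspace (space (Rep_variety X)) - S)\<rbrakk>
   \<Longrightarrow> symb X - (symb Z + symb U) \<in> K0_relations"
| product: "is_product (Rep_variety P) p q (Rep_variety X) (Rep_variety Y)
   \<Longrightarrow> symb X * symb Y - symb P \<in> K0_relations"
| point: "Rep_variety X = zero_locus {} {} \<Longrightarrow> symb X - 1 \<in> K0_relations"

inductive_set K0_ideal :: "'k::field symring set" where
  zero: "0 \<in> K0_ideal"
| add: "r \<in> K0_relations \<Longrightarrow> a \<in> K0_ideal \<Longrightarrow> c * r + a \<in> K0_ideal"

lemma K0_ideal_add: "a \<in> K0_ideal \<Longrightarrow> b \<in> K0_ideal \<Longrightarrow> a + b \<in> K0_ideal"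
  by (induction a rule: K0_ideal.induct) (auto simp: add.assoc intro: K0_ideal.intros)

lemma K0_ideal_mult: "a \<in> K0_ideal \<Longrightarrow> c * a \<in> K0_ideal"
  by (induction a rule: K0_ideal.induct)
     (auto simp: distrib_left mult.assoc[symmetric] intro: K0_ideal.intros)

lemma K0_ideal_uminus: "a \<in> K0_ideal \<Longrightarrow> - a \<in> K0_ideal"
  using K0_ideal_mult[of a "-1"] by simp

lemma K0_relations_subset: "r \<in> K0_relations \<Longrightarrow> r \<in> K0_ideal"
  using K0_ideal.add[of r 0 1] K0_ideal.zero by simp

definition K0_eq :: "'k::field symring \<Rightarrow> 'k symring \<Rightarrow> bool" where
  "K0_eq a b \<longleftrightarrow> a - b \<in> K0_ideal"

lemma K0_eq_refl: "K0_eq a a"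
  by (simp add: K0_eq_def K0_ideal.zero)

quotient_type (overloaded) 'k K0 = "'k::field symring" / K0_eq
proof (rule equivpI)
  show "reflp (K0_eq :: 'k symring \<Rightarrow> _)" by (simp add: reflp_def K0_eq_def K0_ideal.zero)
  show "symp (K0_eq :: 'k symring \<Rightarrow> _)"
    unfolding symp_def K0_eq_def using K0_ideal_uminus by force
  show "transp (K0_eq :: 'k symring \<Rightarrow> _)"
    unfolding transp_def K0_eq_def using K0_ideal_add by force
qed

text \<open>Nontriviality of the ring is not proved here, so the ring with unit is an instance of
  the classes below rather than of \<open>comm_ring_1\<close>, which includes \<open>0 \<noteq> 1\<close>.\<close>

instantiation K0 :: (field) "{comm_ring, comm_monoid_mult}"
begin

lift_definition zero_K0 :: "'a K0" is 0 .
lift_definition one_K0 :: "'a K0" is 1 .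
lift_definition plus_K0 :: "'a K0 \<Rightarrow> 'a K0 \<Rightarrow> 'a K0" is "(+)"
proof -
  fix a b c d :: "'a symring"
  assume "K0_eq a b" "K0_eq c d"
  then have "(a - b) + (c - d) \<in> K0_ideal" unfolding K0_eq_def by (rule K0_ideal_add)
  moreover have "(a + c) - (b + d) = (a - b) + (c - d)" by simp
  ultimately show "K0_eq (a + c) (b + d)" by (simp only: K0_eq_def)
qed
lift_definition uminus_K0 :: "'a K0 \<Rightarrow> 'a K0" is uminus
proof -
  fix a b :: "'a symring"
  assume "K0_eq a b"
  then have "- (a - b) \<in> K0_ideal" unfolding K0_eq_def by (rule K0_ideal_uminus)
  moreover have "(- a) - (- b) = - (a - b)" by simp
  ultimately show "K0_eq (- a) (- b)" by (simp only: K0_eq_def)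
qed
lift_definition minus_K0 :: "'a K0 \<Rightarrow> 'a K0 \<Rightarrow> 'a K0" is "(-)"
proof -
  fix a b c d :: "'a symring"
  assume "K0_eq a b" "K0_eq c d"
  then have "(a - b) + - (c - d) \<in> K0_ideal"
    unfolding K0_eq_def by (intro K0_ideal_add K0_ideal_uminus)
  moreover have "(a - c) - (b - d) = (a - b) + - (c - d)" by simp
  ultimately show "K0_eq (a - c) (b - d)" by (simp only: K0_eq_def)
qed
lift_definition times_K0 :: "'a K0 \<Rightarrow> 'a K0 \<Rightarrow> 'a K0" is "(*)"
proof -
  fix a b c d :: "'a symring"
  assume "K0_eq a b" "K0_eq c d"
  then have "c * (a - b) + b * (c - d) \<in> K0_ideal"
    unfolding K0_eq_def by (intro K0_ideal_add K0_ideal_mult)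
  moreover have "a * c - b * d = c * (a - b) + b * (c - d)"
    by (simp add: right_diff_distrib mult.commute)
  ultimately show "K0_eq (a * c) (b * d)" by (simp only: K0_eq_def)
qed

instance
proof
  fix a b c :: "'a K0"
  show "a * b * c = a * (b * c)" by transfer (simp add: K0_eq_refl mult.assoc)
  show "a * b = b * a" by transfer (simp add: K0_eq_refl mult.commute)
  show "1 * a = a" by transfer (simp add: K0_eq_refl)
  show "a + b + c = a + (b + c)" by transfer (simp add: K0_eq_refl add.assoc)
  show "a + b = b + a" by transfer (simp add: K0_eq_refl add.commute)
  show "0 + a = a" by transfer (simp add: K0_eq_refl)
  show "- a + a = 0" by transfer (simp add: K0_eq_refl)
  show "a - b = a + - b" by transfer (simp add: K0_eq_refl)
  show "(a + b) * c = a * c + b * c" by transfer (simp add: K0_eq_refl distrib_right)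
qed

end

lift_definition K0_class :: "'k::field variety \<Rightarrow> 'k K0" is symb .

definition locus_class :: "nat set \<Rightarrow> 'k::field mpoly set \<Rightarrow> 'k K0" where
  "locus_class E F = K0_class (Abs_variety (zero_locus E F))"

definition lefschetz :: "'k::field K0" where
  "lefschetz = locus_class {0} {}"

lemma fps_right_inverse_K0:
  fixes f :: "'k::field K0 fps"
  assumes f0: "fps_nth f 0 * y = 1"
  shows "f * fps_right_inverse f y = 1"
proof (rule fps_ext)
  fix n
  show "fps_nth (f * fps_right_inverse f y) n = fps_nth 1 n"
  proof (cases n)
    case 0
    then show ?thesis using f0 by simp
  next
    case (Suc k)
    have "fps_nth f 0 * fps_nth (fps_right_inverse f y) n =
        - (fps_nth f 0 * y * (\<Sum>i=1..n. fps_nth f i * fps_right_inverse_constructor f y (n - i)))"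
      using Suc by (simp add: mult.assoc)
    also have "\<dots> = - (\<Sum>i=1..n. fps_nth f i * fps_right_inverse_constructor f y (n - i))"
      by (simp only: f0 mult_1_left)
    finally show ?thesis using Suc
      by (simp add: fps_mult_nth sum.atLeast_Suc_atMost)
  qed
qed


section \<open>Graphs and graph polynomials\<close>

text \<open>A multigraph is represented by a digraph, which carries a chosen orientation; nothing except the signs in the
  incidence matrix depends on the orientation.\<close>

type_synonym mgraph = "(nat, nat) pre_digraph"

definition linked :: "mgraph \<Rightarrow> nat \<Rightarrow> nat \<Rightarrow> bool" where
  "linked G u v \<longleftrightarrow> reachable (with_proj (mk_symmetric G)) u v"

text \<open>The library predicate \<open>spanning_tree\<close> only forbids directed cycles. Acyclicity is
  expressed by: no edge of \<open>T\<close> has its ends joined by a path of other edges of \<open>T\<close>.\<close>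

definition spanning_trees :: "mgraph \<Rightarrow> nat set set" where
  "spanning_trees G = {T. T \<subseteq> arcs G \<and> Digraph_Component.connected (G\<lparr>arcs := T\<rparr>) \<and>
     (\<forall>e\<in>T. \<not> linked (G\<lparr>arcs := T - {e}\<rparr>) (tail G e) (head G e))}"

definition graph_poly :: "mgraph \<Rightarrow> 'k::field mpoly" where
  "graph_poly G = (if Digraph_Component.connected G
     then \<Sum>T\<in>spanning_trees G. \<Prod>e\<in>arcs G - T. mvar e else 0)"

definition graph_class :: "mgraph \<Rightarrow> 'k::field K0" where
  "graph_class G = locus_class (arcs G) {graph_poly G}"

text \<open>The graph without vertices is not connected, so its graph polynomial is \<open>0\<close>.\<close>

definition zero_graph :: mgraph where
  "zero_graph = \<lparr>verts = {}, arcs = {}, tail = (\<lambda>_. 0), head = (\<lambda>_. 0)\<rparr>"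

definition delete :: "mgraph \<Rightarrow> nat \<Rightarrow> mgraph" where
  "delete G e = pre_digraph.del_arc G e"

definition contract :: "mgraph \<Rightarrow> nat \<Rightarrow> mgraph" where
  "contract G e = (if tail G e = head G e then zero_graph else
     (let \<mu> = (\<lambda>v. if v = head G e then tail G e else v)
      in \<lparr>verts = \<mu> ` verts G, arcs = arcs G - {e}, tail = \<mu> \<circ> tail G, head = \<mu> \<circ> head G\<rparr>))"

definition incidence :: "mgraph \<Rightarrow> nat \<Rightarrow> nat \<Rightarrow> 'k::field mpoly" where
  "incidence G e v = (if v = head G e then 1 else 0) - (if v = tail G e then 1 else 0)"

text \<open>Rows and columns of the graph matrix are labelled by edges (\<open>Inl\<close>) and by all vertices
  but the first one (\<open>Inr\<close>); \<open>a e\<close> is the diagonal entry at the edge \<open>e\<close>.\<close>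

fun graph_matrix_entry :: "mgraph \<Rightarrow> (nat \<Rightarrow> 'k::field mpoly) \<Rightarrow> nat + nat \<Rightarrow> nat + nat \<Rightarrow> 'k mpoly" where
  "graph_matrix_entry G a (Inl e) (Inl e') = (if e = e' then a e else 0)"
| "graph_matrix_entry G a (Inl e) (Inr v) = incidence G e v"
| "graph_matrix_entry G a (Inr v) (Inl e) = - incidence G e v"
| "graph_matrix_entry G a (Inr v) (Inr v') = 0"

definition graph_matrix_labels :: "mgraph \<Rightarrow> (nat + nat) list" where
  "graph_matrix_labels G = map Inl (sorted_list_of_set (arcs G)) @
     map Inr (tl (sorted_list_of_set (verts G)))"

text \<open>\<open>dodgson G i j l\<close> is \<open>\<Psi>\<^bsup>i,j\<^esup>\<^bsub>G,l\<^esub>\<close>; the sign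
  left open by the choice of orientation, orderings and removed vertex does not affect zero loci.\<close>

definition dodgson :: "mgraph \<Rightarrow> nat \<Rightarrow> nat \<Rightarrow> nat \<Rightarrow> 'k::field mpoly" where
  "dodgson G i j l =
     (let R = remove1 (Inl i) (graph_matrix_labels G); C = remove1 (Inl j) (graph_matrix_labels G)
      in det (mat (length R) (length C)
           (\<lambda>(r, c). graph_matrix_entry G (mvar(l := 0)) (R ! r) (C ! c))))"

definition incident_edges :: "mgraph \<Rightarrow> nat \<Rightarrow> nat set" where
  "incident_edges G v = {e\<in>arcs G. tail G e = v \<or> head G e = v}"

text \<open>The class \<open>\<langle>G\<rangle>\<^sub>v\<close> at a three-valent vertex, whose edges are numbered in increasing order.\<close>

definition vertex_class :: "mgraph \<Rightarrow> nat \<Rightarrow> 'k::field K0" where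
  "vertex_class G v =
     (let es = sorted_list_of_set (incident_edges G v); e1 = es ! 0; e2 = es ! 1; e3 = es ! 2
      in locus_class (arcs G - {e1, e2, e3})
        {graph_poly (contract (delete (delete G e1) e2) e3),
         dodgson G e2 e3 e1,
         dodgson G e1 e3 e2,
         dodgson G e1 e2 e3,
         graph_poly (contract (contract (contract G e1) e2) e3)})"


section \<open>Wheels\<close>

text \<open>Rim vertices \<open>0, \<dots>, n - 1\<close>, hub \<open>n\<close>; the edge \<open>i < n\<close> joins
  \<open>i\<close> to its successor on the rim, the edge \<open>n + i\<close> is the spoke at \<open>i\<close>.\<close>

definition wheel :: "nat \<Rightarrow> mgraph" where
  "wheel n = \<lparr>verts = {..n}, arcs = {..<2 * n},
     tail = (\<lambda>e. if e < n then e else e - n),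
     head = (\<lambda>e. if e < n then (e + 1) mod n else n)\<rparr>"

text \<open>The vertex \<open>0\<close> plays the role of \<open>r\<^sub>1\<close>; the label \<open>n\<close> of the contracted spoke is unused.\<close>

definition contracted_wheel :: "nat \<Rightarrow> mgraph" where
  "contracted_wheel n = \<lparr>verts = {..<n}, arcs = {..<2 * n} - {n},
     tail = (\<lambda>e. if e < n then e else e - n),
     head = (\<lambda>e. if e < n then (e + 1) mod n else 0)\<rparr>"

lemma contracted_wheel_eq_contract:
  assumes "n \<ge> 1"
  shows "verts (contracted_wheel n) = verts (contract (wheel n) n)"
    and "arcs (contracted_wheel n) = arcs (contract (wheel n) n)"
    and "e \<in> arcs (contracted_wheel n) \<Longrightarrow>
      tail (contracted_wheel n) e = tail (contract (wheel n) n) e \<and>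
      head (contracted_wheel n) e = head (contract (wheel n) n) e"
proof -
  let ?\<mu> = "\<lambda>v. if v = n then 0 else v"
  have c: "contract (wheel n) n = \<lparr>verts = ?\<mu> ` {..n}, arcs = {..<2 * n} - {n},
      tail = ?\<mu> \<circ> tail (wheel n), head = ?\<mu> \<circ> head (wheel n)\<rparr>"
  proof -
    have "tail (wheel n) n = 0" "head (wheel n) n = n" "verts (wheel n) = {..n}"
      "arcs (wheel n) = {..<2 * n}" by (simp_all add: wheel_def)
    then show ?thesis using assms by (simp add: contract_def Let_def cong del: if_weak_cong)
  qed
  have "?\<mu> ` {..n} = {..<n}"
    using assms by (auto simp: image_iff)
  then show "verts (contracted_wheel n) = verts (contract (wheel n) n)"
    by (simp only: c contracted_wheel_def pre_digraph.select_convs)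
  show "arcs (contracted_wheel n) = arcs (contract (wheel n) n)"
    by (simp only: c contracted_wheel_def pre_digraph.select_convs)
  assume "e \<in> arcs (contracted_wheel n)"
  then have e: "e < 2 * n" "e \<noteq> n" by (auto simp: contracted_wheel_def)
  have m: "(e + 1) mod n \<noteq> n" using assms mod_less_divisor[of n "e + 1"] by linarith
  show "tail (contracted_wheel n) e = tail (contract (wheel n) n) e \<and>
      head (contracted_wheel n) e = head (contract (wheel n) n) e"
    unfolding c using e m by (auto simp: contracted_wheel_def wheel_def)
qed

definition w_series :: "'k::field K0 fps" where
  "w_series = Abs_fps (\<lambda>n. if n = 0 then 0 else if n = 1 then lefschetz
     else if n = 2 then lefschetz ^ 3 else graph_class (wheel n))"

definition b_series :: "'k::field K0 fps" where
  "b_series = Abs_fps (\<lambda>n. if n = 0 then 0 else if n = 1 then 1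
     else graph_class (contracted_wheel n))"

text \<open>The function \<open>v\<close> selects a rim vertex of each wheel.\<close>

definition w_hat_series :: "(nat \<Rightarrow> nat) \<Rightarrow> 'k::field K0 fps" where
  "w_hat_series v = Abs_fps (\<lambda>n. if n \<le> 2 then 0 else vertex_class (wheel n) (v n))"

end

theory Submission
  imports Defs
begin

text \<open>
  Why the identity holds. For a connected graph, \<open>\<Psi>\<^sub>G(x)\<close> is the determinant of \<open>M\<^sub>G(x)\<close> (\<open>matrix_tree\<close>),
  so it vanishes exactly if there are a flow \<open>Y\<close> on the edges and a potential \<open>\<phi>\<close>, not both zero
  up to constants, such that \<open>x\<^sub>e Y\<^sub>e\<close> is the potential difference along each edge \<open>e\<close>; the Dodgson
  polynomials are treated in the same way, with one equation and one unknown left out. On a wheel a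
  flow is determined by its values \<open>c\<^sub>k\<close> on the rim edges, and eliminating the potential leaves the
  cyclic tridiagonal system
  \<open>a\<^sub>k c\<^sub>k = s\<^sub>k c\<^sub>k\<^sub>-\<^sub>1 + s\<^sub>k\<^sub>+\<^sub>1 c\<^sub>k\<^sub>+\<^sub>1\<close> with \<open>a\<^sub>k = r\<^sub>k + s\<^sub>k + s\<^sub>k\<^sub>+\<^sub>1\<close>, where \<open>r\<close> and \<open>s\<close> are the rim and spoke
  variables. Since \<open>r\<^sub>k \<mapsto> a\<^sub>k\<close> is a linear change of coordinates, all loci of the theorem become loci of
  generic tridiagonal matrices, described by continuants \<open>K(i..j)\<close>:
  \<open>[B\<^sub>n]\<close> belongs to \<open>K(1..n) = 0\<close>, because the contracted spoke opens the cycle; \<open>[W\<^sub>n\<^sub>+\<^sub>1]\<close> belongs to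
  \<open>a\<^sub>0 K(1..n) = s\<^sub>1\<^sup>2 K(2..n) + s\<^sub>0\<^sup>2 K(1..n-1) + 2 s\<^sub>0 s\<^sub>1 s\<^sub>2 \<dots> s\<^sub>n\<close>; and with \<open>m = n - 2\<close> the five conditions
  of \<open>\<langle>W\<^sub>n\<rangle>\<close> amount to
  \<open>K(1..m) = s\<^sub>1 K(2..m) = s\<^sub>m\<^sub>+\<^sub>1 K(1..m-1) = s\<^sub>1 s\<^sub>m\<^sub>+\<^sub>1 K(2..m-1) = 0\<close>.

  Let \<open>b\<^sub>m, c\<^sub>m, e\<^sub>m, d\<^sub>m\<close> be the classes of the loci where, respectively, \<open>K(1..m)\<close> vanishes, also
  \<open>K(1..m-1)\<close> vanishes, also \<open>K(2..m)\<close> vanishes, and also \<open>K(2..m-1)\<close> vanishes. Continuants are affine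
  in their last diagonal entry, so cutting the loci by the vanishing of its coefficient and of the last
  coupling gives linear recurrences for these classes. The same cutting gives
  \<open>[W\<^sub>n\<^sub>+\<^sub>1] = L\<^sup>2\<^sup>n\<^sup>+\<^sup>1 + L\<^sup>2(L - 1) e\<^sub>n\<close> (\<open>periodic_class\<close>): the decisive point is that on \<open>K(1..n) = 0\<close> the
  quadratic form in \<open>s\<^sub>0, s\<^sub>1\<close> has discriminant zero, hence is a square up to a factor. Finally
  \<open>\<langle>W\<^sub>n\<rangle> = b\<^sub>m + 2(L - 1) c\<^sub>m + (L - 1)\<^sup>2 d\<^sub>m\<close> (\<open>vertex_locus_class\<close>). Multiplied by \<open>1 + (L - 1) t\<close>, the claim
  says that \<open>w\<^sub>n\<^sub>+\<^sub>1 + (L - 1) w\<^sub>n\<close> is a certain combination of \<open>\<langle>W\<^sub>n\<rangle>\<close>, \<open>b\<^sub>n\<close> and \<open>b\<^sub>n\<^sub>-\<^sub>2\<close>, which follows from the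
  recurrences by polynomial arithmetic (\<open>wheel_recurrence_algebra\<close>).
\<close>

section \<open>Locally closed subsets of affine space\<close>

subsection \<open>Morphisms of spaces with functions\<close>

text \<open>On open subsets affine space has the same regular functions as the zero locus of no equations.\<close>

lemma space_with_functions_affine_space:
  "space_with_functions (affine_space E :: 'k::field fspace)"
proof -
  let ?A = "affine_space E :: 'k fspace" and ?Z = "zero_locus E {} :: 'k fspace"
  note Z = space_with_functions_zero_locus[of E "{}"]
  have sp: "space ?Z = space ?A"
    by (simp add: zero_locus_def induced_def zero_set_def)
       (metis subtopology_topspace topspace_affine_space)
  have reg: "f \<in> regular ?A U \<longleftrightarrow> f \<in> regular ?Z U" if "openin (space ?A) U" for f U
    using that by (simp add: regular_affine_space_iff regular_zero_locus_iff sp)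
  show ?thesis
    unfolding space_with_functions_def
  proof (intro conjI allI impI ballI; (elim conjE)?)
    fix U V f assume "openin (space ?A) U" "openin (space ?A) V" "V \<subseteq> U" "f \<in> regular ?A U"
    then show "f \<in> regular ?A V"
      using regular_restrict[OF Z, of U V f] reg[of U f] reg[of V f] unfolding sp by blast
  next
    fix U f
    assume U: "openin (space ?A) U" and
      loc: "\<forall>x\<in>U. \<exists>V. openin (space ?A) V \<and> x \<in> V \<and> V \<subseteq> U \<and> (\<exists>g\<in>regular ?A V. \<forall>y\<in>V. f y = g y)"
    show "f \<in> regular ?A U" unfolding reg[OF U]
    proof (rule regular_glue[OF Z])
      fix x assume "x \<in> U"
      then obtain V g where V: "openin (space ?A) V" "x \<in> V" "V \<subseteq> U" "g \<in> regular ?A V"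
        "\<forall>y\<in>V. f y = g y" using loc by meson
      then show "\<exists>V. openin (space ?Z) V \<and> x \<in> V \<and> V \<subseteq> U \<and> (\<exists>g\<in>regular ?Z V. \<forall>y\<in>V. f y = g y)"
        using reg[OF V(1), of g] unfolding sp by blast
    qed (simp add: U sp)
  next
    fix U c assume U: "openin (space ?A) U"
    show "(\<lambda>_. to_ac c) \<in> regular ?A U"
      unfolding reg[OF U] by (rule regular_const[OF Z]) (simp add: U sp)
  next
    fix U f g assume U: "openin (space ?A) U" and fg: "f \<in> regular ?A U" "g \<in> regular ?A U"
    show "(\<lambda>x. f x + g x) \<in> regular ?A U" "(\<lambda>x. f x * g x) \<in> regular ?A U"
      using regular_add[OF Z, of U f g] regular_mult[OF Z, of U f g] fg U unfolding reg[OF U] sp by blast+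
  next
    fix U f assume U: "openin (space ?A) U" and f: "f \<in> regular ?A U"
    show o: "openin (space ?A) {x\<in>U. f x \<noteq> 0}"
      using f openin_nonzero[OF Z, of U f] U unfolding reg[OF U] sp by blast
    show "(\<lambda>x. inverse (f x)) \<in> regular ?A {x\<in>U. f x \<noteq> 0}"
      using f regular_inverse[OF Z, of U f] U unfolding reg[OF U] reg[OF o] sp by blast
  qed
qed

lemma space_induced: "space (induced X S) = subtopology (space X) S"
  by (simp add: induced_def)

lemma regular_induced_iff:
  "f \<in> regular (induced X S) V \<longleftrightarrow>
    (\<forall>x\<in>V. \<exists>W g. openin (space X) W \<and> x \<in> W \<and> g \<in> regular X W \<and> (\<forall>y\<in>W \<inter> V. f y = g y))"
  by (simp add: induced_def)

lemma space_with_functions_induced: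
  assumes X: "space_with_functions X"
  shows "space_with_functions (induced X S)"
proof -
  let ?Y = "induced X S"
  have open_iff: "openin (space ?Y) U \<longleftrightarrow> (\<exists>T. openin (space X) T \<and> U = T \<inter> S)" for U
    by (simp add: space_induced openin_subtopology)
  have both: "\<exists>W f' g'. openin (space X) W \<and> x \<in> W \<and> f' \<in> regular X W \<and> g' \<in> regular X W \<and>
      (\<forall>y\<in>W \<inter> U. f y = f' y \<and> g y = g' y)"
    if f: "f \<in> regular ?Y U" and g: "g \<in> regular ?Y U" and x: "x \<in> U" for f g U x
  proof -
    obtain W1 f' where 1: "openin (space X) W1" "x \<in> W1" "f' \<in> regular X W1" "\<forall>y\<in>W1 \<inter> U. f y = f' y"
      using f x unfolding regular_induced_iff by blast
    obtain W2 g' where 2: "openin (space X) W2" "x \<in> W2" "g' \<in> regular X W2" "\<forall>y\<in>W2 \<inter> U. g y = g' y"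
      using g x unfolding regular_induced_iff by blast
    have o: "openin (space X) (W1 \<inter> W2)" using 1 2 by blast
    have "f' \<in> regular X (W1 \<inter> W2)" "g' \<in> regular X (W1 \<inter> W2)"
      using regular_restrict[OF X 1(1) o _ 1(3)] regular_restrict[OF X 2(1) o _ 2(3)] by auto
    then show ?thesis using 1 2 o by blast
  qed
  show ?thesis
    unfolding space_with_functions_def
  proof (intro conjI allI impI ballI; (elim conjE)?)
    fix U V f assume VU: "V \<subseteq> U" and f: "f \<in> regular ?Y U"
    show "f \<in> regular ?Y V" unfolding regular_induced_iff
    proof
      fix x assume "x \<in> V"
      then obtain W g where "openin (space X) W" "x \<in> W" "g \<in> regular X W" "\<forall>y\<in>W \<inter> U. f y = g y"
        using f VU unfolding regular_induced_iff by blast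
      then show "\<exists>W g. openin (space X) W \<and> x \<in> W \<and> g \<in> regular X W \<and> (\<forall>y\<in>W \<inter> V. f y = g y)"
        using VU by (intro exI[of _ W] exI[of _ g]) auto
    qed
  next
    fix U f
    assume U: "openin (space ?Y) U" and
      loc: "\<forall>x\<in>U. \<exists>V. openin (space ?Y) V \<and> x \<in> V \<and> V \<subseteq> U \<and> (\<exists>g\<in>regular ?Y V. \<forall>y\<in>V. f y = g y)"
    show "f \<in> regular ?Y U" unfolding regular_induced_iff
    proof
      fix x assume "x \<in> U"
      then obtain V h where V: "openin (space ?Y) V" "x \<in> V" "V \<subseteq> U" "h \<in> regular ?Y V"
        "\<forall>y\<in>V. f y = h y" using loc by meson
      obtain W g where W: "openin (space X) W" "x \<in> W" "g \<in> regular X W" "\<forall>y\<in>W \<inter> V. h y = g y"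
        using V(2,4) unfolding regular_induced_iff by blast
      obtain T where T: "openin (space X) T" "V = T \<inter> S" using V(1) open_iff by blast
      have o: "openin (space X) (W \<inter> T)" using W T by blast
      have "U \<subseteq> S" using U open_iff by blast
      then have "\<forall>y\<in>W \<inter> T \<inter> U. f y = g y" using W(4) V(5) T(2) by auto
      moreover have "g \<in> regular X (W \<inter> T)" using regular_restrict[OF X W(1) o _ W(3)] by auto
      ultimately show "\<exists>W g. openin (space X) W \<and> x \<in> W \<and> g \<in> regular X W \<and> (\<forall>y\<in>W \<inter> U. f y = g y)"
        using o W(2) V(2) T(2) by blast
    qed
  next
    fix U c assume "openin (space ?Y) U"
    then obtain T where "openin (space X) T" "U = T \<inter> S" using open_iff by blast
    then show "(\<lambda>_. to_ac c) \<in> regular ?Y U"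
      unfolding regular_induced_iff using regular_const[OF X] by blast
  next
    fix U f g assume "f \<in> regular ?Y U" "g \<in> regular ?Y U"
    note b = both[OF this]
    show "(\<lambda>x. f x + g x) \<in> regular ?Y U" unfolding regular_induced_iff
    proof
      fix x assume "x \<in> U"
      then obtain W f' g' where "openin (space X) W" "x \<in> W" "f' \<in> regular X W" "g' \<in> regular X W"
        "\<forall>y\<in>W \<inter> U. f y = f' y \<and> g y = g' y" using b[OF \<open>x \<in> U\<close>] by blast
      then show "\<exists>W h. openin (space X) W \<and> x \<in> W \<and> h \<in> regular X W \<and> (\<forall>y\<in>W \<inter> U. f y + g y = h y)"
        by (intro exI[of _ W] exI[of _ "\<lambda>x. f' x + g' x"] conjI regular_add[OF X]) simp_all
    qed
    show "(\<lambda>x. f x * g x) \<in> regular ?Y U" unfolding regular_induced_iff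
    proof
      fix x assume "x \<in> U"
      then obtain W f' g' where "openin (space X) W" "x \<in> W" "f' \<in> regular X W" "g' \<in> regular X W"
        "\<forall>y\<in>W \<inter> U. f y = f' y \<and> g y = g' y" using b[OF \<open>x \<in> U\<close>] by blast
      then show "\<exists>W h. openin (space X) W \<and> x \<in> W \<and> h \<in> regular X W \<and> (\<forall>y\<in>W \<inter> U. f y * g y = h y)"
        by (intro exI[of _ W] exI[of _ "\<lambda>x. f' x * g' x"] conjI regular_mult[OF X]) simp_all
    qed
  next
    fix U f assume U: "openin (space ?Y) U" and f: "f \<in> regular ?Y U"
    have *: "\<exists>W g. openin (space X) W \<and> x \<in> W \<and> (\<lambda>x. inverse (g x)) \<in> regular X W \<and>
        (\<forall>y\<in>W. g y \<noteq> 0) \<and> (\<forall>y\<in>W \<inter> U. f y = g y)" if x: "x \<in> U" "f x \<noteq> 0" for x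
    proof -
      obtain W g where W: "openin (space X) W" "x \<in> W" "g \<in> regular X W" "\<forall>y\<in>W \<inter> U. f y = g y"
        using f x unfolding regular_induced_iff by blast
      then show ?thesis
        using openin_nonzero[OF X W(1,3)] regular_inverse[OF X W(1,3)] x
        by (intro exI[of _ "{y\<in>W. g y \<noteq> 0}"] exI[of _ g] conjI) simp_all
    qed
    show "openin (space ?Y) {x\<in>U. f x \<noteq> 0}"
    proof (subst openin_subopen, intro ballI)
      fix x assume x: "x \<in> {x\<in>U. f x \<noteq> 0}"
      then obtain W g where W: "openin (space X) W" "x \<in> W" "\<forall>y\<in>W. g y \<noteq> 0" "\<forall>y\<in>W \<inter> U. f y = g y"
        using *[of x] by blast
      have "openin (space ?Y) (W \<inter> S)" using W open_iff by blast
      then have "openin (space ?Y) (W \<inter> S \<inter> U)" using U by blast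
      moreover have "x \<in> W \<inter> S \<inter> U" using x W(2) U open_iff by blast
      moreover have "W \<inter> S \<inter> U \<subseteq> {x\<in>U. f x \<noteq> 0}" using W by auto
      ultimately show "\<exists>T. openin (space ?Y) T \<and> x \<in> T \<and> T \<subseteq> {x\<in>U. f x \<noteq> 0}" by blast
    qed
    show "(\<lambda>x. inverse (f x)) \<in> regular ?Y {x\<in>U. f x \<noteq> 0}"
      unfolding regular_induced_iff
    proof
      fix x assume x: "x \<in> {x\<in>U. f x \<noteq> 0}"
      then obtain W g where "openin (space X) W" "x \<in> W" "(\<lambda>x. inverse (g x)) \<in> regular X W"
        "\<forall>y\<in>W \<inter> U. f y = g y" using *[of x] by blast
      then show "\<exists>W h. openin (space X) W \<and> x \<in> W \<and> h \<in> regular X W \<and>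
          (\<forall>y\<in>W \<inter> {x\<in>U. f x \<noteq> 0}. inverse (f y) = h y)"
        by (intro exI[of _ W] exI[of _ "\<lambda>x. inverse (g x)"] conjI) simp_all
    qed
  qed
qed

lemma morphism_comp:
  assumes f: "morphism X Y \<phi>" and g: "morphism Y Z \<psi>"
  shows "morphism X Z (\<psi> \<circ> \<phi>)"
  unfolding morphism_def
proof (intro conjI allI impI)
  show "continuous_map (space X) (space Z) (\<psi> \<circ> \<phi>)"
    using f g by (auto simp: morphism_def intro: continuous_map_compose)
next
  fix V h assume V: "openin (space Z) V \<and> h \<in> regular Z V"
  let ?W = "{y\<in>topspace (space Y). \<psi> y \<in> V}"
  have "h \<circ> \<psi> \<in> regular Y ?W" using g V unfolding morphism_def by blast
  moreover have "openin (space Y) ?W" using g V unfolding morphism_def continuous_map by blast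
  ultimately have "(h \<circ> \<psi>) \<circ> \<phi> \<in> regular X {x\<in>topspace (space X). \<phi> x \<in> ?W}"
    using f unfolding morphism_def by blast
  moreover have "{x\<in>topspace (space X). \<phi> x \<in> ?W} = {x\<in>topspace (space X). (\<psi> \<circ> \<phi>) x \<in> V}"
    using f unfolding morphism_def continuous_map by auto
  ultimately show "h \<circ> (\<psi> \<circ> \<phi>) \<in> regular X {x\<in>topspace (space X). (\<psi> \<circ> \<phi>) x \<in> V}"
    by (simp add: comp_assoc)
qed

lemma morphism_inclusion: "morphism (induced X S) X (\<lambda>x. x)"
  unfolding morphism_def
proof (intro conjI allI impI)
  show "continuous_map (space (induced X S)) (space X) (\<lambda>x. x)"
    by (simp add: space_induced continuous_map_from_subtopology)
next
  fix V f assume "openin (space X) V \<and> f \<in> regular X V"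
  then show "f \<circ> (\<lambda>x. x) \<in> regular (induced X S) {x\<in>topspace (space (induced X S)). x \<in> V}"
    unfolding regular_induced_iff by (auto simp: comp_def)
qed

lemma morphism_into_induced:
  assumes Y: "space_with_functions Y" and f: "morphism Y X \<phi>"
    and S: "\<And>y. y \<in> topspace (space Y) \<Longrightarrow> \<phi> y \<in> S"
  shows "morphism Y (induced X S) \<phi>"
  unfolding morphism_def
proof (intro conjI allI impI)
  show cont: "continuous_map (space Y) (space (induced X S)) \<phi>"
    using f S by (auto simp: morphism_def space_induced continuous_map_in_subtopology)
  fix V h assume V: "openin (space (induced X S)) V \<and> h \<in> regular (induced X S) V"
  let ?U = "{y\<in>topspace (space Y). \<phi> y \<in> V}"
  have U: "openin (space Y) ?U" using cont V unfolding continuous_map by blast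
  show "h \<circ> \<phi> \<in> regular Y ?U"
  proof (rule regular_glue[OF Y U])
    fix y assume y: "y \<in> ?U"
    then obtain W g where W: "openin (space X) W" "\<phi> y \<in> W" "g \<in> regular X W" "\<forall>z\<in>W \<inter> V. h z = g z"
      using V unfolding regular_induced_iff by blast
    let ?P = "{y\<in>topspace (space Y). \<phi> y \<in> W}"
    have P: "openin (space Y) ?P" "g \<circ> \<phi> \<in> regular Y ?P"
      using f W unfolding morphism_def continuous_map by blast+
    have o: "openin (space Y) (?P \<inter> ?U)" using P U by blast
    have "g \<circ> \<phi> \<in> regular Y (?P \<inter> ?U)" using regular_restrict[OF Y P(1) o _ P(2)] by auto
    then show "\<exists>T. openin (space Y) T \<and> y \<in> T \<and> T \<subseteq> ?U \<and> (\<exists>g\<in>regular Y T. \<forall>z\<in>T. (h \<circ> \<phi>) z = g z)"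
      using o y W by (intro exI[of _ "?P \<inter> ?U"] conjI bexI[of _ "g \<circ> \<phi>"]) auto
  qed
qed

lemma isomorphic_trans:
  assumes "isomorphic X Y" "isomorphic Y Z"
  shows "isomorphic X Z"
proof -
  obtain f g where fg: "morphism X Y f" "morphism Y X g" "\<forall>x\<in>topspace (space X). g (f x) = x"
    "\<forall>y\<in>topspace (space Y). f (g y) = y" using assms(1) unfolding isomorphic_def by blast
  obtain h k where hk: "morphism Y Z h" "morphism Z Y k" "\<forall>x\<in>topspace (space Y). k (h x) = x"
    "\<forall>y\<in>topspace (space Z). h (k y) = y" using assms(2) unfolding isomorphic_def by blast
  have "f x \<in> topspace (space Y)" if "x \<in> topspace (space X)" for x
    using fg(1) that unfolding morphism_def continuous_map by auto
  moreover have "k x \<in> topspace (space Y)" if "x \<in> topspace (space Z)" for x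
    using hk(2) that unfolding morphism_def continuous_map by auto
  ultimately show ?thesis unfolding isomorphic_def
    using morphism_comp[OF fg(1) hk(1)] morphism_comp[OF hk(2) fg(2)] fg(3,4) hk(3,4)
    by (intro exI[of _ "h \<circ> f"] exI[of _ "g \<circ> k"]) auto
qed

text \<open>A product of the zero locus with itself, followed by the inverse isomorphism, is a product of \<open>X\<close> with
  itself, and the two diagonals are the same set; so separatedness is inherited.\<close>

lemma variety_isomorphic_zero_locus:
  assumes X: "space_with_functions X" and E: "finite E" and F: "finite F"
    and iso: "isomorphic X (zero_locus E F)"
  shows "variety X"
proof -
  let ?Y = "zero_locus E F"
  obtain f g where f: "morphism X ?Y f" and g: "morphism ?Y X g"
    and gf: "\<forall>x\<in>topspace (space X). g (f x) = x" and fg: "\<forall>y\<in>topspace (space ?Y). f (g y) = y"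
    using iso unfolding isomorphic_def by blast
  have ft: "f x \<in> topspace (space ?Y)" if "x \<in> topspace (space X)" for x
    using f that unfolding morphism_def continuous_map by auto
  have pre: "prevariety X"
    unfolding prevariety_def
  proof (intro conjI exI)
    show "finite {topspace (space X)}" "\<Union>{topspace (space X)} = topspace (space X)" by auto
    show "\<forall>U\<in>{topspace (space X)}. openin (space X) U \<and> affine_variety (induced X U)"
      using isomorphic_trans[OF isomorphic_induced_topspace[OF X] iso] E F
      unfolding affine_variety_def by blast
  qed (rule X)
  have "separated ?Y" using variety_zero_locus[OF E F] unfolding variety_def by blast
  then obtain P p q where P: "is_product P p q ?Y ?Y"
    "closedin (space P) {x\<in>topspace (space P). p x = q x}" unfolding separated_def by blast
  have p: "morphism P ?Y p" and q: "morphism P ?Y q" and preP: "prevariety P"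
    and univ: "\<And>Z a b. prevariety Z \<Longrightarrow> morphism Z ?Y a \<Longrightarrow> morphism Z ?Y b \<Longrightarrow>
      \<exists>c. (morphism Z P c \<and> (\<forall>z\<in>topspace (space Z). p (c z) = a z \<and> q (c z) = b z)) \<and>
        (\<forall>c'. morphism Z P c' \<and> (\<forall>z\<in>topspace (space Z). p (c' z) = a z \<and> q (c' z) = b z)
             \<longrightarrow> (\<forall>z\<in>topspace (space Z). c' z = c z))"
    using P(1) unfolding is_product_def by blast+
  have pt: "p x \<in> topspace (space ?Y) \<and> q x \<in> topspace (space ?Y)" if "x \<in> topspace (space P)" for x
    using p q that unfolding morphism_def continuous_map by auto
  have "is_product P (g \<circ> p) (g \<circ> q) X X"
    unfolding is_product_def
  proof (intro conjI allI impI preP morphism_comp[OF p g] morphism_comp[OF q g])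
    fix Z a b assume Z: "prevariety Z \<and> morphism Z X a \<and> morphism Z X b"
    have ab: "a z \<in> topspace (space X) \<and> b z \<in> topspace (space X)" if "z \<in> topspace (space Z)" for z
      using Z that unfolding morphism_def continuous_map by auto
    have fa: "morphism Z ?Y (f \<circ> a)" "morphism Z ?Y (f \<circ> b)" using Z morphism_comp[OF _ f] by auto
    obtain c where c: "(morphism Z P c \<and> (\<forall>z\<in>topspace (space Z). p (c z) = (f \<circ> a) z \<and> q (c z) = (f \<circ> b) z)) \<and>
        (\<forall>c'. morphism Z P c' \<and> (\<forall>z\<in>topspace (space Z). p (c' z) = (f \<circ> a) z \<and> q (c' z) = (f \<circ> b) z)
             \<longrightarrow> (\<forall>z\<in>topspace (space Z). c' z = c z))"
      using univ[OF _ fa] Z by (elim conjE) (rule exE)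
    note c1 = c[THEN conjunct1] and c2 = c[THEN conjunct2, THEN spec, THEN mp, THEN bspec]
    show "\<exists>c. (morphism Z P c \<and> (\<forall>z\<in>topspace (space Z). (g \<circ> p) (c z) = a z \<and> (g \<circ> q) (c z) = b z)) \<and>
        (\<forall>c'. morphism Z P c' \<and> (\<forall>z\<in>topspace (space Z). (g \<circ> p) (c' z) = a z \<and> (g \<circ> q) (c' z) = b z)
             \<longrightarrow> (\<forall>z\<in>topspace (space Z). c' z = c z))"
    proof (intro exI[of _ c] conjI allI impI ballI)
      fix c' z assume c': "morphism Z P c' \<and> (\<forall>z\<in>topspace (space Z). (g \<circ> p) (c' z) = a z \<and> (g \<circ> q) (c' z) = b z)"
        and z: "z \<in> topspace (space Z)"
      have pq: "p (c' z) = f (a z) \<and> q (c' z) = f (b z)" if "z \<in> topspace (space Z)" for z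
      proof -
        have "c' z \<in> topspace (space P)" using c' that unfolding morphism_def continuous_map by auto
        then have "f (g (p (c' z))) = p (c' z)" "f (g (q (c' z))) = q (c' z)" using fg pt by auto
        moreover have "g (p (c' z)) = a z" "g (q (c' z)) = b z" using c' that by auto
        ultimately show ?thesis by metis
      qed
      show "c' z = c z" by (rule c2[OF _ z]) (use c' pq in simp)
    qed (use c1 gf ab in auto)
  qed
  moreover have "{x\<in>topspace (space P). (g \<circ> p) x = (g \<circ> q) x} = {x\<in>topspace (space P). p x = q x}"
  proof (intro Collect_cong conj_cong refl)
    fix x assume "x \<in> topspace (space P)"
    then have "f (g (p x)) = p x" "f (g (q x)) = q x" using fg pt by auto
    then show "((g \<circ> p) x = (g \<circ> q) x) = (p x = q x)" by (metis comp_apply)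
  qed
  ultimately have "separated X" unfolding separated_def using P(2)
    by (intro exI[of _ P] exI[of _ "g \<circ> p"] exI[of _ "g \<circ> q"]) simp
  then show ?thesis unfolding variety_def using pre by blast
qed

subsection \<open>Rational maps between subsets of affine spaces\<close>

abbreviation aff_subspace :: "nat set \<Rightarrow> 'k::field point set \<Rightarrow> 'k fspace" where
  "aff_subspace E S \<equiv> induced (affine_space E) S"

lemma topspace_aff_subspace: "S \<subseteq> affine_points E \<Longrightarrow> topspace (space (aff_subspace E S)) = S"
  by (auto simp: space_induced)

lemma space_with_functions_aff_subspace: "space_with_functions (aff_subspace E S)"
  by (rule space_with_functions_induced[OF space_with_functions_affine_space])

text \<open>Regular coordinates give a morphism to the whole affine space, and a subset carries the induced structure.\<close>

lemma morphism_into_aff_subspace: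
  assumes X: "space_with_functions X" and SE: "S \<subseteq> affine_points E"
    and pts: "\<And>x. x \<in> topspace (space X) \<Longrightarrow> \<phi> x \<in> S"
    and reg: "\<And>i. (\<lambda>x. \<phi> x i) \<in> regular X (topspace (space X))"
  shows "morphism X (aff_subspace E S) \<phi>"
proof (rule morphism_into_induced[OF X _ pts])
  have "morphism X (zero_locus E {}) \<phi>"
    by (rule morphism_into_zero_locus[OF X _ reg]) (use pts SE in \<open>auto simp: zero_set_def\<close>)
  from morphism_comp[OF this] show "morphism X (affine_space E) \<phi>"
    using morphism_inclusion[of "affine_space E" "zero_set E {}"]
    by (fastforce simp: zero_locus_def comp_def)
qed

lemma coordinate_regular_aff_subspace:
  assumes "morphism X (aff_subspace E S) \<phi>" "S \<subseteq> affine_points E"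
  shows "(\<lambda>x. \<phi> x i) \<in> regular X (topspace (space X))"
proof -
  have "morphism (aff_subspace E S) (zero_locus E {}) (\<lambda>x. x)"
    unfolding zero_locus_def
    by (rule morphism_into_induced[OF space_with_functions_aff_subspace morphism_inclusion])
       (use assms(2) in \<open>auto simp: topspace_aff_subspace zero_set_def\<close>)
  from morphism_comp[OF assms(1) this] have "morphism X (zero_locus E {}) \<phi>" by (simp add: comp_def)
  then show ?thesis by (rule coordinate_regular)
qed

text \<open>Polynomial functions form the stock of equations and of numerators and denominators; working
  with the functions rather than with the polynomials lets the usual arithmetic simplification
  act on them.\<close>

definition polyfun :: "('k::field point \<Rightarrow> 'k alg_closure) \<Rightarrow> bool" where
  "polyfun f \<longleftrightarrow> (\<exists>p. \<forall>x. mp_eval p x = f x)"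

named_theorems polyfun_intros

lemma polyfun_mp_eval [polyfun_intros]: "polyfun (mp_eval p)"
  unfolding polyfun_def by blast

lemma polyfun_0 [polyfun_intros]: "polyfun (\<lambda>_. 0)"
  unfolding polyfun_def by (metis mp_eval_zero)

lemma polyfun_1 [polyfun_intros]: "polyfun (\<lambda>_. 1)"
  unfolding polyfun_def by (metis mp_eval_one)

lemma polyfun_coord [polyfun_intros]: "polyfun (\<lambda>x. x i)"
  unfolding polyfun_def by (metis mp_eval_mvar)

lemma polyfun_add [polyfun_intros]: "polyfun f \<Longrightarrow> polyfun g \<Longrightarrow> polyfun (\<lambda>x. f x + g x)"
  unfolding polyfun_def by (metis mp_eval_add)

lemma polyfun_diff [polyfun_intros]: "polyfun f \<Longrightarrow> polyfun g \<Longrightarrow> polyfun (\<lambda>x. f x - g x)"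
  unfolding polyfun_def by (metis mp_eval_diff)

lemma polyfun_mult [polyfun_intros]: "polyfun f \<Longrightarrow> polyfun g \<Longrightarrow> polyfun (\<lambda>x. f x * g x)"
  unfolding polyfun_def by (metis mp_eval_times)

lemma polyfun_uminus [polyfun_intros]: "polyfun f \<Longrightarrow> polyfun (\<lambda>x. - f x)"
  unfolding polyfun_def by (metis mp_eval_uminus)

lemma polyfun_power [polyfun_intros]: "polyfun f \<Longrightarrow> polyfun (\<lambda>x. f x ^ n)"
  unfolding polyfun_def by (metis mp_eval_power)

lemma polyfun_prod [polyfun_intros]:
  "(\<And>i. i \<in> A \<Longrightarrow> polyfun (f i)) \<Longrightarrow> polyfun (\<lambda>x. \<Prod>i\<in>A. f i x)"
  by (induction A rule: infinite_finite_induct) (simp_all add: polyfun_1 polyfun_mult)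

lemma polyfun_if [polyfun_intros]:
  "polyfun f \<Longrightarrow> polyfun g \<Longrightarrow> polyfun (\<lambda>x. if b then f x else g x)"
  by (cases b) simp_all

lemma polyfun_subst:
  assumes "polyfun f" "\<And>i. polyfun (\<lambda>x. s x i)"
  shows "polyfun (\<lambda>x. f (s x))"
proof -
  obtain p where p: "\<And>x. mp_eval p x = f x" using assms(1) unfolding polyfun_def by blast
  obtain t where t: "\<And>i x. mp_eval (t i) x = s x i" using assms(2) unfolding polyfun_def by metis
  obtain p' where "\<forall>x. mp_eval p' x = mp_eval p (\<lambda>i. mp_eval (t i) x)" using mp_eval_subst by blast
  then have "\<forall>x. mp_eval p' x = f (s x)" by (simp add: t p)
  then show ?thesis unfolding polyfun_def by blast
qed

definition ratfun :: "'k::field point set \<Rightarrow> ('k point \<Rightarrow> 'k alg_closure) \<Rightarrow> bool" where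
  "ratfun S f \<longleftrightarrow> (\<exists>p q. polyfun p \<and> polyfun q \<and> (\<forall>x\<in>S. q x \<noteq> 0 \<and> f x = p x / q x))"

lemma ratfun_polyfun: "polyfun f \<Longrightarrow> ratfun S f"
  unfolding ratfun_def by (intro exI[of _ f] exI[of _ "\<lambda>_. 1"]) (simp add: polyfun_1)

lemma ratfun_cong: "ratfun S f \<Longrightarrow> (\<And>x. x \<in> S \<Longrightarrow> g x = f x) \<Longrightarrow> ratfun S g"
  unfolding ratfun_def by metis

text \<open>The quotient is regular because it is the product of a polynomial with the inverse of a polynomial
  without zeros on \<open>S\<close>.\<close>

lemma ratfun_regular:
  assumes S: "S \<subseteq> affine_points E" and f: "ratfun S f"
  shows "f \<in> regular (aff_subspace E S) S"
proof -
  let ?X = "aff_subspace E S"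
  have X: "space_with_functions ?X" by (rule space_with_functions_aff_subspace)
  have o: "openin (space ?X) S" using openin_topspace[of "space ?X"] topspace_aff_subspace[OF S] by simp
  have poly: "mp_eval p \<in> regular ?X S" for p
    unfolding regular_induced_iff
  proof
    fix x assume "x \<in> S"
    then have "openin (space (affine_space E)) (affine_points E)" "x \<in> affine_points E"
      using S openin_topspace[of "space (affine_space E)"] by auto
    moreover have "mp_eval p \<in> regular (affine_space E) (affine_points E)"
      unfolding regular_affine_space_iff by (intro ballI exI[of _ p] exI[of _ 1]) simp
    ultimately show "\<exists>W g. openin (space (affine_space E)) W \<and> x \<in> W \<and>
        g \<in> regular (affine_space E) W \<and> (\<forall>y\<in>W \<inter> S. mp_eval p y = g y)" by blast
  qed
  obtain p q where pq: "\<forall>x\<in>S. mp_eval q x \<noteq> 0 \<and> f x = mp_eval p x / mp_eval q x"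
    using f unfolding ratfun_def polyfun_def by metis
  have "(\<lambda>x. inverse (mp_eval q x)) \<in> regular ?X {x\<in>S. mp_eval q x \<noteq> 0}"
    by (rule regular_inverse[OF X o poly])
  moreover have "{x\<in>S. mp_eval q x \<noteq> 0} = S" using pq by auto
  ultimately have "(\<lambda>x. mp_eval p x * inverse (mp_eval q x)) \<in> regular ?X S"
    using regular_mult[OF X o poly] by simp
  then show ?thesis
    by (intro regular_glue[OF X o] exI[of _ S]) (use o pq in \<open>auto simp: divide_inverse intro!: bexI\<close>)
qed

lemma morphism_ratfun:
  assumes S: "S \<subseteq> affine_points E" and S': "S' \<subseteq> affine_points E'"
    and pts: "\<And>x. x \<in> S \<Longrightarrow> \<phi> x \<in> S'" and rat: "\<And>i. i \<in> E' \<Longrightarrow> ratfun S (\<lambda>x. \<phi> x i)"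
  shows "morphism (aff_subspace E S) (aff_subspace E' S') \<phi>"
proof (rule morphism_into_aff_subspace[OF space_with_functions_aff_subspace S'])
  fix i
  have "ratfun S (\<lambda>x. \<phi> x i)"
  proof (cases "i \<in> E'")
    case False
    then have "\<phi> x i = 0" if "x \<in> S" for x using pts[OF that] S' by (auto simp: affine_points_def)
    then show ?thesis by (rule ratfun_cong[OF ratfun_polyfun[OF polyfun_0]])
  qed (rule rat)
  then show "(\<lambda>x. \<phi> x i) \<in> regular (aff_subspace E S) (topspace (space (aff_subspace E S)))"
    using ratfun_regular[OF S] topspace_aff_subspace[OF S] by simp
qed (use pts topspace_aff_subspace[OF S] in simp)

lemma isomorphic_ratfun:
  assumes S: "S \<subseteq> affine_points E" and S': "S' \<subseteq> affine_points E'"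
    and "\<And>x. x \<in> S \<Longrightarrow> \<phi> x \<in> S'" "\<And>i. i \<in> E' \<Longrightarrow> ratfun S (\<lambda>x. \<phi> x i)"
    and "\<And>y. y \<in> S' \<Longrightarrow> \<psi> y \<in> S" "\<And>i. i \<in> E \<Longrightarrow> ratfun S' (\<lambda>y. \<psi> y i)"
    and "\<And>x. x \<in> S \<Longrightarrow> \<psi> (\<phi> x) = x" "\<And>y. y \<in> S' \<Longrightarrow> \<phi> (\<psi> y) = y"
  shows "isomorphic (aff_subspace E S) (aff_subspace E' S')"
  unfolding isomorphic_def
  using morphism_ratfun[OF S S' assms(3,4)] morphism_ratfun[OF S' S assms(5,6)] assms(7,8)
  by (intro exI[of _ \<phi>] exI[of _ \<psi>]) (simp_all add: topspace_aff_subspace S S')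

definition loc_closed :: "nat set \<Rightarrow> 'k::field point set \<Rightarrow> bool" where
  "loc_closed E S \<longleftrightarrow> finite E \<and> (\<exists>F g. finite F \<and> (\<forall>f\<in>F. polyfun f) \<and> polyfun g \<and>
     S = {x\<in>affine_points E. (\<forall>f\<in>F. f x = 0) \<and> g x \<noteq> 0})"

lemma loc_closed_subset: "loc_closed E S \<Longrightarrow> S \<subseteq> affine_points E"
  unfolding loc_closed_def by auto

text \<open>The inequation \<open>g \<noteq> 0\<close> becomes the equation \<open>x\<^sub>i g = 1\<close> in a new coordinate, so locally closed
  subsets are affine varieties.\<close>

lemma loc_closed_isomorphic_zero_locus:
  fixes S :: "'k::field point set"
  assumes "loc_closed E S"
  shows "\<exists>E' F'. finite E' \<and> finite F' \<and> isomorphic (aff_subspace E S) (zero_locus E' F')"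
proof -
  obtain F g where E: "finite E" and F: "finite F" "\<forall>f\<in>F. polyfun f" "polyfun g"
    and S: "S = {x\<in>affine_points E. (\<forall>f\<in>F. f x = 0) \<and> g x \<noteq> 0}"
    using assms unfolding loc_closed_def by blast
  obtain i where i: "i \<notin> E" using E ex_new_if_finite infinite_UNIV_nat by blast
  have upd: "polyfun (\<lambda>x. (x(i := 0)) j)" for j 
    by (cases "j = i") (simp_all add: polyfun_0 polyfun_coord)
  have "\<exists>p. \<forall>x. mp_eval p x = f (x(i := 0))" if "f \<in> F" for f
    using polyfun_subst[of f "\<lambda>x. x(i := 0)", OF _ upd] F that unfolding polyfun_def by blast
  then obtain P where P: "\<And>f x. f \<in> F \<Longrightarrow> mp_eval (P f) x = f (x(i := 0))" by metis
  obtain G where G: "\<And>x. mp_eval G x = x i * g (x(i := 0)) - 1"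
    using polyfun_diff[OF polyfun_mult[OF polyfun_coord polyfun_subst[of g "\<lambda>x. x(i := 0)", OF F(3) upd]] polyfun_1]
    unfolding polyfun_def by blast
  let ?F' = "insert G (P ` F)" and ?E' = "insert i E"
  have fg: "f \<in> insert g F \<Longrightarrow> polyfun f" for f using F by blast
  have "isomorphic (aff_subspace E S) (aff_subspace ?E' (zero_set ?E' ?F'))"
  proof (rule isomorphic_ratfun[where \<phi> = "\<lambda>x. x(i := 1 / g x)" and \<psi> = "\<lambda>x. x(i := 0)"])
    show "S \<subseteq> affine_points E" "zero_set ?E' ?F' \<subseteq> affine_points ?E'"
      by (auto simp: S zero_set_def)
  next
    fix x assume x: "x \<in> S"
    then have x0: "x(i := 0) = x" using i by (auto simp: S affine_points_def)
    then show "x(i := 1 / g x) \<in> zero_set ?E' ?F'"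
      using x by (auto simp: zero_set_def S affine_points_def P G)
    show "(x(i := 1 / g x))(i := 0) = x" using x0 by simp
  next
    fix j
    have "ratfun S (\<lambda>x. 1 / g x)" unfolding ratfun_def
      by (intro exI[of _ "\<lambda>_. 1"] exI[of _ g]) (auto simp: polyfun_1 F S)
    then show "ratfun S (\<lambda>x. (x(i := 1 / g x)) j)"
      by (cases "j = i") (auto intro: ratfun_polyfun polyfun_coord)
    show "ratfun (zero_set ?E' ?F') (\<lambda>y. (y(i := 0)) j)" by (rule ratfun_polyfun[OF upd])
  next
    fix y assume y: "y \<in> zero_set ?E' ?F'"
    then have 1: "y i * g (y(i := 0)) = 1" by (simp add: zero_set_def G)
    then show "y(i := 0) \<in> S" using y by (auto simp: zero_set_def S affine_points_def P)
    have "1 / g (y(i := 0)) = y i" using 1 by (metis divide_eq_eq mult_eq_0_iff zero_neq_one)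
    then show "(y(i := 0))(i := 1 / g (y(i := 0))) = y" by auto
  qed
  then show ?thesis using E F(1) unfolding zero_locus_def[symmetric]
    by (intro exI[of _ ?E'] exI[of _ ?F']) auto
qed

lemma variety_aff_subspace: "loc_closed E S \<Longrightarrow> variety (aff_subspace E S)"
  using variety_isomorphic_zero_locus[OF space_with_functions_aff_subspace]
    loc_closed_isomorphic_zero_locus by blast

text \<open>The scissor relation speaks of subsets of a variety that is itself a subset of affine space; this
  identifies them with subsets of affine space.\<close>

lemma induced_induced_isomorphic:
  assumes S: "S \<subseteq> affine_points E" and T: "T \<subseteq> S"
  shows "isomorphic (induced (aff_subspace E S) T) (aff_subspace E T)"
proof -
  let ?Y = "induced (aff_subspace E S) T"
  have tY: "topspace (space ?Y) = T" using topspace_aff_subspace[OF S] T by (auto simp: space_induced)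
  have tT: "topspace (space (aff_subspace E T)) = T" using S T by (intro topspace_aff_subspace) auto
  have "morphism ?Y (affine_space E) (\<lambda>x. x)"
    using morphism_comp[OF morphism_inclusion morphism_inclusion, of "affine_space E" S T]
    by (simp add: comp_def)
  then have 1: "morphism ?Y (aff_subspace E T) (\<lambda>x. x)"
    using morphism_into_induced[OF space_with_functions_induced[OF space_with_functions_aff_subspace]]
      tY by blast
  have "morphism (aff_subspace E T) (aff_subspace E S) (\<lambda>x. x)"
    by (rule morphism_into_induced[OF space_with_functions_aff_subspace morphism_inclusion])
       (use tT T in auto)
  then have "morphism (aff_subspace E T) ?Y (\<lambda>x. x)"
    by (rule morphism_into_induced[OF space_with_functions_aff_subspace]) (use tT in auto)
  with 1 show ?thesis unfolding isomorphic_def by auto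
qed

subsection \<open>Classes in the Grothendieck ring\<close>

definition set_class :: "nat set \<Rightarrow> 'k::field point set \<Rightarrow> 'k K0" where
  "set_class E S = K0_class (Abs_variety (aff_subspace E S))"

lemma locus_class_eq_set_class: "locus_class E F = set_class E (zero_set E F)"
  by (simp add: locus_class_def set_class_def zero_locus_def)

lemma Rep_Abs_aff_subspace:
  "loc_closed E S \<Longrightarrow> Rep_variety (Abs_variety (aff_subspace E S)) = aff_subspace E S"
  using variety_aff_subspace by (intro Abs_variety_inverse) auto

lemma K0_class_eq: "K0_class X = abs_K0 (symb X)"
  by (simp add: K0_class_def)

lemma K0_class_isomorphic:
  assumes "isomorphic (Rep_variety X) (Rep_variety Y)"
  shows "K0_class X = K0_class Y"
  using K0_relations_subset[OF K0_relations.iso[OF assms]]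
  by (simp add: K0_class_eq K0.abs_eq_iff K0_eq_def)

lemma set_class_isomorphic:
  "loc_closed E S \<Longrightarrow> loc_closed E' S' \<Longrightarrow> isomorphic (aff_subspace E S) (aff_subspace E' S') \<Longrightarrow>
    set_class E S = set_class E' S'"
  unfolding set_class_def by (rule K0_class_isomorphic) (simp add: Rep_Abs_aff_subspace)

lemma loc_closed_zero:
  assumes "loc_closed E S" "polyfun f"
  shows "loc_closed E {x\<in>S. f x = 0}"
proof -
  obtain F g where F: "finite E" "finite F" "\<forall>f\<in>F. polyfun f" "polyfun g"
    "S = {x\<in>affine_points E. (\<forall>f\<in>F. f x = 0) \<and> g x \<noteq> 0}"
    using assms(1) unfolding loc_closed_def by blast
  then show ?thesis using assms(2) unfolding loc_closed_def
    by (intro conjI exI[of _ "insert f F"] exI[of _ g]) auto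
qed

lemma loc_closed_nonzero:
  assumes "loc_closed E S" "polyfun f"
  shows "loc_closed E {x\<in>S. f x \<noteq> 0}"
proof -
  obtain F g where F: "finite E" "finite F" "\<forall>f\<in>F. polyfun f" "polyfun g"
    "S = {x\<in>affine_points E. (\<forall>f\<in>F. f x = 0) \<and> g x \<noteq> 0}"
    using assms(1) unfolding loc_closed_def by blast
  then show ?thesis using assms(2) unfolding loc_closed_def
    by (intro conjI exI[of _ F] exI[of _ "\<lambda>x. g x * f x"]) (auto intro: polyfun_mult)
qed

lemma set_class_scissor:
  fixes S :: "'k::field point set"
  assumes S: "loc_closed E S" and f: "polyfun f"
  shows "set_class E S = set_class E {x\<in>S. f x = 0} + set_class E {x\<in>S. f x \<noteq> 0}"
proof -
  let ?X = "aff_subspace E S" and ?T = "{x\<in>S. f x = 0}" and ?U = "{x\<in>S. f x \<noteq> 0}"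
  note SE = loc_closed_subset[OF S]
  have piece: "Rep_variety (Abs_variety (induced ?X T)) = induced ?X T \<and>
      K0_class (Abs_variety (induced ?X T)) = set_class E T"
    if T: "loc_closed E T" "T \<subseteq> S" for T
  proof -
    note iso = induced_induced_isomorphic[OF SE T(2)]
    obtain E' F' where "finite E'" "finite F'" "isomorphic (aff_subspace E T) (zero_locus E' F')"
      using loc_closed_isomorphic_zero_locus[OF T(1)] by blast
    then have "variety (induced ?X T)"
      using variety_isomorphic_zero_locus isomorphic_trans[OF iso]
        space_with_functions_induced[OF space_with_functions_aff_subspace] by blast
    then have 1: "Rep_variety (Abs_variety (induced ?X T)) = induced ?X T"
      by (intro Abs_variety_inverse) auto
    then show ?thesis using K0_class_isomorphic iso Rep_Abs_aff_subspace[OF T(1)]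
      unfolding set_class_def by metis
  qed
  have o: "openin (space ?X) S" using openin_topspace[of "space ?X"] topspace_aff_subspace[OF SE] by simp
  have "openin (space ?X) ?U"
    by (rule openin_nonzero[OF space_with_functions_aff_subspace o])
       (rule ratfun_regular[OF SE ratfun_polyfun[OF f]])
  moreover have "S - ?T = ?U" by auto
  ultimately have cl: "closedin (space ?X) ?T" unfolding closedin_def topspace_aff_subspace[OF SE] by auto
  have *: "K0_class X = K0_class Z + K0_class U" if
    "closedin (space (Rep_variety X)) R" "Rep_variety Z = induced (Rep_variety X) R"
    "Rep_variety U = induced (Rep_variety X) (topspace (space (Rep_variety X)) - R)"
    for X Z U :: "'k variety" and R
    using K0_relations_subset[OF K0_relations.scissor[OF that]] 
    by (simp add: K0_class_eq K0.abs_eq_iff K0_eq_def plus_K0.abs_eq times_K0.abs_eq one_K0_def)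
  note T = piece[OF loc_closed_zero[OF S f]] and U = piece[OF loc_closed_nonzero[OF S f]]
  have "K0_class (Abs_variety ?X) = K0_class (Abs_variety (induced ?X ?T)) + K0_class (Abs_variety (induced ?X ?U))"
    by (rule *[of _ ?T]) (use cl T U \<open>S - ?T = ?U\<close> in
      \<open>auto simp: Rep_Abs_aff_subspace[OF S] topspace_aff_subspace[OF SE]\<close>)
  then show ?thesis using T U by (auto simp: set_class_def)
qed

text \<open>Adding a free coordinate is the product with the affine line: a pair of morphisms to the factors is glued
  by putting the value in the line at the place of the new coordinate.\<close>

lemma set_class_times_line:
  fixes S :: "'k::field point set"
  assumes S: "loc_closed E S" and i: "i \<notin> E"
    and T: "T = {x\<in>affine_points (insert i E). x(i := 0) \<in> S}" "loc_closed (insert i E) T"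
  shows "set_class (insert i E) T = lefschetz * set_class E S"
proof -
  note SE = loc_closed_subset[OF S] and TE = loc_closed_subset[OF T(2)]
  let ?P = "aff_subspace (insert i E) T" and ?X = "zero_locus {0} {} :: 'k fspace"
    and ?Y = "aff_subspace E S"
  define p :: "'k point \<Rightarrow> 'k point" where "p = (\<lambda>x j. if j = 0 then x i else 0)"
  define q :: "'k point \<Rightarrow> 'k point" where "q = (\<lambda>x. x(i := 0))"
  have p: "morphism ?P ?X p" unfolding zero_locus_def
    by (rule morphism_ratfun[OF TE])
       (auto simp: p_def zero_set_def affine_points_def intro: ratfun_polyfun polyfun_coord)
  have q: "morphism ?P ?Y q"
    by (rule morphism_ratfun[OF TE SE])
       (auto simp: q_def T intro!: ratfun_polyfun polyfun_intros)
  have prod: "is_product ?P p q ?X ?Y"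
    unfolding is_product_def
  proof (intro conjI allI impI p q)
    show "prevariety ?P" using variety_aff_subspace[OF T(2)] unfolding variety_def by blast
    fix Z a b assume Z: "prevariety Z \<and> morphism Z ?X a \<and> morphism Z ?Y b"
    then have swf: "space_with_functions Z" unfolding prevariety_def by blast
    have a: "morphism Z ?X a" and b: "morphism Z ?Y b" using Z by auto
    have apt: "a z j = 0" if "z \<in> topspace (space Z)" "j \<noteq> 0" for z j
      using a that by (auto simp: morphism_def continuous_map zero_set_def affine_points_def Pi_iff)
    have bS: "b z \<in> S" if "z \<in> topspace (space Z)" for z
      using b that by (auto simp: morphism_def continuous_map topspace_aff_subspace[OF SE])
    then have bi: "b z i = 0" if "z \<in> topspace (space Z)" for z
      using that SE i unfolding affine_points_def by blast
    then have b0: "(b z)(i := 0) = b z" if "z \<in> topspace (space Z)" for z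
      using that by auto
    define c where "c = (\<lambda>z. (b z)(i := a z 0))"
    have cT: "c z \<in> T" if "z \<in> topspace (space Z)" for z
      using bS[OF that] b0[OF that] SE by (auto simp: c_def T affine_points_def)
    have "(\<lambda>z. c z j) \<in> regular Z (topspace (space Z))" for j
      using coordinate_regular[OF a, of 0] coordinate_regular_aff_subspace[OF b SE, of j]
      by (cases "j = i") (simp_all add: c_def)
    then have cm: "morphism Z ?P c" using cT by (intro morphism_into_aff_subspace[OF swf TE])
    have pc: "p (c z) = a z \<and> q (c z) = b z" if "z \<in> topspace (space Z)" for z
      using apt[OF that] b0[OF that] by (auto simp: p_def q_def c_def)
    show "\<exists>c. (morphism Z ?P c \<and> (\<forall>z\<in>topspace (space Z). p (c z) = a z \<and> q (c z) = b z)) \<and>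
        (\<forall>c'. morphism Z ?P c' \<and> (\<forall>z\<in>topspace (space Z). p (c' z) = a z \<and> q (c' z) = b z)
             \<longrightarrow> (\<forall>z\<in>topspace (space Z). c' z = c z))"
    proof (intro exI[of _ c] conjI allI impI ballI cm)
      fix c' z assume "morphism Z ?P c' \<and> (\<forall>z\<in>topspace (space Z). p (c' z) = a z \<and> q (c' z) = b z)"
        and z: "z \<in> topspace (space Z)"
      then have "p (c' z) = a z" "q (c' z) = b z" by auto
      then have "p (c' z) 0 = a z 0" "q (c' z) = b z" by simp_all
      then have "c' z i = a z 0" "(c' z)(i := 0) = b z" unfolding p_def q_def by simp_all
      then show "c' z = c z" unfolding c_def by (metis fun_upd_triv fun_upd_upd)
    qed (use pc in auto)
  qed
  have X: "Rep_variety (Abs_variety ?X) = ?X"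
    using variety_zero_locus[of "{0}" "{}"] by (intro Abs_variety_inverse) auto
  have *: "K0_class A * K0_class B = K0_class P" if
    "is_product (Rep_variety P) p q (Rep_variety A) (Rep_variety B)" for A B P :: "'k variety"
    using K0_relations_subset[OF K0_relations.product[OF that]] 
    by (simp add: K0_class_eq K0.abs_eq_iff K0_eq_def plus_K0.abs_eq times_K0.abs_eq one_K0_def)
  show ?thesis
    using *[of "Abs_variety ?P" "Abs_variety ?X" "Abs_variety ?Y"] prod
    by (simp add: X Rep_Abs_aff_subspace[OF S] Rep_Abs_aff_subspace[OF T(2)] lefschetz_def
        locus_class_def set_class_def)
qed

lemma set_class_point: "set_class {} (affine_points {} :: 'k::field point set) = 1"
proof -
  let ?X = "zero_locus {} {} :: 'k fspace"
  have X: "Rep_variety (Abs_variety ?X) = ?X"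
    using variety_zero_locus[of "{}" "{}"] by (intro Abs_variety_inverse) auto
  have *: "K0_class A = 1" if "Rep_variety A = ?X" for A :: "'k variety"
    using K0_relations_subset[OF K0_relations.point[OF that]] 
    by (simp add: K0_class_eq K0.abs_eq_iff K0_eq_def plus_K0.abs_eq times_K0.abs_eq one_K0_def)
  have "zero_set {} {} = (affine_points {} :: 'k point set)" by (auto simp: zero_set_def)
  then show ?thesis using *[OF X] by (simp add: set_class_def zero_locus_def)
qed

subsection \<open>Classes of subsets given by conditions on the coordinates\<close>

definition loc_closed_pred :: "('k::field point \<Rightarrow> bool) \<Rightarrow> bool" where
  "loc_closed_pred \<Phi> \<longleftrightarrow> (\<exists>F g. finite F \<and> (\<forall>f\<in>F. polyfun f) \<and> polyfun g \<and>
     (\<forall>x. \<Phi> x \<longleftrightarrow> (\<forall>f\<in>F. f x = 0) \<and> g x \<noteq> 0))"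

named_theorems loc_intros

lemma loc_True [loc_intros]: "loc_closed_pred (\<lambda>_. True)"
  unfolding loc_closed_pred_def by (intro exI[of _ "{}"] exI[of _ "\<lambda>_. 1"]) (simp add: polyfun_1)

lemma loc_False [loc_intros]: "loc_closed_pred (\<lambda>_. False)"
  unfolding loc_closed_pred_def by (intro exI[of _ "{}"] exI[of _ "\<lambda>_. 0"]) (simp add: polyfun_0)

lemma loc_nonzero [loc_intros]: "polyfun f \<Longrightarrow> loc_closed_pred (\<lambda>x. f x \<noteq> 0)"
  unfolding loc_closed_pred_def by (intro exI[of _ "{}"] exI[of _ f]) simp

lemma loc_eq [loc_intros]: "polyfun f \<Longrightarrow> polyfun g \<Longrightarrow> loc_closed_pred (\<lambda>x. f x = g x)"
  unfolding loc_closed_pred_def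
  by (intro exI[of _ "{\<lambda>x. f x - g x}"] exI[of _ "\<lambda>_. 1"]) (simp add: polyfun_1 polyfun_diff)

lemma loc_conj [loc_intros]:
  assumes "loc_closed_pred \<Phi>" "loc_closed_pred \<Psi>"
  shows "loc_closed_pred (\<lambda>x. \<Phi> x \<and> \<Psi> x)"
proof -
  obtain F g where 1: "finite F" "\<forall>f\<in>F. polyfun f" "polyfun g"
    "\<forall>x. \<Phi> x \<longleftrightarrow> (\<forall>f\<in>F. f x = 0) \<and> g x \<noteq> 0" using assms(1) unfolding loc_closed_pred_def by blast
  obtain F' g' where 2: "finite F'" "\<forall>f\<in>F'. polyfun f" "polyfun g'"
    "\<forall>x. \<Psi> x \<longleftrightarrow> (\<forall>f\<in>F'. f x = 0) \<and> g' x \<noteq> 0" using assms(2) unfolding loc_closed_pred_def by blast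
  show ?thesis unfolding loc_closed_pred_def
    by (rule exI[of _ "F \<union> F'"], rule exI[of _ "\<lambda>x. g x * g' x"]) (use 1 2 polyfun_mult in auto)
qed

lemma loc_closed_pred_subset:
  assumes "finite E" "loc_closed_pred \<Phi>"
  shows "loc_closed E {x\<in>affine_points E. \<Phi> x}"
proof -
  obtain F g where "finite F" "\<forall>f\<in>F. polyfun f" "polyfun g"
    "\<forall>x. \<Phi> x \<longleftrightarrow> (\<forall>f\<in>F. f x = 0) \<and> g x \<noteq> 0" using assms(2) unfolding loc_closed_pred_def by blast
  then show ?thesis unfolding loc_closed_def using assms(1)
    by (intro conjI exI[of _ F] exI[of _ g]) auto
qed

abbreviation cond_class :: "nat set \<Rightarrow> ('k::field point \<Rightarrow> bool) \<Rightarrow> 'k K0" where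
  "cond_class E \<Phi> \<equiv> set_class E {x\<in>affine_points E. \<Phi> x}"

lemma cond_class_cong:
  "(\<And>x. x \<in> affine_points E \<Longrightarrow> \<Phi> x \<longleftrightarrow> \<Psi> x) \<Longrightarrow> cond_class E \<Phi> = cond_class E \<Psi>"
  by (rule arg_cong[of _ _ "set_class E"]) blast

lemma cond_class_split:
  assumes "finite E" "loc_closed_pred \<Phi>" "polyfun f"
  shows "cond_class E \<Phi> = cond_class E (\<lambda>x. \<Phi> x \<and> f x = 0) + cond_class E (\<lambda>x. \<Phi> x \<and> f x \<noteq> 0)"
  using set_class_scissor[OF loc_closed_pred_subset[OF assms(1,2)] assms(3)] by (simp add: conj_assoc)

lemma cond_class_False:
  assumes "finite E" shows "cond_class E (\<lambda>_. False) = (0 :: 'k::field K0)"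
  using cond_class_split[OF assms loc_False polyfun_1, where 'a='k] by simp

lemma cond_class_isomorphic:
  assumes "finite E" "finite E'" "loc_closed_pred \<Phi>" "loc_closed_pred \<Psi>"
    and "\<And>x. x \<in> affine_points E \<Longrightarrow> \<Phi> x \<Longrightarrow> \<phi> x \<in> affine_points E' \<and> \<Psi> (\<phi> x) \<and> \<psi> (\<phi> x) = x"
    and "\<And>y. y \<in> affine_points E' \<Longrightarrow> \<Psi> y \<Longrightarrow> \<psi> y \<in> affine_points E \<and> \<Phi> (\<psi> y) \<and> \<phi> (\<psi> y) = y"
    and "\<And>i. i \<in> E' \<Longrightarrow> ratfun {x\<in>affine_points E. \<Phi> x} (\<lambda>x. \<phi> x i)"
    and "\<And>i. i \<in> E \<Longrightarrow> ratfun {x\<in>affine_points E'. \<Psi> x} (\<lambda>y. \<psi> y i)"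
  shows "cond_class E \<Phi> = cond_class E' \<Psi>"
  by (rule set_class_isomorphic[OF loc_closed_pred_subset loc_closed_pred_subset isomorphic_ratfun[of _ _ _ _ \<phi> \<psi>]])
     (use assms in auto)

text \<open>Used both for functions and for conditions on points, hence the polymorphic codomain.\<close>

definition indep :: "nat \<Rightarrow> ('k::field point \<Rightarrow> 'b) \<Rightarrow> bool" where
  "indep i f \<longleftrightarrow> (\<forall>x c. f (x(i := c)) = f x)"

lemma indepD: "indep i f \<Longrightarrow> f (x(i := c)) = f x"
  by (simp add: indep_def)

lemma affine_points_insert_iff:
  "i \<notin> E \<Longrightarrow> x(i := 0) \<in> affine_points E \<longleftrightarrow> x \<in> affine_points (insert i E)"
  by (auto simp: affine_points_def)

lemma affine_points_upd_same: "i \<notin> E \<Longrightarrow> x \<in> affine_points E \<Longrightarrow> x(i := 0) = x"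
  by (auto simp: affine_points_def)

lemma cond_class_free:
  assumes "finite E" "i \<notin> E" "loc_closed_pred \<Phi>" "indep i \<Phi>"
  shows "cond_class (insert i E) \<Phi> = lefschetz * cond_class E \<Phi>"
  using assms(1,2,3)
  by (intro set_class_times_line loc_closed_pred_subset)
     (auto simp: indepD[OF assms(4)] affine_points_insert_iff)

text \<open>An equation that is linear in a new coordinate, with a coefficient without zeros, makes the locus a graph.\<close>

lemma cond_class_solve:
  assumes E: "finite E" "i \<notin> E" and \<Phi>: "loc_closed_pred \<Phi>" "indep i \<Phi>"
    and pq: "polyfun p" "polyfun q" "indep i p" "indep i q" and nz: "\<And>x. \<Phi> x \<Longrightarrow> q x \<noteq> 0"
  shows "cond_class (insert i E) (\<lambda>x. \<Phi> x \<and> q x * x i = p x) = cond_class E \<Phi>"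
proof (rule cond_class_isomorphic[where \<phi> = "\<lambda>x. x(i := 0)" and \<psi> = "\<lambda>y. y(i := p y / q y)"])
  show "loc_closed_pred (\<lambda>x. \<Phi> x \<and> q x * x i = p x)"
    by (intro loc_intros \<Phi> polyfun_intros pq)
next
  fix x assume x: "x \<in> affine_points (insert i E)" "\<Phi> x \<and> q x * x i = p x"
  then have "p x / q x = x i" using nz by (metis nonzero_mult_div_cancel_left)
  then show "x(i := 0) \<in> affine_points E \<and> \<Phi> (x(i := 0)) \<and>
      (x(i := 0))(i := p (x(i := 0)) / q (x(i := 0))) = x"
    using x by (simp add: affine_points_insert_iff[OF E(2)] indepD[OF \<Phi>(2)] indepD[OF pq(3)] indepD[OF pq(4)])
next
  fix y assume y: "y \<in> affine_points E" "\<Phi> y"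
  then show "y(i := p y / q y) \<in> affine_points (insert i E) \<and>
      (\<Phi> (y(i := p y / q y)) \<and> q (y(i := p y / q y)) * (y(i := p y / q y)) i = p (y(i := p y / q y))) \<and>
      (y(i := p y / q y))(i := 0) = y"
    using nz affine_points_upd_same[OF E(2)]
    by (simp add: indepD[OF \<Phi>(2)] indepD[OF pq(3)] indepD[OF pq(4)]) (auto simp: affine_points_def)
next
  fix j show "ratfun {x \<in> affine_points (insert i E). \<Phi> x \<and> q x * x i = p x} (\<lambda>x. (x(i := 0)) j)"
    by (cases "j = i") (simp_all add: ratfun_polyfun polyfun_0 polyfun_coord)
  have "ratfun {x \<in> affine_points E. \<Phi> x} (\<lambda>y. p y / q y)"
    unfolding ratfun_def using pq nz by blast
  then show "ratfun {x \<in> affine_points E. \<Phi> x} (\<lambda>y. (y(i := p y / q y)) j)"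
    by (cases "j = i") (simp_all add: ratfun_polyfun polyfun_coord)
qed (use E \<Phi> in auto)

lemma indep_const: "indep i (\<lambda>_. c)"
  by (simp add: indep_def)

lemma indep_conj: "indep i \<Phi> \<Longrightarrow> indep i \<Psi> \<Longrightarrow> indep i (\<lambda>x. \<Phi> x \<and> \<Psi> x)"
  by (simp add: indep_def)

lemma indep_eq: "indep i f \<Longrightarrow> indep i g \<Longrightarrow> indep i (\<lambda>x. f x = g x)"
  by (simp add: indep_def)

lemma indep_neq: "indep i f \<Longrightarrow> indep i g \<Longrightarrow> indep i (\<lambda>x. f x \<noteq> g x)"
  by (simp add: indep_def)

lemma indep_mult: "indep i f \<Longrightarrow> indep i g \<Longrightarrow> indep i (\<lambda>x. f x * g x)"
  by (simp add: indep_def)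

lemma indep_power: "indep i f \<Longrightarrow> indep i (\<lambda>x. f x ^ n)"
  by (simp add: indep_def)

lemma indep_uminus: "indep i f \<Longrightarrow> indep i (\<lambda>x. - f x)"
  by (simp add: indep_def)

lemma indep_add: "indep i f \<Longrightarrow> indep i g \<Longrightarrow> indep i (\<lambda>x. f x + g x)"
  by (simp add: indep_def)

lemma indep_diff: "indep i f \<Longrightarrow> indep i g \<Longrightarrow> indep i (\<lambda>x. f x - g x)"
  by (simp add: indep_def)

lemma indep_coord: "j \<noteq> i \<Longrightarrow> indep i (\<lambda>x. x j)"
  by (simp add: indep_def)

lemmas indep_intros = indep_const indep_conj indep_eq indep_neq indep_mult indep_power indep_uminus
  indep_add indep_diff indep_coord

lemma cond_class_coord_zero:
  assumes E: "finite E" "i \<notin> E" and \<Phi>: "loc_closed_pred \<Phi>" "indep i \<Phi>"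
  shows "cond_class (insert i E) (\<lambda>x. \<Phi> x \<and> x i = 0) = cond_class E \<Phi>"
  using cond_class_solve[OF E \<Phi> polyfun_0 polyfun_1 indep_const indep_const] by simp

lemma cond_class_coord_nonzero:
  assumes E: "finite E" "i \<notin> E" and \<Phi>: "loc_closed_pred \<Phi>" "indep i \<Phi>"
  shows "cond_class (insert i E) (\<lambda>x. \<Phi> x \<and> x i \<noteq> 0) = (lefschetz - 1) * cond_class E \<Phi>"
  using cond_class_split[OF _ \<Phi>(1) polyfun_coord[of i], of "insert i E"] E
    cond_class_free[OF E \<Phi>] cond_class_coord_zero[OF E \<Phi>]
  by (simp add: algebra_simps)

text \<open>Splitting by \<open>x\<^sub>i = 0\<close>: this is how each equation of the form \<open>x\<^sub>i f = 0\<close> below is resolved, where \<open>x\<^sub>i\<close>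
  does not occur in \<open>f\<close>.\<close>

lemma cond_class_zero_or:
  assumes E: "finite E" "i \<notin> E" and \<Phi>: "loc_closed_pred \<Phi>" "indep i \<Phi>"
    and \<Psi>: "loc_closed_pred \<Psi>" "indep i \<Psi>"
    and loc: "loc_closed_pred \<Theta>" and \<Theta>: "\<And>x. \<Theta> x \<longleftrightarrow> \<Phi> x \<and> (x i = 0 \<or> \<Psi> x)"
  shows "cond_class (insert i E) \<Theta> = cond_class E \<Phi> + (lefschetz - 1) * cond_class E (\<lambda>x. \<Phi> x \<and> \<Psi> x)"
proof -
  have "cond_class (insert i E) \<Theta> =
      cond_class (insert i E) (\<lambda>x. \<Theta> x \<and> x i = 0) + cond_class (insert i E) (\<lambda>x. \<Theta> x \<and> x i \<noteq> 0)"
    by (rule cond_class_split[OF _ loc polyfun_coord]) (use E in simp)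
  also have "cond_class (insert i E) (\<lambda>x. \<Theta> x \<and> x i = 0) = cond_class (insert i E) (\<lambda>x. \<Phi> x \<and> x i = 0)"
    by (rule cond_class_cong) (auto simp: \<Theta>)
  also have "\<dots> = cond_class E \<Phi>" by (rule cond_class_coord_zero[OF E \<Phi>])
  also have "cond_class (insert i E) (\<lambda>x. \<Theta> x \<and> x i \<noteq> 0) =
      cond_class (insert i E) (\<lambda>x. (\<Phi> x \<and> \<Psi> x) \<and> x i \<noteq> 0)"
    by (rule cond_class_cong) (auto simp: \<Theta>)
  also have "\<dots> = (lefschetz - 1) * cond_class E (\<lambda>x. \<Phi> x \<and> \<Psi> x)"
    by (rule cond_class_coord_nonzero[OF E loc_conj indep_conj]) (use \<Phi> \<Psi> in auto)
  finally show ?thesis .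
qed

section \<open>Continuants\<close>

text \<open>\<open>continuant a s j l\<close> is the determinant \<open>K(j..j+l-2)\<close> of the tridiagonal matrix with diagonal
  \<open>a\<^sub>j, \<dots>, a\<^sub>j\<^sub>+\<^sub>l\<^sub>-\<^sub>2\<close>, where \<open>s\<^sub>i\<close> (up to sign) couples \<open>i - 1\<close> and \<open>i\<close>. The index \<open>l\<close> exceeds the size of the matrix by
  one, so that the recurrence starts with the value \<open>0\<close> at size \<open>-1\<close>; such continuants do occur below.\<close>

fun continuant :: "(nat \<Rightarrow> 'a::comm_ring_1) \<Rightarrow> (nat \<Rightarrow> 'a) \<Rightarrow> nat \<Rightarrow> nat \<Rightarrow> 'a" where
  "continuant a s j 0 = 0"
| "continuant a s j (Suc 0) = 1"
| "continuant a s j (Suc (Suc l)) =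
     a (j + l) * continuant a s j (Suc l) - (s (j + l))\<^sup>2 * continuant a s j l"

lemma continuant_cong:
  "(\<And>i. j \<le> i \<Longrightarrow> i + 1 < j + l \<Longrightarrow> a i = a' i) \<Longrightarrow> (\<And>i. j < i \<Longrightarrow> i + 1 < j + l \<Longrightarrow> s i = s' i) \<Longrightarrow>
    continuant a s j l = continuant a' s' j l"
proof (induction a s j l rule: continuant.induct)
  case (3 a s j l)
  have "continuant a s j (Suc l) = continuant a' s' j (Suc l)"
    "continuant a s j l = continuant a' s' j l"
    using 3 by auto
  moreover have "a (j + l) = a' (j + l)" "l > 0 \<Longrightarrow> s (j + l) = s' (j + l)" using 3 by auto
  ultimately show ?case by (cases l) auto
qed auto

text \<open>Expansion along the first instead of the last row.\<close>

lemma continuant_left: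
  "continuant a s j (Suc (Suc l)) =
    a j * continuant a s (Suc j) (Suc l) - (s (Suc j))\<^sup>2 * continuant a s (Suc (Suc j)) l"
proof (induction l rule: induct_nat_012)
  case 0 then show ?case by simp
next
  case 1 then show ?case by (simp add: algebra_simps)
next
  case (ge2 l)
  have "continuant a s j (Suc (Suc (Suc (Suc l)))) =
      a (j + Suc (Suc l)) * continuant a s j (Suc (Suc (Suc l))) - (s (j + Suc (Suc l)))\<^sup>2 * continuant a s j (Suc (Suc l))"
    by (rule continuant.simps)
  also note ge2(1)
  also note ge2(2)
  finally show ?case by (simp add: algebra_simps)
qed

lemma continuant_reverse:
  "j + l \<le> N + 2 \<Longrightarrow> continuant (\<lambda>i. a (N - i)) (\<lambda>i. s (N + 1 - i)) j l = continuant a s (N + 2 - j - l) l"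
proof (induction l rule: induct_nat_012)
  case (ge2 l)
  have 1: "N + 2 - j - Suc l = Suc (N - j - l)" "N + 2 - j - l = Suc (Suc (N - j - l))"
    "N + 1 - (j + l) = Suc (N - j - l)" "N + 2 - j - Suc (Suc l) = N - j - l" "N - (j + l) = N - j - l"
    using ge2(3) by auto
  have IH: "continuant (\<lambda>i. a (N - i)) (\<lambda>i. s (N + 1 - i)) j l = continuant a s (N + 2 - j - l) l"
    "continuant (\<lambda>i. a (N - i)) (\<lambda>i. s (N + 1 - i)) j (Suc l) = continuant a s (N + 2 - j - Suc l) (Suc l)"
    using ge2 by auto
  show ?case
    unfolding continuant.simps(3)[of "\<lambda>i. a (N - i)"] IH 1 continuant_left[of a s "N - j - l"] by simp
qed auto

text \<open>The condensation identity for the corner minors: the minors without first row and last column, and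
  vice versa, are the product of the couplings.\<close>

lemma continuant_condensation:
  "continuant a s j (Suc (Suc n)) * continuant a s (Suc j) n =
    continuant a s (Suc j) (Suc n) * continuant a s j (Suc n) - (\<Prod>i=Suc j..<j + Suc n. s i)\<^sup>2"
proof (induction n)
  case (Suc n)
  have p: "(\<Prod>i=Suc j..<j + Suc (Suc n). s i) = (\<Prod>i=Suc j..<j + Suc n. s i) * s (j + Suc n)"
    by simp
  have "continuant a s j (Suc (Suc (Suc n))) * continuant a s (Suc j) (Suc n) -
      continuant a s (Suc j) (Suc (Suc n)) * continuant a s j (Suc (Suc n)) =
      (s (j + Suc n))\<^sup>2 * (continuant a s j (Suc (Suc n)) * continuant a s (Suc j) n -
        continuant a s (Suc j) (Suc n) * continuant a s j (Suc n))"
    by (simp only: continuant.simps(3)[of a s j "Suc n"] continuant.simps(3)[of a s "Suc j" n])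
       (simp add: algebra_simps del: continuant.simps)
  also have "\<dots> = (s (j + Suc n))\<^sup>2 * - (\<Prod>i=Suc j..<j + Suc n. s i)\<^sup>2"
    by (simp only: Suc.IH) simp
  also have "\<dots> = - (\<Prod>i=Suc j..<j + Suc (Suc n). s i)\<^sup>2"
    by (simp only: p power_mult_distrib) simp
  finally show ?case by (simp add: diff_eq_eq del: continuant.simps)
qed simp

subsection \<open>Classes of continuant loci\<close>

text \<open>A point of affine space encodes a chain: \<open>a\<^sub>i\<close> is its coordinate \<open>2 i\<close> and \<open>s\<^sub>i\<close> its coordinate \<open>2 i + 1\<close>.\<close>

definition kont :: "nat \<Rightarrow> nat \<Rightarrow> 'k::field point \<Rightarrow> 'k alg_closure" where
  "kont j l x = continuant (\<lambda>i. x (2 * i)) (\<lambda>i. x (2 * i + 1)) j l"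

lemma kont_simps [simp]: "kont j 0 x = 0" "kont j (Suc 0) x = 1"
  by (simp_all add: kont_def)

lemma kont_Suc_Suc:
  "kont j (Suc (Suc l)) x = x (2 * (j + l)) * kont j (Suc l) x - (x (2 * (j + l) + 1))\<^sup>2 * kont j l x"
  by (simp add: kont_def)

lemma polyfun_kont [polyfun_intros]: "polyfun (kont j l :: 'k::field point \<Rightarrow> _)"
proof (induction l rule: induct_nat_012)
  case (ge2 l)
  have "polyfun (\<lambda>x :: 'k point. x (2 * (j + l)) * kont j (Suc l) x - (x (2 * (j + l) + 1))\<^sup>2 * kont j l x)"
    by (intro polyfun_intros ge2)
  then show ?case by (simp only: kont_Suc_Suc[symmetric])
next
  case 0
  have "kont j 0 = (\<lambda>x :: 'k point. 0)" by (rule ext) simp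
  then show ?case by (simp add: polyfun_0)
next
  case 1
  have "kont j 1 = (\<lambda>x :: 'k point. 1)" by (rule ext) simp
  then show ?case by (simp add: polyfun_1)
qed

lemma indep_kont:
  "(j + l \<le> Suc m \<and> 2 * m \<le> i) \<or> i < 2 * j \<or> i = 2 * j + 1 \<Longrightarrow> indep i (kont j l)"
  unfolding indep_def kont_def by (intro allI continuant_cong) (auto; presburger)+

text \<open>The coupling \<open>s\<^sub>1\<close> is absent, since it leads out of the chain \<open>1, \<dots>, m\<close>.\<close>

definition chain_vars :: "nat \<Rightarrow> nat set" where
  "chain_vars m = (\<lambda>i. 2 * i) ` {1..m} \<union> (\<lambda>i. 2 * i + 1) ` {2..m}"

lemma finite_chain_vars [simp]: "finite (chain_vars m)"
  by (simp add: chain_vars_def)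

lemma chain_vars_1: "chain_vars (Suc 0) = {2}"
  by (auto simp: chain_vars_def)

lemma chain_vars_Suc:
  "m \<ge> 1 \<Longrightarrow> chain_vars (Suc m) = insert (2 * Suc m) (insert (2 * Suc m + 1) (chain_vars m))"
  by (auto simp: chain_vars_def atLeastAtMostSuc_conv)

lemma chain_vars_bound: "i \<in> chain_vars m \<Longrightarrow> 2 \<le> i \<and> i \<noteq> 3 \<and> i < 2 * Suc m"
  unfolding chain_vars_def by (elim UnE imageE; simp; presburger)

lemma chain_vars_notin: "2 * Suc m \<notin> chain_vars m" "2 * Suc m + 1 \<notin> chain_vars m"
  using chain_vars_bound by fastforce+

text \<open>The classes \<open>b\<^sub>m, c\<^sub>m, d\<^sub>m, e\<^sub>m\<close> of the introduction.\<close>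

definition cls_b :: "nat \<Rightarrow> 'k::field K0" where
  "cls_b m = cond_class (chain_vars m) (\<lambda>x. kont 1 (Suc m) x = 0)"
definition cls_c :: "nat \<Rightarrow> 'k::field K0" where
  "cls_c m = cond_class (chain_vars m) (\<lambda>x. kont 1 (Suc m) x = 0 \<and> kont 1 m x = 0)"
definition cls_d :: "nat \<Rightarrow> 'k::field K0" where
  "cls_d m = cond_class (chain_vars m) (\<lambda>x. (kont 1 (Suc m) x = 0 \<and> kont 1 m x = 0) \<and>
     kont 2 m x = 0 \<and> kont 2 (m - 1) x = 0)"
definition cls_e :: "nat \<Rightarrow> 'k::field K0" where
  "cls_e m = cond_class (chain_vars m) (\<lambda>x. (kont 1 (Suc m) x = 0 \<and> kont 1 m x = 0) \<and> kont 2 m x = 0)"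

text \<open>Reading the chain backwards exchanges \<open>K(1..m-1)\<close> and \<open>K(2..m)\<close> and permutes the coordinates.\<close>

lemma cls_c_reversed:
  "cls_c m = (cond_class (chain_vars m) (\<lambda>x. kont 1 (Suc m) x = 0 \<and> kont 2 m x = 0) :: 'k::field K0)"
proof -
  \<comment> \<open>\<open>a\<^sub>i\<close> goes to \<open>a\<^sub>m\<^sub>+\<^sub>1\<^sub>-\<^sub>i\<close> and \<open>s\<^sub>i\<close>, which couples \<open>i - 1\<close> and \<open>i\<close>, to \<open>s\<^sub>m\<^sub>+\<^sub>2\<^sub>-\<^sub>i\<close>.\<close>
  define \<pi> where "\<pi> i = (if even i then 2 * (m + 1) - i else 2 * (m + 2) + 2 - i)" for i :: nat
  let ?E = "chain_vars m"
  have \<pi>: "\<pi> i \<in> ?E \<and> \<pi> (\<pi> i) = i" if "i \<in> ?E" for i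
  proof -
    have "(\<exists>j\<in>{1..m}. i = 2 * j) \<or> (\<exists>j\<in>{2..m}. i = 2 * j + 1)" using that by (auto simp: chain_vars_def)
    then show ?thesis
    proof (elim disjE bexE)
      fix j assume j: "j \<in> {1..m}" "i = 2 * j"
      then have "\<pi> i = 2 * (m + 1 - j)" by (simp add: \<pi>_def diff_mult_distrib2)
      moreover have "m + 1 - j \<in> {1..m}" using j by auto
      moreover have "2 * (m + 1) - 2 * (m + 1 - j) = 2 * j" using j by auto
      ultimately show ?thesis using j by (auto simp: chain_vars_def \<pi>_def)
    next
      fix j assume j: "j \<in> {2..m}" "i = 2 * j + 1"
      then have "\<pi> i = 2 * (m + 2 - j) + 1" by (auto simp: \<pi>_def)
      moreover have "m + 2 - j \<in> {2..m}" using j by auto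
      moreover have "2 * (m + 2) + 2 - (2 * (m + 2 - j) + 1) = 2 * j + 1" using j by auto
      ultimately show ?thesis using j by (auto simp: chain_vars_def \<pi>_def)
    qed
  qed
  define \<phi> :: "'k point \<Rightarrow> 'k point" where "\<phi> x i = (if i \<in> ?E then x (\<pi> i) else 0)" for x i
  have \<phi>_aff: "\<phi> x \<in> affine_points ?E" for x by (simp add: \<phi>_def affine_points_def)
  have \<phi>_inv: "\<phi> (\<phi> x) = x" if "x \<in> affine_points ?E" for x
    using that \<pi> by (auto simp: \<phi>_def affine_points_def fun_eq_iff)
  have rev: "kont j l (\<phi> x) = kont (m + 3 - j - l) l x" if "j \<ge> 1" "j + l \<le> m + 2" for j l x
  proof -
    have "kont j l (\<phi> x) = continuant (\<lambda>i. x (2 * (m + 1 - i))) (\<lambda>i. x (2 * (m + 1 + 1 - i) + 1)) j l"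
      unfolding kont_def
    proof (rule continuant_cong)
      fix i assume "j \<le> i" "i + 1 < j + l"
      then have "i \<in> {1..m}" using that by auto
      then show "\<phi> x (2 * i) = x (2 * (m + 1 - i))"
        by (auto simp: \<phi>_def chain_vars_def \<pi>_def diff_mult_distrib2)
    next
      fix i assume "j < i" "i + 1 < j + l"
      then have "i \<in> {2..m}" using that by auto
      moreover from this have "\<pi> (2 * i + 1) = 2 * (m + 1 + 1 - i) + 1" by (auto simp: \<pi>_def)
      ultimately show "\<phi> x (2 * i + 1) = x (2 * (m + 1 + 1 - i) + 1)"
        by (simp add: \<phi>_def chain_vars_def)
    qed
    also have "\<dots> = kont (m + 3 - j - l) l x"
      using continuant_reverse[of j l "m + 1" "\<lambda>i. x (2 * i)" "\<lambda>i. x (2 * i + 1)"] that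
      by (simp add: kont_def eval_nat_numeral)
    finally show ?thesis .
  qed
  have poly: "polyfun (\<lambda>x. \<phi> x i)" for i
    by (cases "i \<in> ?E") (simp_all add: \<phi>_def polyfun_0 polyfun_coord)
  have r: "kont 1 (Suc m) (\<phi> x) = kont 1 (Suc m) x" "kont 1 m (\<phi> x) = kont 2 m x"
    "kont 2 m (\<phi> x) = kont 1 m x" for x
    using rev[of 1 "Suc m" x] rev[of 1 m x] rev[of 2 m x] by (simp_all add: eval_nat_numeral)
  show ?thesis unfolding cls_c_def
    by (rule cond_class_isomorphic[where \<phi> = \<phi> and \<psi> = \<phi>])
       (simp_all add: r[simplified One_nat_def] \<phi>_aff \<phi>_inv ratfun_polyfun[OF poly] loc_intros polyfun_kont polyfun_0)
qed

lemma affine_class: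
  "m \<ge> 1 \<Longrightarrow> cond_class (chain_vars m) (\<lambda>_. True) = (lefschetz :: 'k::field K0) ^ (2 * m - 1)"
proof (induction m rule: nat_induct_at_least)
  case base
  have "cond_class {2} (\<lambda>_. True) = (lefschetz :: 'k K0) * cond_class {} (\<lambda>_. True)"
    by (rule cond_class_free) (simp_all add: loc_True indep_const)
  then show ?case by (simp add: chain_vars_1 set_class_point)
next
  case (Suc m)
  have "cond_class (chain_vars (Suc m)) (\<lambda>_. True) =
      (lefschetz :: 'k K0) * cond_class (insert (2 * Suc m + 1) (chain_vars m)) (\<lambda>_. True)"
    unfolding chain_vars_Suc[OF Suc.hyps]
    by (rule cond_class_free) (use chain_vars_notin[of m] in \<open>auto simp: loc_True indep_const\<close>)
  also have "cond_class (insert (2 * Suc m + 1) (chain_vars m)) (\<lambda>_. True) =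
      (lefschetz :: 'k K0) * cond_class (chain_vars m) (\<lambda>_. True)"
    by (rule cond_class_free) (use chain_vars_notin[of m] in \<open>auto simp: loc_True indep_const\<close>)
  finally show ?case
    using Suc.hyps Suc.IH by (cases m) simp_all
qed

lemma cls_base: "cls_b 1 = 1" "cls_c 1 = 0" "cls_d 1 = 0" "cls_e 1 = 0"
proof -
  have "cls_b 1 = cond_class {2} (\<lambda>x :: 'a point. True \<and> x 2 = 0)"
    unfolding cls_b_def chain_vars_1 One_nat_def
    by (rule cond_class_cong) (simp add: kont_Suc_Suc)
  also have "\<dots> = cond_class {} (\<lambda>x :: 'a point. True)"
    by (rule cond_class_coord_zero) (simp_all add: loc_True indep_const)
  finally show "cls_b 1 = (1 :: 'a::field K0)" by (simp add: set_class_point)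
  show "cls_c 1 = (0 :: 'b::field K0)" "cls_d 1 = (0 :: 'c::field K0)" "cls_e 1 = (0 :: 'd::field K0)"
    unfolding cls_c_def cls_d_def cls_e_def by (simp_all add: cond_class_False[simplified])
qed

text \<open>The situation when the chain grows: of the two new coordinates \<open>a\<^sub>i\<close> is free and \<open>s\<^sub>j\<close> multiplies the remaining
  conditions.\<close>

lemma two_step_zero_or:
  assumes E: "finite E" "i \<notin> E" "j \<notin> E" "i \<noteq> j"
    and \<Phi>: "loc_closed_pred \<Phi>" "indep i \<Phi>" "indep j \<Phi>"
    and \<Psi>: "loc_closed_pred \<Psi>" "indep i \<Psi>" "indep j \<Psi>"
    and loc: "loc_closed_pred \<Theta>" and \<Theta>: "\<And>x. \<Theta> x \<longleftrightarrow> \<Phi> x \<and> (x j = 0 \<or> \<Psi> x)"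
  shows "cond_class (insert i (insert j E)) \<Theta> =
    lefschetz * (cond_class E \<Phi> + (lefschetz - 1) * cond_class E (\<lambda>x. \<Phi> x \<and> \<Psi> x))"
proof -
  have "indep i \<Theta>"
    using E \<Phi>(2) \<Psi>(2) unfolding indep_def \<Theta> by simp
  then have "cond_class (insert i (insert j E)) \<Theta> = lefschetz * cond_class (insert j E) \<Theta>"
    by (intro cond_class_free) (use E loc in auto)
  also have "cond_class (insert j E) \<Theta> =
      cond_class E \<Phi> + (lefschetz - 1) * cond_class E (\<lambda>x. \<Phi> x \<and> \<Psi> x)"
    by (rule cond_class_zero_or[OF _ _ \<Phi>(1,3) \<Psi>(1,3) loc \<Theta>]) (use E in auto)
  finally show ?thesis .
qed

context
  fixes m :: nat
  assumes m: "m \<ge> 1"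
begin

private lemma new_vars:
  "finite (chain_vars m)" "2 * Suc m \<notin> chain_vars m" "2 * Suc m + 1 \<notin> chain_vars m"
  "2 * Suc m \<noteq> 2 * Suc m + 1"
  using chain_vars_notin by auto

private lemma indep_new [simp]:
  "i \<ge> 2 * Suc m \<Longrightarrow> indep i (kont 1 (Suc m))" "i \<ge> 2 * Suc m \<Longrightarrow> indep i (kont 1 m)"
  "i \<ge> 2 * Suc m \<Longrightarrow> indep i (kont 2 m)" "i \<ge> 2 * Suc m \<Longrightarrow> indep i (kont 2 (m - 1))"
  by (rule indep_kont; use m in force)+

private lemmas [simp] = indep_new[unfolded One_nat_def]

private lemma kont_step:
  "kont 1 (Suc (Suc m)) x = x (2 * Suc m) * kont 1 (Suc m) x - (x (2 * Suc m + 1))\<^sup>2 * kont 1 m x"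
  "kont 2 (Suc m) x = x (2 * Suc m) * kont 2 m x - (x (2 * Suc m + 1))\<^sup>2 * kont 2 (m - 1) x"
proof -
  show "kont 1 (Suc (Suc m)) x = x (2 * Suc m) * kont 1 (Suc m) x - (x (2 * Suc m + 1))\<^sup>2 * kont 1 m x"
    unfolding kont_Suc_Suc by simp
  obtain k where "m = Suc k" using m by (cases m) auto
  then show "kont 2 (Suc m) x = x (2 * Suc m) * kont 2 m x - (x (2 * Suc m + 1))\<^sup>2 * kont 2 (m - 1) x"
    using kont_Suc_Suc[of 2 k x] by simp
qed

text \<open>Given \<open>K(1..m) = 0\<close>, the recurrence turns \<open>K(1..m+1) = 0\<close> into \<open>s\<^sup>2 K(1..m-1) = 0\<close> for the new coupling \<open>s\<close>.\<close>

lemma cls_c_Suc: "cls_c (Suc m) = lefschetz * (cls_b m + (lefschetz - 1) * cls_c m)"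
  unfolding cls_c_def[of "Suc m"] cls_b_def cls_c_def[of m] chain_vars_Suc[OF m]
proof (rule two_step_zero_or)
  show "loc_closed_pred (\<lambda>x :: 'a point. kont 1 (Suc (Suc m)) x = 0 \<and> kont 1 (Suc m) x = 0)"
    by (intro loc_intros polyfun_intros)
qed (use new_vars in \<open>auto intro!: loc_intros polyfun_intros indep_intros simp: kont_step[simplified]\<close>)

text \<open>Both continuants lose their first term, and what remains is divisible by the new coupling.\<close>

lemma cls_d_Suc: "cls_d (Suc m) = lefschetz * (cls_c m + (lefschetz - 1) * cls_d m)"
  unfolding cls_d_def[of "Suc m"] cls_c_reversed cls_d_def[of m] chain_vars_Suc[OF m]
proof -
  have eq: "((kont 1 (Suc m) x = 0 \<and> kont 1 m x = 0) \<and> kont 2 m x = 0 \<and> kont 2 (m - 1) x = 0) \<longleftrightarrow>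
     (kont 1 (Suc m) x = 0 \<and> kont 2 m x = 0) \<and> (kont 1 m x = 0 \<and> kont 2 (m - 1) x = 0)" for x :: "'a point"
    by auto
  show "cond_class (insert (2 * Suc m) (insert (2 * Suc m + 1) (chain_vars m)))
      (\<lambda>x. (kont 1 (Suc (Suc m)) x = 0 \<and> kont 1 (Suc m) x = 0) \<and> kont 2 (Suc m) x = 0 \<and> kont 2 (Suc m - 1) x = 0) =
    lefschetz * (cond_class (chain_vars m) (\<lambda>x. kont 1 (Suc m) x = 0 \<and> kont 2 m x = 0) + (lefschetz - 1) *
      cond_class (chain_vars m) (\<lambda>x :: 'a point. (kont 1 (Suc m) x = 0 \<and> kont 1 m x = 0) \<and> kont 2 m x = 0 \<and> kont 2 (m - 1) x = 0))"
    unfolding eq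
  proof (rule two_step_zero_or)
    show "loc_closed_pred (\<lambda>x :: 'a point. (kont 1 (Suc (Suc m)) x = 0 \<and> kont 1 (Suc m) x = 0) \<and>
        kont 2 (Suc m) x = 0 \<and> kont 2 (Suc m - 1) x = 0)"
      by (intro loc_intros polyfun_intros)
  qed (use new_vars in \<open>auto intro!: loc_intros polyfun_intros indep_intros simp: kont_step[simplified]\<close>)
qed

text \<open>Where \<open>K(1..m) \<noteq> 0\<close> the new diagonal entry is determined; the rest is the locus of \<open>cls_c (Suc m)\<close>.\<close>

lemma cls_b_Suc: "cls_b (Suc m) = lefschetz * (lefschetz ^ (2 * m - 1) - cls_b m) + cls_c (Suc m)"
proof -
  let ?E = "insert (2 * Suc m) (insert (2 * Suc m + 1) (chain_vars m))"
  have "cls_b (Suc m) = cond_class ?E (\<lambda>x :: 'a point. kont 1 (Suc (Suc m)) x = 0 \<and> kont 1 (Suc m) x = 0) +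
      cond_class ?E (\<lambda>x. kont 1 (Suc (Suc m)) x = 0 \<and> kont 1 (Suc m) x \<noteq> 0)"
    unfolding cls_b_def chain_vars_Suc[OF m]
    by (rule cond_class_split) (simp_all add: loc_intros polyfun_intros)
  also have "cond_class ?E (\<lambda>x :: 'a point. kont 1 (Suc (Suc m)) x = 0 \<and> kont 1 (Suc m) x = 0) = cls_c (Suc m)"
    by (simp add: cls_c_def chain_vars_Suc[OF m])
  also have "cond_class ?E (\<lambda>x :: 'a point. kont 1 (Suc (Suc m)) x = 0 \<and> kont 1 (Suc m) x \<noteq> 0) =
      cond_class ?E (\<lambda>x. kont 1 (Suc m) x \<noteq> 0 \<and> kont 1 (Suc m) x * x (2 * Suc m) = (x (2 * Suc m + 1))\<^sup>2 * kont 1 m x)"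
    by (rule cond_class_cong) (auto simp: kont_step[simplified] mult.commute)
  also have "\<dots> = cond_class (insert (2 * Suc m + 1) (chain_vars m)) (\<lambda>x :: 'a point. kont 1 (Suc m) x \<noteq> 0)"
    by (rule cond_class_solve)
       (use new_vars in \<open>auto intro!: loc_intros polyfun_intros indep_intros\<close>)
  also have "\<dots> = lefschetz * cond_class (chain_vars m) (\<lambda>x :: 'a point. kont 1 (Suc m) x \<noteq> 0)"
    by (rule cond_class_free)
       (use new_vars in \<open>auto intro!: loc_intros polyfun_intros indep_intros\<close>)
  also have "cond_class (chain_vars m) (\<lambda>x :: 'a point. kont 1 (Suc m) x \<noteq> 0) =
      lefschetz ^ (2 * m - 1) - cls_b m"
    using cond_class_split[OF finite_chain_vars loc_True polyfun_kont, of m 1 "Suc m", where 'a = 'a]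
    by (simp add: affine_class[OF m, simplified] cls_b_def)
  finally show ?thesis by (simp add: add.commute)
qed

text \<open>Here \<open>K(2..m+1) = 0\<close> can be solved for the new diagonal entry where \<open>K(2..m) \<noteq> 0\<close>.\<close>

lemma cls_e_Suc:
  "cls_e (Suc m) = cls_b m - cls_c m + (lefschetz - 1) * (cls_c m - cls_e m) +
     lefschetz * (cls_c m + (lefschetz - 1) * cls_d m)"
proof -
  let ?i = "2 * Suc m" and ?j = "2 * Suc m + 1"
  let ?E = "insert ?i (insert ?j (chain_vars m))"
  let ?P = "kont 1 (Suc m) :: 'a point \<Rightarrow> _" and ?Q = "kont 1 m :: 'a point \<Rightarrow> _"
    and ?P' = "kont 2 m :: 'a point \<Rightarrow> _" and ?Q' = "kont 2 (m - 1) :: 'a point \<Rightarrow> _"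
  let ?\<Theta> = "\<lambda>x. (kont 1 (Suc (Suc m)) x = 0 \<and> ?P x = 0) \<and> kont 2 (Suc m) x = 0"
  have "cls_e (Suc m) = cond_class ?E (\<lambda>x. ?\<Theta> x \<and> ?P' x = 0) + cond_class ?E (\<lambda>x. ?\<Theta> x \<and> ?P' x \<noteq> 0)"
    unfolding cls_e_def chain_vars_Suc[OF m]
    by (rule cond_class_split) (simp_all add: loc_intros polyfun_intros)
  also have "cond_class ?E (\<lambda>x. ?\<Theta> x \<and> ?P' x = 0) =
      lefschetz * (cond_class (chain_vars m) (\<lambda>x. ?P x = 0 \<and> ?P' x = 0) + (lefschetz - 1) *
        cond_class (chain_vars m) (\<lambda>x. (?P x = 0 \<and> ?P' x = 0) \<and> (?Q x = 0 \<and> ?Q' x = 0)))"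
  proof (rule two_step_zero_or)
    show "loc_closed_pred (\<lambda>x. ?\<Theta> x \<and> ?P' x = 0)" by (intro loc_intros polyfun_intros)
  qed (use new_vars in \<open>auto intro!: loc_intros polyfun_intros indep_intros simp: kont_step[simplified]\<close>)
  also have "cond_class (chain_vars m) (\<lambda>x. ?P x = 0 \<and> ?P' x = 0) = cls_c m"
    by (simp add: cls_c_reversed)
  also have "cond_class (chain_vars m) (\<lambda>x. (?P x = 0 \<and> ?P' x = 0) \<and> (?Q x = 0 \<and> ?Q' x = 0)) = cls_d m"
    unfolding cls_d_def by (rule cond_class_cong) auto
  also have "cond_class ?E (\<lambda>x. ?\<Theta> x \<and> ?P' x \<noteq> 0) =
      cond_class ?E (\<lambda>x. ((?P x = 0 \<and> x ?j * ?Q x = 0) \<and> ?P' x \<noteq> 0) \<and> ?P' x * x ?i = (x ?j)\<^sup>2 * ?Q' x)"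
    by (rule cond_class_cong) (auto simp: kont_step[simplified] mult.commute)
  also have "\<dots> = cond_class (insert ?j (chain_vars m)) (\<lambda>x. (?P x = 0 \<and> x ?j * ?Q x = 0) \<and> ?P' x \<noteq> 0)"
    by (rule cond_class_solve)
       (use new_vars in \<open>auto intro!: loc_intros polyfun_intros indep_intros simp del: mult_eq_0_iff\<close>)
  also have "\<dots> = cond_class (chain_vars m) (\<lambda>x. ?P x = 0 \<and> ?P' x \<noteq> 0) +
      (lefschetz - 1) * cond_class (chain_vars m) (\<lambda>x. (?P x = 0 \<and> ?P' x \<noteq> 0) \<and> ?Q x = 0)"
  proof (rule cond_class_zero_or)
    show "loc_closed_pred (\<lambda>x. (?P x = 0 \<and> x ?j * ?Q x = 0) \<and> ?P' x \<noteq> 0)"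
      by (intro loc_intros polyfun_intros)
  qed (use new_vars in \<open>auto intro!: loc_intros polyfun_intros indep_intros\<close>)
  also have "cond_class (chain_vars m) (\<lambda>x. ?P x = 0 \<and> ?P' x \<noteq> 0) = cls_b m - cls_c m"
    using cond_class_split[OF finite_chain_vars loc_eq[OF polyfun_kont polyfun_0] polyfun_kont, of m 1 "Suc m" 2 m,
        where 'a = 'a]
    by (simp add: cls_b_def cls_c_reversed)
  also have "cond_class (chain_vars m) (\<lambda>x. (?P x = 0 \<and> ?P' x \<noteq> 0) \<and> ?Q x = 0) =
      cond_class (chain_vars m) (\<lambda>x. (?P x = 0 \<and> ?Q x = 0) \<and> ?P' x \<noteq> 0)"
    by (rule cond_class_cong) auto
  also have "\<dots> = cls_c m - cls_e m"
    using cond_class_split[OF finite_chain_vars loc_conj[OF loc_eq[OF polyfun_kont polyfun_0]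
          loc_eq[OF polyfun_kont polyfun_0]] polyfun_kont, of m 1 "Suc m" 1 m 2 m, where 'a = 'a]
    by (simp add: cls_c_def cls_e_def)
  finally show ?thesis by (simp add: add_ac)
qed

end

lemma cond_class_nonzero:
  assumes "finite E" "loc_closed_pred \<Phi>" "polyfun f"
  shows "cond_class E (\<lambda>x. \<Phi> x \<and> f x \<noteq> 0) = cond_class E \<Phi> - cond_class E (\<lambda>x. \<Phi> x \<and> f x = 0)"
  using cond_class_split[OF assms] by simp

text \<open>The coordinates \<open>0, 1, 3\<close> are \<open>a\<^sub>0, s\<^sub>0, s\<^sub>1\<close>, and the equation says that the determinant \<open>a\<^sub>0 P - Q\<close> of the cyclic matrix is
  zero, where \<open>P = K(1..m)\<close>. If \<open>P \<noteq> 0\<close>, then \<open>a\<^sub>0\<close> is determined. If \<open>P = 0\<close>, then \<open>a\<^sub>0\<close> is free and the form \<open>Q\<close> in \<open>s\<^sub>0, s\<^sub>1\<close> has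
  the leading coefficients \<open>A = K(2..m)\<close> and \<open>B = K(1..m-1)\<close> and discriminant zero. Hence \<open>Q = 0\<close> is a line, unless
  \<open>A = B = 0\<close>, when it is the plane; this exception is the locus of \<open>cls_e m\<close>.\<close>

lemma periodic_class:
  assumes m: "m \<ge> 1"
  defines "pr \<equiv> (\<lambda>x :: 'k::field point. \<Prod>i=2..<Suc m. x (2 * i + 1))"
  shows "cond_class (insert 0 (insert 1 (insert 3 (chain_vars m))))
     (\<lambda>x. kont 1 (Suc m) x * x 0 =
        (x 3)\<^sup>2 * kont 2 m x + (x 1)\<^sup>2 * kont 1 m x + (x 1 * x 3 * pr x + x 1 * x 3 * pr x)) =
     (lefschetz :: 'k K0) ^ (2 * m + 1) + lefschetz * lefschetz * (lefschetz - 1) * cls_e m"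
proof -
  let ?L = "lefschetz :: 'k K0"
  let ?P = "kont 1 (Suc m) :: 'k point \<Rightarrow> _" and ?A = "kont 2 m :: 'k point \<Rightarrow> _"
    and ?B = "kont 1 m :: 'k point \<Rightarrow> _"
  let ?E = "chain_vars m"
  define Q where "Q = (\<lambda>x :: 'k point. (x 3)\<^sup>2 * ?A x + (x 1)\<^sup>2 * ?B x + (x 1 * x 3 * pr x + x 1 * x 3 * pr x))"
  have notin: "0 \<notin> ?E" "1 \<notin> ?E" "3 \<notin> ?E" using chain_vars_bound by fastforce+
  have fin: "finite ?E" by simp
  have ind: "indep i ?P" "indep i ?A" "indep i ?B" "indep i pr" if "i \<in> {0,1,3}" for i
    using that unfolding pr_def by (auto intro!: indep_kont) (auto simp: indep_def intro!: prod.cong)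
  have poly_pr: "polyfun pr" unfolding pr_def by (intro polyfun_intros)
  have polyQ: "polyfun Q" unfolding Q_def by (intro polyfun_intros poly_pr)
  have indQ: "indep 0 Q" unfolding Q_def by (intro indep_intros ind) auto
  note intros = loc_intros polyfun_intros poly_pr polyQ indep_intros ind ind[unfolded One_nat_def] indQ
  have cond: "?P x * kont 2 (m - 1) x = ?A x * ?B x - (pr x)\<^sup>2" for x
    using continuant_condensation[of "\<lambda>i. x (2 * i)" "\<lambda>i. x (2 * i + 1)" 1 "m - 1"] m
    by (simp add: kont_def pr_def eval_nat_numeral)
  have AB: "?A x * ?B x = (pr x)\<^sup>2" if "?P x = 0" for x using cond[of x] that by simp
  have AQ: "?A x * Q x = (?A x * x 3 + pr x * x 1)\<^sup>2" if "?P x = 0" for x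
  proof -
    have "?A x * Q x = (?A x * x 3)\<^sup>2 + (x 1)\<^sup>2 * (?A x * ?B x) + (?A x * x 3) * (pr x * x 1) + (?A x * x 3) * (pr x * x 1)"
      by (simp add: Q_def algebra_simps power2_eq_square)
    then show ?thesis unfolding AB[OF that] by (simp add: algebra_simps power2_eq_square)
  qed
  let ?E1 = "insert 1 (insert 3 ?E)"
  let ?F = "\<lambda>x. ?P x * x 0 = Q x"
  have "cond_class (insert 0 ?E1) ?F =
      cond_class (insert 0 ?E1) (\<lambda>x. ?F x \<and> ?P x = 0) + cond_class (insert 0 ?E1) (\<lambda>x. ?F x \<and> ?P x \<noteq> 0)"
    by (rule cond_class_split) (simp_all add: intros)
  also have "cond_class (insert 0 ?E1) (\<lambda>x. ?F x \<and> ?P x \<noteq> 0) = cond_class (insert 0 ?E1) (\<lambda>x. ?P x \<noteq> 0 \<and> ?P x * x 0 = Q x)"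
    by (rule cond_class_cong) auto
  also have "\<dots> = cond_class ?E1 (\<lambda>x. ?P x \<noteq> 0)"
    by (rule cond_class_solve) (use notin in \<open>auto intro!: intros\<close>)
  also have "\<dots> = ?L * (?L * cond_class ?E (\<lambda>x. ?P x \<noteq> 0))"
    using notin by (simp add: cond_class_free intros)
  also have "cond_class ?E (\<lambda>x. ?P x \<noteq> 0) = ?L ^ (2 * m - 1) - cls_b m"
    using cond_class_nonzero[OF fin loc_True polyfun_kont, of 1 "Suc m", where 'a = 'k]
    by (simp add: affine_class[OF m, simplified] cls_b_def)
  also have "cond_class (insert 0 ?E1) (\<lambda>x. ?F x \<and> ?P x = 0) = cond_class (insert 0 ?E1) (\<lambda>x. ?P x = 0 \<and> Q x = 0)"
    by (rule cond_class_cong) auto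
  also have "\<dots> = ?L * cond_class ?E1 (\<lambda>x. ?P x = 0 \<and> Q x = 0)"
    by (rule cond_class_free) (use notin in \<open>auto intro!: intros\<close>)
  also have "cond_class ?E1 (\<lambda>x. ?P x = 0 \<and> Q x = 0) =
      cond_class ?E1 (\<lambda>x. (?P x = 0 \<and> Q x = 0) \<and> ?A x = 0) + cond_class ?E1 (\<lambda>x. (?P x = 0 \<and> Q x = 0) \<and> ?A x \<noteq> 0)"
    by (rule cond_class_split) (simp_all add: intros)
  also have "cond_class ?E1 (\<lambda>x. (?P x = 0 \<and> Q x = 0) \<and> ?A x \<noteq> 0) =
      cond_class (insert 3 (insert 1 ?E)) (\<lambda>x. (?P x = 0 \<and> ?A x \<noteq> 0) \<and> ?A x * x 3 = - (pr x * x 1))"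
    unfolding insert_commute[of 1 3]
  proof (rule cond_class_cong)
    fix x :: "'k point"
    have "Q x = 0 \<longleftrightarrow> ?A x * x 3 = - (pr x * x 1)" if "?P x = 0" "?A x \<noteq> 0"
      using AQ[OF that(1)] that(2) by (metis add_eq_0_iff2 mult_eq_0_iff power2_eq_square)
    then show "((?P x = 0 \<and> Q x = 0) \<and> ?A x \<noteq> 0) = ((?P x = 0 \<and> ?A x \<noteq> 0) \<and> ?A x * x 3 = - (pr x * x 1))"
      by blast
  qed
  also have "\<dots> = cond_class (insert 1 ?E) (\<lambda>x. ?P x = 0 \<and> ?A x \<noteq> 0)"
    by (rule cond_class_solve) (use notin in \<open>auto intro!: intros\<close>)
  also have "\<dots> = ?L * cond_class ?E (\<lambda>x. ?P x = 0 \<and> ?A x \<noteq> 0)"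
    by (rule cond_class_free) (use notin in \<open>auto intro!: intros\<close>)
  also have "cond_class ?E (\<lambda>x. ?P x = 0 \<and> ?A x \<noteq> 0) = cls_b m - cls_c m"
    using cond_class_nonzero[OF fin loc_eq[OF polyfun_kont polyfun_0] polyfun_kont, of 1 "Suc m" 2 m, where 'a = 'k]
    by (simp add: cls_b_def cls_c_reversed)
  also have "cond_class ?E1 (\<lambda>x. (?P x = 0 \<and> Q x = 0) \<and> ?A x = 0) =
      cond_class ?E1 (\<lambda>x. (?P x = 0 \<and> ?A x = 0) \<and> x 1 * ?B x = 0)"
  proof (rule cond_class_cong)
    fix x :: "'k point"
    have "Q x = 0 \<longleftrightarrow> x 1 * ?B x = 0" if "?P x = 0" "?A x = 0"
    proof -
      have "pr x = 0" using AB[OF that(1)] that(2) by simp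
      then show ?thesis using that by (simp add: Q_def)
    qed
    then show "((?P x = 0 \<and> Q x = 0) \<and> ?A x = 0) = ((?P x = 0 \<and> ?A x = 0) \<and> x 1 * ?B x = 0)" by blast
  qed
  also have "\<dots> = cond_class (insert 3 ?E) (\<lambda>x. ?P x = 0 \<and> ?A x = 0) +
      (?L - 1) * cond_class (insert 3 ?E) (\<lambda>x. (?P x = 0 \<and> ?A x = 0) \<and> ?B x = 0)"
  proof (rule cond_class_zero_or)
    show "loc_closed_pred (\<lambda>x. (?P x = 0 \<and> ?A x = 0) \<and> x 1 * ?B x = 0)" by (intro intros)
  qed (use notin in \<open>auto intro!: intros\<close>)
  also have "cond_class (insert 3 ?E) (\<lambda>x. ?P x = 0 \<and> ?A x = 0) = ?L * cls_c m"
    unfolding cls_c_reversed by (rule cond_class_free) (use notin in \<open>auto intro!: intros\<close>)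
  also have "cond_class (insert 3 ?E) (\<lambda>x. (?P x = 0 \<and> ?A x = 0) \<and> ?B x = 0) =
      cond_class (insert 3 ?E) (\<lambda>x. (?P x = 0 \<and> ?B x = 0) \<and> ?A x = 0)"
    by (rule cond_class_cong) auto
  also have "\<dots> = ?L * cls_e m"
    unfolding cls_e_def by (rule cond_class_free) (use notin in \<open>auto intro!: intros\<close>)
  finally have "cond_class (insert 0 ?E1) ?F =
      ?L * (?L * cls_c m + (?L - 1) * (?L * cls_e m) + ?L * (cls_b m - cls_c m)) + ?L * (?L * (?L ^ (2 * m - 1) - cls_b m))" .
  also have "\<dots> = ?L * (?L * ?L ^ (2 * m - 1)) + ?L * ?L * (?L - 1) * cls_e m"
    by (simp add: algebra_simps)
  also have "?L * (?L * ?L ^ (2 * m - 1)) = ?L ^ (2 * m + 1)"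
    using m by (cases m) simp_all
  finally show ?thesis by (simp only: Q_def)
qed

text \<open>Resolving the factors \<open>s\<^sub>m\<^sub>+\<^sub>1\<close> and \<open>s\<^sub>1\<close> one after the other.\<close>

lemma vertex_locus_class:
  assumes m: "m \<ge> 1"
  shows "cond_class (insert 3 (insert (2 * Suc m + 1) (chain_vars m)))
     (\<lambda>x :: 'k::field point. (kont 1 (Suc m) x = 0 \<and> x 3 * kont 2 m x = 0) \<and>
        x (2 * Suc m + 1) * kont 1 m x = 0 \<and> x 3 * x (2 * Suc m + 1) * kont 2 (m - 1) x = 0) =
     cls_b m + (lefschetz - 1) * cls_c m + (lefschetz - 1) * (cls_c m + (lefschetz - 1) * cls_d m)"
proof -
  let ?t = "2 * Suc m + 1" and ?L = "lefschetz :: 'k K0"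
  let ?P = "kont 1 (Suc m) :: 'k point \<Rightarrow> _" and ?A = "kont 2 m :: 'k point \<Rightarrow> _"
    and ?B = "kont 1 m :: 'k point \<Rightarrow> _" and ?D = "kont 2 (m - 1) :: 'k point \<Rightarrow> _"
  let ?E = "chain_vars m"
  have notin: "3 \<notin> ?E" "?t \<notin> ?E" "3 \<noteq> ?t" using chain_vars_bound[of 3 m] chain_vars_notin[of m] m by auto
  have ind: "indep i ?P" "indep i ?A" "indep i ?B" "indep i ?D" if "i \<in> {3, ?t}" for i
    using that m by (auto intro!: indep_kont[of _ _ "Suc m"])
  note intros = loc_intros polyfun_intros indep_intros ind ind[unfolded One_nat_def]
  have "cond_class (insert ?t (insert 3 ?E)) (\<lambda>x. (?P x = 0 \<and> x 3 * ?A x = 0) \<and> x ?t * ?B x = 0 \<and> x 3 * x ?t * ?D x = 0) =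
      cond_class (insert 3 ?E) (\<lambda>x. ?P x = 0 \<and> x 3 * ?A x = 0) +
      (?L - 1) * cond_class (insert 3 ?E) (\<lambda>x. (?P x = 0 \<and> x 3 * ?A x = 0) \<and> ?B x = 0 \<and> x 3 * ?D x = 0)"
  proof (rule cond_class_zero_or)
    show "loc_closed_pred (\<lambda>x. (?P x = 0 \<and> x 3 * ?A x = 0) \<and> x ?t * ?B x = 0 \<and> x 3 * x ?t * ?D x = 0)"
      by (intro intros)
  qed (use notin in \<open>auto intro!: intros simp del: mult_eq_0_iff\<close>, auto)
  also have "cond_class (insert 3 ?E) (\<lambda>x. ?P x = 0 \<and> x 3 * ?A x = 0) =
      cls_b m + (?L - 1) * cond_class ?E (\<lambda>x. ?P x = 0 \<and> ?A x = 0)"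
    unfolding cls_b_def
  proof (rule cond_class_zero_or)
    show "loc_closed_pred (\<lambda>x. ?P x = 0 \<and> x 3 * ?A x = 0)" by (intro intros)
  qed (use notin in \<open>auto intro!: intros\<close>)
  also have "cond_class ?E (\<lambda>x. ?P x = 0 \<and> ?A x = 0) = cls_c m" by (simp add: cls_c_reversed)
  also have "cond_class (insert 3 ?E) (\<lambda>x. (?P x = 0 \<and> x 3 * ?A x = 0) \<and> ?B x = 0 \<and> x 3 * ?D x = 0) =
      cls_c m + (?L - 1) * cond_class ?E (\<lambda>x. (?P x = 0 \<and> ?B x = 0) \<and> ?A x = 0 \<and> ?D x = 0)"
    unfolding cls_c_def
  proof (rule cond_class_zero_or)
    show "loc_closed_pred (\<lambda>x. (?P x = 0 \<and> x 3 * ?A x = 0) \<and> ?B x = 0 \<and> x 3 * ?D x = 0)" by (intro intros)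
  qed (use notin in \<open>auto intro!: intros\<close>)
  also have "cond_class ?E (\<lambda>x. (?P x = 0 \<and> ?B x = 0) \<and> ?A x = 0 \<and> ?D x = 0) = cls_d m"
    by (simp only: cls_d_def)
  finally show ?thesis by (simp only: insert_commute[of 3])
qed

section \<open>Determinants of matrices indexed by labels\<close>

definition label_mat :: "('a \<Rightarrow> 'a \<Rightarrow> 'b) \<Rightarrow> 'a list \<Rightarrow> 'a list \<Rightarrow> 'b mat" where
  "label_mat f rs cs = mat (length rs) (length cs) (\<lambda>(i, j). f (rs ! i) (cs ! j))"

lemma label_mat_carrier: "length rs = n \<Longrightarrow> length cs = n \<Longrightarrow> label_mat f rs cs \<in> carrier_mat n n"
  by (simp add: label_mat_def)

lemma label_mat_cong:
  "(\<And>r c. r \<in> set rs \<Longrightarrow> c \<in> set cs \<Longrightarrow> f r c = g r c) \<Longrightarrow> label_mat f rs cs = label_mat g rs cs"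
  unfolding label_mat_def by (rule eq_matI) auto

text \<open>A permutation of the labels acts on rows and columns at once, so its sign appears twice. This makes the
  determinant independent of the order in which edges and vertices are listed.\<close>

lemma det_label_mat_reorder:
  fixes f :: "'a \<Rightarrow> 'a \<Rightarrow> 'b::comm_ring_1"
  assumes "distinct xs" "distinct ys" "set xs = set ys"
  shows "det (label_mat f xs xs) = det (label_mat f ys ys)"
proof -
  have "mset xs = mset ys" using assms set_eq_iff_mset_eq_distinct by blast
  then obtain p where p: "p permutes {..<length ys}" "permute_list p ys = xs"
    using mset_eq_permutation by metis
  let ?n = "length ys"
  have len: "length xs = ?n" using p(2) by auto
  have nth: "xs ! i = ys ! p i" if "i < ?n" for i
    using permute_list_nth[OF p(1) that] p(2) by simp
  have p': "p permutes {0..<?n}" using p(1) by (simp add: atLeast0LessThan)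
  have pb: "p i < ?n" if "i < ?n" for i using permutes_in_image[OF p(1), of i] that by simp
  define A where "A = label_mat f ys ys"
  define B where "B = mat ?n ?n (\<lambda>(i, j). A $$ (p i, j))"
  have A: "A \<in> carrier_mat ?n ?n" and B: "B \<in> carrier_mat ?n ?n"
    by (auto simp: A_def B_def label_mat_def)
  have "(label_mat f xs xs)\<^sup>T = mat ?n ?n (\<lambda>(i, j). B\<^sup>T $$ (p i, j))"
    by (rule eq_matI) (use pb in \<open>auto simp: label_mat_def A_def B_def len nth\<close>)
  then have "det (label_mat f xs xs)\<^sup>T = signof p * det B\<^sup>T"
    using det_permute_rows[OF _ p', of "B\<^sup>T"] B by simp
  moreover have "det (label_mat f xs xs)\<^sup>T = det (label_mat f xs xs)"
    by (rule det_transpose[of _ ?n]) (simp add: label_mat_carrier len)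
  moreover have "det B\<^sup>T = signof p * det A"
    using det_permute_rows[OF A p'] det_transpose[OF B] by (simp add: B_def)
  ultimately have "det (label_mat f xs xs) = (signof p * signof p) * det A" by (simp add: mult.assoc)
  also have "signof p * signof p = (1 :: 'b)" using signof_pm_one[of p] by (cases "sign p = 1") (auto simp: sign_def)
  finally show ?thesis by (simp add: A_def)
qed

lemma det_label_mat_first_row:
  fixes f :: "'a \<Rightarrow> 'a \<Rightarrow> 'b::comm_ring_1"
  assumes len: "length rs = length cs" and z: "\<And>c. c \<in> set cs \<Longrightarrow> f r c = 0"
  shows "det (label_mat f (r # rs) (c0 # cs)) = f r c0 * det (label_mat f rs cs)"
proof -
  let ?n = "length cs" and ?A = "label_mat f (r # rs) (c0 # cs)"
  have A: "?A \<in> carrier_mat (Suc ?n) (Suc ?n)" using len by (simp add: label_mat_def)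
  have "det ?A = (\<Sum>j<Suc ?n. ?A $$ (0, j) * cofactor ?A 0 j)"
    by (rule laplace_expansion_row[OF A]) simp
  also have "\<dots> = ?A $$ (0, 0) * cofactor ?A 0 0 + (\<Sum>j<?n. ?A $$ (0, Suc j) * cofactor ?A 0 (Suc j))"
    by (rule sum.lessThan_Suc_shift)
  also have "(\<Sum>j<?n. ?A $$ (0, Suc j) * cofactor ?A 0 (Suc j)) = 0"
    by (rule sum.neutral) (use z in \<open>auto simp: label_mat_def\<close>)
  also have "mat_delete ?A 0 0 = label_mat f rs cs"
    by (rule eq_matI) (auto simp: label_mat_def mat_delete_def)
  then have "cofactor ?A 0 0 = det (label_mat f rs cs)" by (simp add: cofactor_def)
  finally show ?thesis by (simp add: label_mat_def)
qed

lemma det_label_mat_first_column: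
  fixes f :: "'a \<Rightarrow> 'a \<Rightarrow> 'b::comm_ring_1"
  assumes len: "length rs = length cs" and z: "\<And>r. r \<in> set rs \<Longrightarrow> f r c = 0"
  shows "det (label_mat f (r0 # rs) (c # cs)) = f r0 c * det (label_mat f rs cs)"
proof -
  have T: "(label_mat f xs ys)\<^sup>T = label_mat (\<lambda>r c. f c r) ys xs" for xs ys
    by (rule eq_matI) (auto simp: label_mat_def)
  have dT: "det (label_mat (\<lambda>r c. f c r) ys xs) = det (label_mat f xs ys)" if "length xs = length ys" for xs ys
    using det_transpose[OF label_mat_carrier[of xs "length ys" ys f]] that by (simp add: T)
  show ?thesis
    using det_label_mat_first_row[of cs rs "\<lambda>r c. f c r" c r0] len z
    by (simp add: dT)
qed

lemma det_label_mat_two_entries: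
  fixes f :: "'a \<Rightarrow> 'a \<Rightarrow> 'b::comm_ring_1"
  assumes row: "\<And>c. c \<in> set zs \<Longrightarrow> f p c = 0" and col: "\<And>r. r \<in> set zs \<Longrightarrow> f r p = 0"
  shows "det (label_mat f (p # q # zs) (p # q # zs)) =
    f p p * det (label_mat f (q # zs) (q # zs)) - f p q * f q p * det (label_mat f zs zs)"
proof -
  let ?n = "length zs" and ?A = "label_mat f (p # q # zs) (p # q # zs)"
  have A: "?A \<in> carrier_mat (Suc (Suc ?n)) (Suc (Suc ?n))" by (simp add: label_mat_def)
  have "det ?A = (\<Sum>j<Suc (Suc ?n). ?A $$ (0, j) * cofactor ?A 0 j)"
    by (rule laplace_expansion_row[OF A]) simp
  also have "\<dots> = ?A $$ (0, 0) * cofactor ?A 0 0 + (?A $$ (0, 1) * cofactor ?A 0 1 +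
      (\<Sum>j<?n. ?A $$ (0, Suc (Suc j)) * cofactor ?A 0 (Suc (Suc j))))"
    unfolding sum.lessThan_Suc_shift by simp
  also have "(\<Sum>j<?n. ?A $$ (0, Suc (Suc j)) * cofactor ?A 0 (Suc (Suc j))) = 0"
    by (rule sum.neutral) (use row in \<open>auto simp: label_mat_def\<close>)
  also have "cofactor ?A 0 0 = det (label_mat f (q # zs) (q # zs))"
  proof -
    have "mat_delete ?A 0 0 = label_mat f (q # zs) (q # zs)"
      by (rule eq_matI) (auto simp: label_mat_def mat_delete_def)
    then show ?thesis by (simp add: cofactor_def)
  qed
  also have "cofactor ?A 0 1 = - (f q p * det (label_mat f zs zs))"
  proof -
    have "mat_delete ?A 0 1 = label_mat f (q # zs) (p # zs)"
      by (rule eq_matI) (auto simp: label_mat_def mat_delete_def nth_Cons split: nat.split)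
    then show ?thesis
      using det_label_mat_first_column[of zs zs f p q] col by (simp add: cofactor_def)
  qed
  finally show ?thesis by (simp add: label_mat_def mult.assoc)
qed

text \<open>Square matrices are singular exactly if they have a kernel, with rows and columns labelled by possibly
  different sets. All vanishing statements about minors go through this lemma.\<close>

lemma det_label_mat_eq_0_iff:
  fixes f :: "'a \<Rightarrow> 'a \<Rightarrow> 'b::field"
  assumes len: "length rs = length cs" and d: "distinct cs"
  shows "det (label_mat f rs cs) = 0 \<longleftrightarrow>
    (\<exists>y. (\<exists>c\<in>set cs. y c \<noteq> 0) \<and> (\<forall>r\<in>set rs. (\<Sum>c\<in>set cs. f r c * y c) = 0))"
proof -
  let ?n = "length cs"
  have A: "label_mat f rs cs \<in> carrier_mat ?n ?n" by (simp add: label_mat_def len)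
  have bij: "bij_betw ((!) cs) {0..<?n} (set cs)"
    using bij_betw_nth[OF d, of "{0..<?n}" "set cs"] by (simp add: atLeast0LessThan)
  have prod: "(label_mat f rs cs *\<^sub>v v) $ i = (\<Sum>c\<in>set cs. f (rs ! i) c * y c)"
    if "v \<in> carrier_vec ?n" "\<And>j. j < ?n \<Longrightarrow> v $ j = y (cs ! j)" "i < ?n" for v :: "'b vec" and y i
  proof -
    have "(label_mat f rs cs *\<^sub>v v) $ i = (\<Sum>j=0..<?n. f (rs ! i) (cs ! j) * y (cs ! j))"
      using that by (simp add: label_mat_def scalar_prod_def len)
    also have "\<dots> = (\<Sum>c\<in>set cs. f (rs ! i) c * y c)"
      by (rule sum.reindex_bij_betw[OF bij])
    finally show ?thesis .
  qed
  show ?thesis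
    unfolding det_0_iff_vec_prod_zero_field[OF A]
  proof safe
    fix v :: "'b vec" assume v: "v \<in> carrier_vec ?n" "v \<noteq> 0\<^sub>v ?n" "label_mat f rs cs *\<^sub>v v = 0\<^sub>v ?n"
    define y where "y c = v $ (the_inv_into {0..<?n} ((!) cs) c)" for c
    have y: "v $ j = y (cs ! j)" if "j < ?n" for j
      using the_inv_into_f_f[of "(!) cs" "{0..<?n}" j] bij that by (simp add: y_def bij_betw_def)
    have "\<exists>j<?n. v $ j \<noteq> 0" using v by (metis carrier_vecD eq_vecI index_zero_vec)
    then have "\<exists>c\<in>set cs. y c \<noteq> 0" using y by (metis nth_mem)
    moreover have "(\<Sum>c\<in>set cs. f r c * y c) = 0" if "r \<in> set rs" for r
      using that prod[OF v(1) y] v(3) len by (auto simp: in_set_conv_nth)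
    ultimately show "\<exists>y. (\<exists>c\<in>set cs. y c \<noteq> 0) \<and> (\<forall>r\<in>set rs. (\<Sum>c\<in>set cs. f r c * y c) = 0)" by blast
  next
    fix y c assume c: "c \<in> set cs" "y c \<noteq> 0" and 0: "\<forall>r\<in>set rs. (\<Sum>c\<in>set cs. f r c * y c) = 0"
    let ?v = "vec ?n (\<lambda>j. y (cs ! j))"
    obtain j where "j < ?n" "cs ! j = c" using c(1) by (auto simp: in_set_conv_nth)
    then have "?v $ j \<noteq> 0\<^sub>v ?n $ j" using c by simp
    then have "?v \<noteq> 0\<^sub>v ?n" by metis
    moreover have "label_mat f rs cs *\<^sub>v ?v = 0\<^sub>v ?n"
      by (rule eq_vecI) (use prod[of ?v y] 0 len in \<open>auto simp: label_mat_def\<close>)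
    ultimately show "\<exists>v. v \<in> carrier_vec ?n \<and> v \<noteq> 0\<^sub>v ?n \<and> label_mat f rs cs *\<^sub>v v = 0\<^sub>v ?n"
      by (intro exI[of _ ?v]) auto
  qed
qed

section \<open>Spanning trees and the graph matrix\<close>

subsection \<open>Deletion and contraction\<close>

definition wf_graph :: "mgraph \<Rightarrow> bool" where
  "wf_graph G \<longleftrightarrow> finite (verts G) \<and> finite (arcs G) \<and> (\<forall>e\<in>arcs G. tail G e \<in> verts G \<and> head G e \<in> verts G)"

text \<open>Linking by edges of \<open>A\<close> is the reflexive transitive closure of this symmetric relation; unlike \<open>linked\<close> it
  does not mention the vertex set.\<close>

definition ends :: "mgraph \<Rightarrow> nat set \<Rightarrow> (nat \<times> nat) set" where
  "ends G A = (\<Union>e\<in>A. {(tail G e, head G e), (head G e, tail G e)})"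

lemma ends_insert: "ends G (insert e A) = insert (tail G e, head G e) (insert (head G e, tail G e) (ends G A))"
  by (auto simp: ends_def)

lemma ends_sym: "(u, v) \<in> (ends G A)\<^sup>* \<Longrightarrow> (v, u) \<in> (ends G A)\<^sup>*"
proof -
  have "sym (ends G A)" by (auto simp: ends_def sym_def)
  then show "(u, v) \<in> (ends G A)\<^sup>* \<Longrightarrow> (v, u) \<in> (ends G A)\<^sup>*" by (meson sym_rtrancl symD)
qed

lemma ends_mono: "A \<subseteq> B \<Longrightarrow> (u, v) \<in> (ends G A)\<^sup>* \<Longrightarrow> (u, v) \<in> (ends G B)\<^sup>*"
  using rtrancl_mono[of "ends G A" "ends G B"] by (auto simp: ends_def)

lemma path_insert_cases:
  "(u, v) \<in> (ends G (insert f A))\<^sup>* \<longleftrightarrow> (u, v) \<in> (ends G A)\<^sup>* \<or>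
    (u, tail G f) \<in> (ends G A)\<^sup>* \<and> (head G f, v) \<in> (ends G A)\<^sup>* \<or>
    (u, head G f) \<in> (ends G A)\<^sup>* \<and> (tail G f, v) \<in> (ends G A)\<^sup>*"
  unfolding ends_insert rtrancl_insert by (auto intro: rtrancl_trans)

lemma reachable_iff:
  assumes "wf_graph G" "A \<subseteq> arcs G"
  shows "linked (G\<lparr>arcs := A\<rparr>) u v \<longleftrightarrow> u \<in> verts G \<and> (u, v) \<in> (ends G A)\<^sup>*"
proof -
  have eq: "linked (G\<lparr>arcs := A\<rparr>) u v \<longleftrightarrow> (u, v) \<in> rtrancl_on (verts G) (ends G A)"
    by (simp add: linked_def reachable_def parcs_mk_symmetric ends_def)
  have V: "v \<in> verts G" if "(u, v) \<in> (ends G A)\<^sup>*" "u \<in> verts G"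
    using that assms by (induction rule: rtrancl_induct) (auto simp: ends_def wf_graph_def)
  show ?thesis unfolding eq
  proof safe
    assume "u \<in> verts G" "(u, v) \<in> (ends G A)\<^sup>*"
    then show "(u, v) \<in> rtrancl_on (verts G) (ends G A)"
      using V assms by (intro rtrancl_consistent_rtrancl_on) (auto simp: ends_def wf_graph_def)
  qed (auto dest: rtrancl_on_rtranclI in_rtrancl_on_in_F)
qed

lemma connected_iff:
  assumes "wf_graph G" "A \<subseteq> arcs G"
  shows "Digraph_Component.connected (G\<lparr>arcs := A\<rparr>) \<longleftrightarrow>
    verts G \<noteq> {} \<and> (\<forall>u\<in>verts G. \<forall>v\<in>verts G. (u, v) \<in> (ends G A)\<^sup>*)"
  using reachable_iff[OF assms]
  by (auto simp: Digraph_Component.connected_def strongly_connected_def linked_def)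

lemma spanning_trees_iff:
  assumes "wf_graph G"
  shows "T \<in> spanning_trees G \<longleftrightarrow> T \<subseteq> arcs G \<and> verts G \<noteq> {} \<and>
    (\<forall>u\<in>verts G. \<forall>v\<in>verts G. (u, v) \<in> (ends G T)\<^sup>*) \<and>
    (\<forall>e\<in>T. (tail G e, head G e) \<notin> (ends G (T - {e}))\<^sup>*)"
proof (cases "T \<subseteq> arcs G")
  case True
  have "linked (G\<lparr>arcs := T - {e}\<rparr>) (tail G e) (head G e) \<longleftrightarrow> (tail G e, head G e) \<in> (ends G (T - {e}))\<^sup>*"
    if "e \<in> T" for e
    using reachable_iff[OF assms, of "T - {e}"] that True assms by (auto simp: wf_graph_def)
  then show ?thesis using connected_iff[OF assms True] True by (auto simp: spanning_trees_def)
qed (simp add: spanning_trees_def)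

definition tree_sum :: "mgraph \<Rightarrow> 'k::field point \<Rightarrow> 'k alg_closure" where
  "tree_sum G x = (\<Sum>T\<in>spanning_trees G. \<Prod>e\<in>arcs G - T. x e)"

lemma mp_eval_graph_poly:
  assumes "wf_graph G" shows "mp_eval (graph_poly G) x = tree_sum G x"
proof (cases "Digraph_Component.connected G")
  case False
  have "spanning_trees G = {}"
  proof (rule equals0I)
    fix T assume "T \<in> spanning_trees G"
    then have T: "T \<subseteq> arcs G" "verts G \<noteq> {}" "\<forall>u\<in>verts G. \<forall>v\<in>verts G. (u, v) \<in> (ends G T)\<^sup>*"
      using spanning_trees_iff[OF assms] by auto
    then have "Digraph_Component.connected (G\<lparr>arcs := arcs G\<rparr>)"
      unfolding connected_iff[OF assms order_refl] using ends_mono by blast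
    then show False using False by simp
  qed
  then show ?thesis using False by (simp add: graph_poly_def tree_sum_def)
qed (simp add: graph_poly_def tree_sum_def)

lemma delete_simps [simp]:
  "verts (delete G e) = verts G" "arcs (delete G e) = arcs G - {e}"
  "tail (delete G e) = tail G" "head (delete G e) = head G"
  by (simp_all add: delete_def pre_digraph.del_arc_def)

lemma ends_delete [simp]: "ends (delete G e) A = ends G A"
  by (simp add: ends_def)

lemma wf_delete: "wf_graph G \<Longrightarrow> wf_graph (delete G e)"
  by (auto simp: wf_graph_def)

lemma wf_zero_graph: "wf_graph zero_graph"
  by (simp add: wf_graph_def zero_graph_def)

lemma tree_sum_zero_graph [simp]: "tree_sum zero_graph x = 0"
proof -
  have "spanning_trees zero_graph = {}" using spanning_trees_iff[OF wf_zero_graph] by (auto simp: zero_graph_def)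
  then show ?thesis by (simp add: tree_sum_def)
qed

definition merge :: "mgraph \<Rightarrow> nat \<Rightarrow> nat \<Rightarrow> nat" where
  "merge G e v = (if v = head G e then tail G e else v)"

lemma contract_simps:
  assumes "tail G e \<noteq> head G e"
  shows "verts (contract G e) = merge G e ` verts G" "arcs (contract G e) = arcs G - {e}"
    "tail (contract G e) f = merge G e (tail G f)" "head (contract G e) f = merge G e (head G f)"
  using assms by (simp_all add: contract_def Let_def merge_def[abs_def] cong del: if_weak_cong)

lemma wf_contract: "wf_graph G \<Longrightarrow> wf_graph (contract G e)"
  by (cases "tail G e = head G e") (auto simp: wf_graph_def contract_simps, simp_all add: contract_def zero_graph_def)

lemma path_contract:
  assumes "tail G e \<noteq> head G e"
  shows "(merge G e u, merge G e v) \<in> (ends (contract G e) A)\<^sup>* \<longleftrightarrow> (u, v) \<in> (ends G (insert e A))\<^sup>*"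
proof -
  let ?\<mu> = "merge G e" and ?J = "(ends G (insert e A))\<^sup>*"
  have \<mu>: "(w, ?\<mu> w) \<in> ?J" for w by (auto simp: merge_def ends_insert)
  have 1: "(p, q) \<in> ?J" if "(p, q) \<in> (ends (contract G e) A)\<^sup>*" for p q
    using that
  proof (induction rule: rtrancl_induct)
    case (step y z)
    then obtain a b where ab: "y = ?\<mu> a" "z = ?\<mu> b" "(a, b) \<in> ends G A"
      using assms by (auto simp: ends_def contract_simps)
    then have "(a, b) \<in> ?J" by (auto simp: ends_insert)
    then show ?case using step.IH ab \<mu>[of a] \<mu>[of b] ends_sym rtrancl_trans by metis
  qed simp
  show ?thesis
  proof
    assume "(?\<mu> u, ?\<mu> v) \<in> (ends (contract G e) A)\<^sup>*"
    from 1[OF this] show "(u, v) \<in> ?J" using \<mu>[of u] \<mu>[of v] ends_sym rtrancl_trans by metis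
  next
    assume "(u, v) \<in> ?J"
    then show "(?\<mu> u, ?\<mu> v) \<in> (ends (contract G e) A)\<^sup>*"
    proof (induction rule: rtrancl_induct)
      case (step y z)
      have "?\<mu> y = ?\<mu> z \<or> (?\<mu> y, ?\<mu> z) \<in> ends (contract G e) A"
        using step.hyps(2) assms by (auto simp: ends_def contract_simps merge_def)
      then show ?case using step.IH by (metis rtrancl.rtrancl_into_rtrancl)
    qed simp
  qed
qed

text \<open>The exchange property of forests: a path of edges of \<open>A\<close> joining the ends of \<open>e\<close> would contain an edge \<open>f\<close>
  whose ends are joined by the rest of the path together with \<open>e\<close>. It supplies the condition at \<open>e\<close> itself when
  \<open>e\<close> is added to a spanning tree of the contracted graph.\<close>

lemma acyclic_exchange:
  assumes fin: "finite A" and ne: "tail G e \<noteq> head G e" and e: "e \<notin> A"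
    and acyc: "\<And>f. f \<in> A \<Longrightarrow> (tail G f, head G f) \<notin> (ends G (insert e (A - {f})))\<^sup>*"
  shows "(tail G e, head G e) \<notin> (ends G A)\<^sup>*"
  using assms
proof (induction A rule: finite_induct)
  case empty
  then show ?case by (simp add: ends_def)
next
  case (insert f A)
  have "(tail G e, head G e) \<notin> (ends G A)\<^sup>*"
  proof (rule insert.IH)
    fix g assume g: "g \<in> A"
    have "insert e (A - {g}) \<subseteq> insert e (insert f A - {g})" by auto
    then show "(tail G g, head G g) \<notin> (ends G (insert e (A - {g})))\<^sup>*"
      using insert.prems(3)[of g] ends_mono g by blast
  qed (use insert.prems in auto)
  moreover have "insert e (insert f A - {f}) = insert e A" using insert.hyps by auto
  then have "(tail G f, head G f) \<notin> (ends G (insert e A))\<^sup>*" using insert.prems(3)[of f] by simp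
  ultimately show ?case
    unfolding path_insert_cases[of "tail G e" "head G e" G f A] path_insert_cases[of _ _ G e A]
    using ends_sym by blast
qed

lemma spanning_trees_contract:
  assumes wf: "wf_graph G" and e: "e \<in> arcs G" "tail G e \<noteq> head G e"
  shows "T \<in> spanning_trees (contract G e) \<longleftrightarrow> e \<notin> T \<and> insert e T \<in> spanning_trees G"
proof (cases "e \<notin> T \<and> T \<subseteq> arcs G")
  case True
  let ?\<mu> = "merge G e"
  have fin: "finite T" using True wf finite_subset by (auto simp: wf_graph_def)
  have ac: "(\<forall>f\<in>T. (?\<mu> (tail G f), ?\<mu> (head G f)) \<notin> (ends (contract G e) (T - {f}))\<^sup>*) \<longleftrightarrow>
     (\<forall>f\<in>insert e T. (tail G f, head G f) \<notin> (ends G (insert e T - {f}))\<^sup>*)"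
  proof -
    have *: "insert e T - {f} = insert e (T - {f})" if "f \<in> T" for f using that True by auto
    moreover have "insert e T - {e} = T" using True by auto
    ultimately show ?thesis
      unfolding path_contract[OF e(2)] using acyclic_exchange[OF fin e(2), of ] True by auto
  qed
  have "T \<subseteq> arcs G - {e}" "insert e T \<subseteq> arcs G" using True e by auto
  moreover have "(\<forall>u\<in>verts G. \<forall>v\<in>verts G. (?\<mu> u, ?\<mu> v) \<in> (ends (contract G e) T)\<^sup>*) \<longleftrightarrow>
      (\<forall>u\<in>verts G. \<forall>v\<in>verts G. (u, v) \<in> (ends G (insert e T))\<^sup>*)"
    by (simp add: path_contract[OF e(2)])
  ultimately show ?thesis
    unfolding spanning_trees_iff[OF wf] spanning_trees_iff[OF wf_contract[OF wf]]
      contract_simps[OF e(2)] ball_simps(9) using ac True by simp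
next
  case False
  then show ?thesis using contract_simps(2)[OF e(2)] by (auto simp: spanning_trees_def)
qed

text \<open>The spanning trees without \<open>e\<close> are those of \<open>G \<setminus> e\<close>, the others correspond to those of the
  contraction. For loops and bridges one of the two summands is zero, which the conventions for the zero graph and for
  disconnected graphs achieve.\<close>

theorem tree_sum_deletion_contraction:
  assumes wf: "wf_graph G" and e: "e \<in> arcs G"
  shows "tree_sum G x = x e * tree_sum (delete G e) x + tree_sum (contract G e) x"
proof -
  have finA: "finite (arcs G)" using wf by (simp add: wf_graph_def)
  have fin: "finite (spanning_trees G)"
    by (rule finite_subset[of _ "Pow (arcs G)"]) (auto simp: spanning_trees_def finA)
  let ?p = "\<lambda>T. \<Prod>e\<in>arcs G - T. x e"
  have "tree_sum G x = (\<Sum>T\<in>{T\<in>spanning_trees G. e \<notin> T}. ?p T) + (\<Sum>T\<in>{T\<in>spanning_trees G. e \<in> T}. ?p T)"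
    unfolding tree_sum_def
    by (subst sum.union_disjoint[symmetric]) (auto simp: fin intro!: sum.cong)
  also have "(\<Sum>T\<in>{T\<in>spanning_trees G. e \<notin> T}. ?p T) = x e * tree_sum (delete G e) x"
  proof -
    have "{T\<in>spanning_trees G. e \<notin> T} = spanning_trees (delete G e)"
      using spanning_trees_iff[OF wf] spanning_trees_iff[OF wf_delete[OF wf], of _ e] by auto
    moreover have "?p T = x e * (\<Prod>e\<in>arcs (delete G e) - T. x e)" if "T \<in> spanning_trees (delete G e)" for T
    proof -
      have "arcs G - T = insert e (arcs G - {e} - T)" using e that by (auto simp: spanning_trees_def)
      then show ?thesis using finA by simp
    qed
    ultimately show ?thesis by (simp add: tree_sum_def sum_distrib_left)
  qed
  also have "(\<Sum>T\<in>{T\<in>spanning_trees G. e \<in> T}. ?p T) = tree_sum (contract G e) x"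
  proof (cases "tail G e = head G e")
    case True
    then have "(tail G e, head G e) \<in> (ends G (T - {e}))\<^sup>*" for T by simp
    then have none: "{T\<in>spanning_trees G. e \<in> T} = {}" using spanning_trees_iff[OF wf] by blast
    show ?thesis unfolding none using True by (simp add: contract_def)
  next
    case False
    have "bij_betw (insert e) (spanning_trees (contract G e)) {T\<in>spanning_trees G. e \<in> T}"
      unfolding bij_betw_def
    proof
      show "inj_on (insert e) (spanning_trees (contract G e))"
        using spanning_trees_contract[OF wf e False] by (intro inj_onI) (metis insert_ident)
      show "insert e ` spanning_trees (contract G e) = {T\<in>spanning_trees G. e \<in> T}"
      proof safe
        fix T assume "T \<in> spanning_trees G" "e \<in> T"
        then have "T - {e} \<in> spanning_trees (contract G e)" "T = insert e (T - {e})"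
          using spanning_trees_contract[OF wf e False] by (auto simp: insert_absorb)
        then show "T \<in> insert e ` spanning_trees (contract G e)" by blast
      qed (use spanning_trees_contract[OF wf e False] in auto)
    qed
    then have "(\<Sum>T\<in>{T\<in>spanning_trees G. e \<in> T}. ?p T) = (\<Sum>T\<in>spanning_trees (contract G e). ?p (insert e T))"
      by (rule sum.reindex_bij_betw[symmetric])
    also have "\<dots> = tree_sum (contract G e) x"
      unfolding tree_sum_def contract_simps[OF False] by (intro sum.cong prod.cong) auto
    finally show ?thesis .
  qed
  finally show ?thesis .
qed

subsection \<open>The matrix-tree theorem\<close>

definition inc :: "mgraph \<Rightarrow> nat \<Rightarrow> nat \<Rightarrow> 'a::ring_1" where
  "inc G e v = (if v = head G e then 1 else 0) - (if v = tail G e then 1 else 0)"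

fun graph_entry :: "mgraph \<Rightarrow> (nat \<Rightarrow> 'a::ring_1) \<Rightarrow> nat + nat \<Rightarrow> nat + nat \<Rightarrow> 'a" where
  "graph_entry G x (Inl e) (Inl e') = (if e = e' then x e else 0)"
| "graph_entry G x (Inl e) (Inr v) = inc G e v"
| "graph_entry G x (Inr v) (Inl e) = - inc G e v"
| "graph_entry G x (Inr v) (Inr v') = 0"

lemma mp_eval_graph_matrix_entry:
  "mp_eval (graph_matrix_entry G a r c) x = graph_entry G (\<lambda>e. mp_eval (a e) x) r c"
  by (cases r; cases c) (simp_all add: incidence_def inc_def)

lemma distinct_list_of_set: "finite A \<Longrightarrow> \<exists>xs. distinct xs \<and> set xs = A"
  using finite_distinct_list by metis

text \<open>Both sides satisfy deletion and contraction at an edge \<open>e\<close> between the omitted vertex \<open>v\<^sub>0\<close> and another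
  vertex \<open>h\<close>. In the row and column of \<open>e\<close> the only entries are then \<open>x\<^sub>e\<close> on the diagonal and \<open>\<plusminus>1\<close> at \<open>h\<close>; expanding,
  the first gives the matrix of \<open>G \<setminus> e\<close> and the second removes \<open>e\<close> and \<open>h\<close>, which leaves the matrix of the contraction with the
  merged vertex omitted. If no edge meets \<open>v\<^sub>0\<close> and there are other vertices, then the constant potentials on them form a kernel.\<close>

theorem matrix_tree:
  fixes x :: "'k::field point"
  assumes "wf_graph G" "v0 \<in> verts G" "distinct xs" "set xs = Inl ` arcs G \<union> Inr ` (verts G - {v0})"
  shows "tree_sum G x = det (label_mat (graph_entry G x) xs xs)"
  using assms
proof (induction "card (arcs G)" arbitrary: G v0 xs rule: less_induct)
  case less
  note wf = less.prems(1) and v0 = less.prems(2)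
  have fin: "finite (arcs G)" "finite (verts G)" using wf by (auto simp: wf_graph_def)
  have card_less: "card (arcs G - {e}) < card (arcs G)" if "e \<in> arcs G" for e
    using that fin(1) by (rule card_Diff1_less[rotated])
  have entry_del: "graph_entry (delete G e) x = graph_entry G x" for e
  proof (intro ext)
    fix r c show "graph_entry (delete G e) x r c = graph_entry G x r c"
      by (cases r; cases c) (simp_all add: inc_def)
  qed
  show ?case
  proof (cases "\<exists>e\<in>arcs G. tail G e = v0 \<or> head G e = v0")
    case True
    then obtain e where e: "e \<in> arcs G" "tail G e = v0 \<or> head G e = v0" by blast
    show ?thesis
    proof (cases "tail G e = head G e")
      case loop: True
      obtain zs where zs: "distinct zs" "set zs = Inl ` (arcs G - {e}) \<union> Inr ` (verts G - {v0})"
        using distinct_list_of_set[of "Inl ` (arcs G - {e}) \<union> Inr ` (verts G - {v0})"] fin by auto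
      have "det (label_mat (graph_entry G x) xs xs) = det (label_mat (graph_entry G x) (Inl e # zs) (Inl e # zs))"
      proof (rule det_label_mat_reorder)
        have A: "Inl ` arcs G = insert (Inl e :: nat + nat) (Inl ` (arcs G - {e}))"
          using e by blast
        show "set xs = set (Inl e # zs)"
          by (simp only: less.prems(4) list.set zs(2) A Un_insert_left)
      qed (use less.prems(3) zs in auto)
      also have "\<dots> = x e * det (label_mat (graph_entry G x) zs zs)"
        by (subst det_label_mat_first_row) (use zs loop e in \<open>auto simp: inc_def\<close>)
      also have "det (label_mat (graph_entry G x) zs zs) = tree_sum (delete G e) x"
        using less.hyps[of "delete G e" v0 zs] card_less[OF e(1)] wf_delete[OF wf] v0 zs
        by (simp add: entry_del)
      finally show ?thesis
        using tree_sum_deletion_contraction[OF wf e(1), of x] loop by (simp add: contract_def)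
    next
      case nl: False
      define h where "h = (if tail G e = v0 then head G e else tail G e)"
      have h: "h \<in> verts G" "h \<noteq> v0" using e nl wf by (auto simp: h_def wf_graph_def)
      obtain zs where zs: "distinct zs" "set zs = Inl ` (arcs G - {e}) \<union> Inr ` (verts G - {v0, h})"
        using distinct_list_of_set[of "Inl ` (arcs G - {e}) \<union> Inr ` (verts G - {v0, h})"] fin by auto
      have row: "graph_entry G x (Inl e) c = 0 \<and> graph_entry G x c (Inl e) = 0" if c: "c \<in> set zs" for c
      proof (cases c)
        case (Inr v)
        then have "v \<noteq> v0" "v \<noteq> h" using c zs(2) by auto
        then have "v \<noteq> tail G e" "v \<noteq> head G e" using e(2) by (auto simp: h_def)
        then show ?thesis using Inr by (simp add: inc_def)
      qed (use c zs(2) in auto)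
      have "det (label_mat (graph_entry G x) xs xs) =
          det (label_mat (graph_entry G x) (Inl e # Inr h # zs) (Inl e # Inr h # zs))"
      proof (rule det_label_mat_reorder)
        have A: "Inl ` arcs G = insert (Inl e :: nat + nat) (Inl ` (arcs G - {e}))"
          using e by blast
        have V: "Inr ` (verts G - {v0}) = insert (Inr h :: nat + nat) (Inr ` (verts G - {v0, h}))"
          using h by blast
        show "set xs = set (Inl e # Inr h # zs)"
          by (simp only: less.prems(4) list.set zs(2) A V Un_insert_left Un_insert_right)
             (simp add: insert_commute)
      qed (use less.prems(3) zs in auto)
      also have "\<dots> = x e * det (label_mat (graph_entry G x) (Inr h # zs) (Inr h # zs)) -
          graph_entry G x (Inl e) (Inr h) * graph_entry G x (Inr h) (Inl e) * det (label_mat (graph_entry G x) zs zs)"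
        using det_label_mat_two_entries[of zs "graph_entry G x" "Inl e" "Inr h"] row by simp
      also have "graph_entry G x (Inl e) (Inr h) * graph_entry G x (Inr h) (Inl e) = -1"
        using nl by (auto simp: inc_def h_def)
      also have "det (label_mat (graph_entry G x) (Inr h # zs) (Inr h # zs)) = tree_sum (delete G e) x"
      proof -
        have "verts G - {v0} = insert h (verts G - {v0, h})" using h by auto
        then have "set (Inr h # zs) = Inl ` (arcs G - {e}) \<union> Inr ` (verts G - {v0})"
          using zs(2) by simp
        moreover have "distinct (Inr h # zs)" using zs by auto
        ultimately show ?thesis
          using less.hyps[of "delete G e" v0 "Inr h # zs"] card_less[OF e(1)] wf_delete[OF wf] v0 zs
          by (simp add: entry_del)
      qed
      also have "det (label_mat (graph_entry G x) zs zs) = tree_sum (contract G e) x"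
      proof -
        have V: "merge G e ` verts G = verts G - {head G e}"
          using nl wf e(1) by (auto simp: merge_def wf_graph_def image_iff)
        have te: "tail G e \<in> verts (contract G e)"
          using nl wf e(1) by (simp add: contract_simps V wf_graph_def)
        have set: "set zs = Inl ` arcs (contract G e) \<union> Inr ` (verts (contract G e) - {tail G e})"
        proof -
          have "{head G e, tail G e} = {v0, h}" using e(2) nl by (auto simp: h_def)
          then have "verts G - {head G e} - {tail G e} = verts G - {v0, h}" by blast
          then show ?thesis by (simp only: zs(2) contract_simps[OF nl] V)
        qed
        have "label_mat (graph_entry G x) zs zs = label_mat (graph_entry (contract G e) x) zs zs"
        proof (rule label_mat_cong)
          have *: "inc (contract G e) f w = (inc G f w :: 'k alg_closure)" if "w \<noteq> tail G e" "w \<noteq> head G e" for f w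
            using that by (simp add: inc_def contract_simps[OF nl] merge_def)
          fix r c assume "r \<in> set zs" "c \<in> set zs"
          then show "graph_entry G x r c = graph_entry (contract G e) x r c"
          proof -
            have "v \<noteq> tail G e \<and> v \<noteq> head G e" if "Inr v \<in> set zs" for v
              using that e(2) unfolding zs(2) h_def by (auto split: if_splits)
            then show ?thesis using * \<open>r \<in> set zs\<close> \<open>c \<in> set zs\<close> by (cases r; cases c) simp_all
          qed
        qed
        then show ?thesis
          using less.hyps[OF _ wf_contract[OF wf] te zs(1) set] card_less[OF e(1)] contract_simps(2)[OF nl] by simp
      qed
      finally show ?thesis using tree_sum_deletion_contraction[OF wf e(1), of x] by simp
    qed
  next
    case none: False
    show ?thesis
    proof (cases "verts G = {v0}")
      case True
      then have A: "arcs G = {}" using wf none by (auto simp: wf_graph_def)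
      then have "xs = []" using less.prems(4) True by auto
      moreover have "spanning_trees G = {{}}" using spanning_trees_iff[OF wf] A True by auto
      ultimately show ?thesis using A by (simp add: tree_sum_def label_mat_def)
    next
      case False
      then obtain w where w: "w \<in> verts G" "w \<noteq> v0" using v0 by auto
      have "spanning_trees G = {}"
      proof (rule equals0I)
        fix T assume "T \<in> spanning_trees G"
        then have T: "T \<subseteq> arcs G" "(v0, w) \<in> (ends G T)\<^sup>*" using spanning_trees_iff[OF wf] v0 w by auto
        from T(2) w(2) obtain z where "(v0, z) \<in> ends G T" by (auto elim: converse_rtranclE)
        then show False using T(1) none by (auto simp: ends_def)
      qed
      then have "tree_sum G x = 0" by (simp add: tree_sum_def)
      moreover have "det (label_mat (graph_entry G x) xs xs) = 0"
        unfolding det_label_mat_eq_0_iff[OF refl less.prems(3)]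
      proof (intro exI[of _ "case_sum (\<lambda>_. 0) (\<lambda>_. 1)"] conjI ballI)
        show "\<exists>c\<in>set xs. case_sum (\<lambda>_. 0) (\<lambda>_. 1 :: 'k alg_closure) c \<noteq> 0"
          using w less.prems(4) by (intro bexI[of _ "Inr w"]) auto
        fix r assume r: "r \<in> set xs"
        have "(\<Sum>c\<in>set xs. graph_entry G x r c * case_sum (\<lambda>_. 0) (\<lambda>_. 1) c) =
            (\<Sum>v\<in>verts G - {v0}. graph_entry G x r (Inr v))"
          unfolding less.prems(4) using fin
          by (subst sum.union_disjoint) (auto simp: sum.reindex)
        also have "\<dots> = 0"
        proof (cases r)
          case (Inl e)
          then have "e \<in> arcs G" using r less.prems(4) by auto
          then have "tail G e \<in> verts G - {v0}" "head G e \<in> verts G - {v0}"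
            using none wf by (auto simp: wf_graph_def)
          then show ?thesis using fin(2) by (simp add: Inl inc_def sum_subtractf)
        qed simp
        finally show "(\<Sum>c\<in>set xs. graph_entry G x r c * case_sum (\<lambda>_. 0) (\<lambda>_. 1) c) = 0" .
      qed
      ultimately show ?thesis by simp
    qed
  qed
qed

section \<open>Kernels of tridiagonal matrices\<close>

definition tri_row :: "(nat \<Rightarrow> 'a::comm_ring_1) \<Rightarrow> (nat \<Rightarrow> 'a) \<Rightarrow> (nat \<Rightarrow> 'a) \<Rightarrow> nat \<Rightarrow> 'a" where
  "tri_row a s c k = a k * c k - s k * c (k - 1) - s (Suc k) * c (Suc k)"

text \<open>Cramer's rule for the first unknown of a chain, with the outer neighbours \<open>c\<^sub>i\<^sub>-\<^sub>1\<close> and \<open>c\<^sub>i\<^sub>+\<^sub>l\<close> as inhomogeneities.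
  No division is made, so the formula also gives information when the determinant is zero.\<close>

lemma cramer_left:
  assumes "i \<ge> 1" "\<And>k. i \<le> k \<Longrightarrow> k < i + l \<Longrightarrow> tri_row a s c k = 0"
  shows "continuant a s i (Suc l) * c i =
    s i * continuant a s (Suc i) l * c (i - 1) + (\<Prod>k=Suc i..<Suc (i + l). s k) * c (i + l)"
  using assms(2)
proof (induction l rule: induct_nat_012)
  case 0 then show ?case by simp
next
  case 1
  from 1[of i] show ?case by (simp add: tri_row_def algebra_simps)
next
  case (ge2 l)
  let ?m = "i + Suc l" and ?p = "\<Prod>k=Suc i..<Suc (i + l). s k"
  have IH: "continuant a s i (Suc l) * c i = s i * continuant a s (Suc i) l * c (i - 1) + ?p * c (i + l)"
    "continuant a s i (Suc (Suc l)) * c i =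
      s i * continuant a s (Suc i) (Suc l) * c (i - 1) + (\<Prod>k=Suc i..<Suc (i + Suc l). s k) * c (i + Suc l)"
    by (rule ge2.IH; rule ge2.prems; simp)+
  have p1: "(\<Prod>k=Suc i..<Suc (i + Suc l). s k) = ?p * s ?m"
    and p2: "(\<Prod>k=Suc i..<Suc (i + Suc (Suc l)). s k) = ?p * s ?m * s (Suc ?m)"
    by simp_all
  have row: "s (Suc ?m) * c (Suc ?m) = a ?m * c ?m - s ?m * c (i + l)"
    using ge2.prems[of ?m] by (simp add: tri_row_def algebra_simps)
  have "continuant a s i (Suc (Suc (Suc l))) * c i =
      a ?m * (continuant a s i (Suc (Suc l)) * c i) - (s ?m)\<^sup>2 * (continuant a s i (Suc l) * c i)"
    by (simp only: continuant.simps(3)[of a s i "Suc l"]) (simp add: algebra_simps del: continuant.simps)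
  also have "\<dots> = s i * (a ?m * continuant a s (Suc i) (Suc l) - (s ?m)\<^sup>2 * continuant a s (Suc i) l) * c (i - 1) +
      ?p * s ?m * (a ?m * c ?m - s ?m * c (i + l))"
    unfolding IH p1 by (simp add: algebra_simps power2_eq_square del: continuant.simps)
  also have "a ?m * continuant a s (Suc i) (Suc l) - (s ?m)\<^sup>2 * continuant a s (Suc i) l =
      continuant a s (Suc i) (Suc (Suc l))"
    by simp
  also have "?p * s ?m * (a ?m * c ?m - s ?m * c (i + l)) = ?p * s ?m * s (Suc ?m) * c (Suc ?m)"
    unfolding row[symmetric] by (simp add: mult.assoc)
  finally show ?case unfolding p2 by simp
qed

lemma cramer_right:
  assumes "i \<ge> 1" "\<And>k. i \<le> k \<Longrightarrow> k < i + l \<Longrightarrow> tri_row a s c k = 0"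
  shows "continuant a s i (Suc l) * c (i + l - 1) =
    s (i + l) * continuant a s i l * c (i + l) + (\<Prod>k=i..<i + l. s k) * c (i - 1)"
  using assms
proof (induction l arbitrary: i rule: induct_nat_012)
  case 0 then show ?case by simp
next
  case 1
  from 1(2)[of i] show ?case by (simp add: tri_row_def algebra_simps)
next
  case (ge2 l)
  let ?m = "i + Suc l" and ?p = "\<Prod>k=Suc (Suc i)..<Suc (Suc (i + l)). s k"
  have IH: "continuant a s (Suc (Suc i)) (Suc l) * c ?m =
      s (Suc ?m) * continuant a s (Suc (Suc i)) l * c (Suc ?m) + ?p * c (Suc i)"
    "continuant a s (Suc i) (Suc (Suc l)) * c ?m =
      s (Suc ?m) * continuant a s (Suc i) (Suc l) * c (Suc ?m) + (\<Prod>k=Suc i..<Suc (Suc (i + l)). s k) * c i"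
    using ge2.IH(1)[of "Suc (Suc i)"] ge2.IH(2)[of "Suc i"] ge2.prems(2) by simp_all
  have p1: "(\<Prod>k=Suc i..<Suc (Suc (i + l)). s k) = s (Suc i) * ?p"
    by (rule prod.atLeast_Suc_lessThan) simp
  have "(\<Prod>k=i..<Suc (Suc (i + l)). s k) = s i * (\<Prod>k=Suc i..<Suc (Suc (i + l)). s k)"
    by (rule prod.atLeast_Suc_lessThan) simp
  then have p2: "(\<Prod>k=i..<i + Suc (Suc l). s k) = s i * (s (Suc i) * ?p)"
    unfolding p1 by (simp only: add_Suc_right)
  have row: "s i * c (i - 1) = a i * c i - s (Suc i) * c (Suc i)"
    using ge2.prems(2)[of i] by (simp add: tri_row_def algebra_simps)
  have "continuant a s i (Suc (Suc (Suc l))) * c ?m =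
      a i * (continuant a s (Suc i) (Suc (Suc l)) * c ?m) - (s (Suc i))\<^sup>2 * (continuant a s (Suc (Suc i)) (Suc l) * c ?m)"
    by (simp only: continuant_left[of a s i "Suc l"]) (simp add: algebra_simps del: continuant.simps)
  also have "\<dots> = s (Suc ?m) * (a i * continuant a s (Suc i) (Suc l) - (s (Suc i))\<^sup>2 * continuant a s (Suc (Suc i)) l) * c (Suc ?m) +
      s (Suc i) * ?p * (a i * c i - s (Suc i) * c (Suc i))"
    unfolding IH p1 by (simp add: algebra_simps power2_eq_square del: continuant.simps)
  also have "a i * continuant a s (Suc i) (Suc l) - (s (Suc i))\<^sup>2 * continuant a s (Suc (Suc i)) l =
      continuant a s i (Suc (Suc l))"
    by (rule continuant_left[symmetric])
  finally show ?case unfolding p2 row[symmetric] by (simp add: algebra_simps del: continuant.simps)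
qed

text \<open>By Cramer's rule the first unknown is zero. The rest of the chain is regular unless the first coupling is
  nonzero; in that case the first row makes the second unknown zero, and the chain is shortened by two.\<close>

lemma tri_kernel_trivial:
  fixes s :: "nat \<Rightarrow> 'a::idom"
  assumes "i \<ge> 1" "continuant a s i (Suc l) \<noteq> 0" "s i * c (i - 1) = 0" "s (i + l) * c (i + l) = 0"
    and "\<And>k. i \<le> k \<Longrightarrow> k < i + l \<Longrightarrow> tri_row a s c k = 0"
    and "i \<le> k" "k < i + l"
  shows "c k = 0"
  using assms
proof (induction l arbitrary: i k rule: less_induct)
  case (less l)
  obtain l' where l: "l = Suc l'" using less.prems(6,7) by (cases l) auto
  have "(\<Prod>k=Suc i..<Suc (i + l). s k) = (\<Prod>k=Suc i..<i + l. s k) * s (i + l)"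
    by (rule prod.atLeastLessThan_Suc) (simp add: l)
  then have last: "(\<Prod>k=Suc i..<Suc (i + l). s k) * c (i + l) = 0"
    using less.prems(4) by (simp only: mult.assoc mult_zero_right)
  have first: "s i * continuant a s (Suc i) l * c (i - 1) = 0"
    using less.prems(3) by auto
  have "continuant a s i (Suc l) * c i = 0"
    using cramer_left[of i l, OF less.prems(1,5)] unfolding first last by (simp del: continuant.simps)
  then have ci: "c i = 0" using less.prems(2) by simp
  show ?case
  proof (cases "k = i \<or> l' = 0")
    case True
    then have "k = i" using less.prems(6,7) l by auto
    then show ?thesis using ci by simp
  next
    case False
    show ?thesis
    proof (cases "continuant a s (Suc i) (Suc l') = 0")
      case True
      obtain l'' where l': "l' = Suc l''" using False by (cases l') auto
      have "continuant a s i (Suc l) = - ((s (Suc i))\<^sup>2 * continuant a s (Suc (Suc i)) (Suc l''))"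
        using continuant_left[of a s i l'] True l l' by (simp del: continuant.simps)
      then have nz: "s (Suc i) \<noteq> 0" "continuant a s (Suc (Suc i)) (Suc l'') \<noteq> 0"
        using less.prems(2) by auto
      have "s (Suc i) * c (Suc i) = 0"
        using less.prems(5)[of i] less.prems(3) ci l by (auto simp: tri_row_def)
      then have c1: "c (Suc i) = 0" using nz by simp
      show ?thesis
      proof (cases "k = Suc i")
        case False
        show ?thesis
          by (rule less.IH[of l'' "Suc (Suc i)"])
             (use less.prems False \<open>\<not> (k = i \<or> l' = 0)\<close> c1 nz l l' in auto)
      qed (use c1 in simp)
    next
      case nz: False
      show ?thesis
        by (rule less.IH[of l' "Suc i"]) (use less.prems False ci nz l in auto)
    qed
  qed
qed

text \<open>Supports smaller than the set of rows occur for vectors that remain solutions when the chain is coupled to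
  further unknowns.\<close>

definition tri_kernel ::
  "(nat \<Rightarrow> 'a::comm_ring_1) \<Rightarrow> (nat \<Rightarrow> 'a) \<Rightarrow> nat set \<Rightarrow> nat set \<Rightarrow> (nat \<Rightarrow> 'a) \<Rightarrow> bool" where
  "tri_kernel a s R C u \<longleftrightarrow> (\<exists>k. u k \<noteq> 0) \<and> (\<forall>k. u k \<noteq> 0 \<longrightarrow> k \<in> C) \<and> (\<forall>k\<in>R. tri_row a s u k = 0)"

text \<open>The first and the last column of the adjugate matrix of the chain \<open>i, \<dots>, i + l - 1\<close>, extended by zero; the signs
  disappear because the couplings enter the rows with a minus sign.\<close>

definition adj_first :: "(nat \<Rightarrow> 'a::comm_ring_1) \<Rightarrow> (nat \<Rightarrow> 'a) \<Rightarrow> nat \<Rightarrow> nat \<Rightarrow> nat \<Rightarrow> 'a" where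
  "adj_first a s i l k = (if i \<le> k \<and> k < i + l
     then (\<Prod>j=Suc i..<Suc k. s j) * continuant a s (Suc k) (i + l - k) else 0)"

definition adj_last :: "(nat \<Rightarrow> 'a::comm_ring_1) \<Rightarrow> (nat \<Rightarrow> 'a) \<Rightarrow> nat \<Rightarrow> nat \<Rightarrow> nat \<Rightarrow> 'a" where
  "adj_last a s i l k = (if i \<le> k \<and> k < i + l
     then (\<Prod>j=Suc k..<i + l. s j) * continuant a s i (Suc k - i) else 0)"

lemma adj_first_row:
  assumes "i \<ge> 1" "i \<le> k" "k < i + l"
  shows "tri_row a s (adj_first a s i l) k = (if k = i then continuant a s i (Suc l) else 0)"
proof -
  let ?u = "adj_first a s i l"
  define q where "q = i + l - Suc k"
  have q: "i + l - k = Suc q" "i + l - Suc k = q" using assms by (auto simp: q_def)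
  define p where "p = (\<Prod>j=Suc i..<Suc k. s j)"
  have uk: "?u k = p * continuant a s (Suc k) (Suc q)"
    using assms by (simp add: adj_first_def q p_def)
  have uk1: "s (Suc k) * ?u (Suc k) = p * ((s (Suc k))\<^sup>2 * continuant a s (Suc (Suc k)) q)"
  proof (cases "q = 0")
    case True
    then have "Suc k = i + l" using assms by (auto simp: q_def)
    then show ?thesis using True by (simp add: adj_first_def)
  next
    case False
    then have "Suc k < i + l" by (auto simp: q_def)
    then show ?thesis using assms q by (simp add: adj_first_def p_def power2_eq_square algebra_simps)
  qed
  have left: "a k * continuant a s (Suc k) (Suc q) - (s (Suc k))\<^sup>2 * continuant a s (Suc (Suc k)) q =
      continuant a s k (Suc (Suc q))"
    by (rule continuant_left[symmetric])
  have "tri_row a s ?u k = p * continuant a s k (Suc (Suc q)) - s k * ?u (k - 1)"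
    unfolding tri_row_def uk uk1 left[symmetric] by (simp add: algebra_simps del: continuant.simps)
  also have "\<dots> = (if k = i then continuant a s i (Suc l) else 0)"
  proof (cases "k = i")
    case True
    then have "Suc (Suc q) = Suc l" "?u (k - 1) = 0" "p = 1" using q assms by (auto simp: adj_first_def p_def)
    then show ?thesis using True by simp
  next
    case False
    then obtain k' where k: "k = Suc k'" "i \<le> k'" using assms by (cases k) auto
    then have "i + l - k' = Suc (Suc q)" using assms q by auto
    then show ?thesis using False k assms(3) by (simp add: adj_first_def p_def algebra_simps del: continuant.simps)
  qed
  finally show ?thesis .
qed

lemma adj_last_row:
  assumes "i \<ge> 1" "i \<le> k" "k < i + l"
  shows "tri_row a s (adj_last a s i l) k = (if Suc k = i + l then continuant a s i (Suc l) else 0)"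
proof -
  let ?u = "adj_last a s i l"
  define q where "q = k - i"
  have q: "Suc k - i = Suc q" "k = i + q" using assms by (auto simp: q_def)
  define p where "p = (\<Prod>j=Suc k..<i + l. s j)"
  have uk: "?u k = p * continuant a s i (Suc q)"
    using assms by (simp add: adj_last_def q(1) p_def)
  have uk1: "s k * ?u (k - 1) = p * ((s k)\<^sup>2 * continuant a s i q)"
  proof (cases "q = 0")
    case True
    then show ?thesis using q assms by (auto simp: adj_last_def)
  next
    case False
    then have "i \<le> k - 1" "k - 1 < i + l" "Suc (k - 1) = k" "k - i = q" using assms q by auto
    moreover have "(\<Prod>j=k..<i + l. s j) = s k * p"
      using assms by (simp add: p_def prod.atLeast_Suc_lessThan)
    ultimately show ?thesis by (simp add: adj_last_def power2_eq_square algebra_simps)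
  qed
  have "tri_row a s ?u k = p * continuant a s i (Suc (Suc q)) - s (Suc k) * ?u (Suc k)"
    unfolding tri_row_def uk uk1 by (simp add: q(2) algebra_simps)
  also have "\<dots> = (if Suc k = i + l then continuant a s i (Suc l) else 0)"
  proof (cases "Suc k = i + l")
    case True
    then have "Suc (Suc q) = Suc l" "?u (Suc k) = 0" "p = 1" using q assms by (auto simp: adj_last_def p_def)
    then show ?thesis using True by simp
  next
    case False
    then have "Suc k < i + l" "i \<le> Suc k" "Suc (Suc k) - i = Suc (Suc q)" using assms q by auto
    moreover from this have "p = s (Suc k) * (\<Prod>j=Suc (Suc k)..<i + l. s j)"
      by (simp add: p_def prod.atLeast_Suc_lessThan)
    ultimately show ?thesis using False by (simp add: adj_last_def algebra_simps del: continuant.simps)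
  qed
  finally show ?thesis .
qed

lemma tri_kernel_extend:
  assumes "tri_kernel a s R C u" "C \<subseteq> C'" "\<And>k. k \<in> R' - R \<Longrightarrow> tri_row a s u k = 0"
  shows "tri_kernel a s R' C' u"
  using assms unfolding tri_kernel_def by blast

text \<open>Both existence statements need each other. If also \<open>K(i..j-1) = 0\<close>, then the last coupling is zero or
  \<open>K(i..j-2) = 0\<close>, and a kernel vector of the shorter chain satisfies the last row in either case. Otherwise the last
  column of the adjugate matrix is a nonzero kernel vector.\<close>

lemma tri_kernel_and_right:
  fixes s :: "nat \<Rightarrow> 'a::idom"
  assumes "i \<ge> 1" "continuant a s i (Suc l) = 0"
  shows "(\<exists>u. tri_kernel a s {i..<i + l} {i..<i + l} u) \<and>
    (continuant a s i l = 0 \<longrightarrow> (\<exists>u. tri_kernel a s {i..<i + l} {i..<i + l - 1} u))"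
  using assms(2)
proof (induction l)
  case 0 then show ?case by simp
next
  case (Suc l)
  have right: "\<exists>u. tri_kernel a s {i..<i + Suc l} {i..<i + l} u" if z: "continuant a s i (Suc l) = 0"
  proof -
    have IH1: "\<exists>u. tri_kernel a s {i..<i + l} {i..<i + l} u"
      and IH2: "continuant a s i l = 0 \<Longrightarrow> \<exists>u. tri_kernel a s {i..<i + l} {i..<i + l - 1} u"
      using Suc.IH[OF z] by auto
    have "(s (i + l))\<^sup>2 * continuant a s i l = 0" using Suc.prems z by simp
    then consider "s (i + l) = 0" | "continuant a s i l = 0" by auto
    then show ?thesis
    proof cases
      case 1
      obtain u where u: "tri_kernel a s {i..<i + l} {i..<i + l} u" using IH1 by blast
      have "u (i + l) = 0" "u (Suc (i + l)) = 0"
        using u unfolding tri_kernel_def by auto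
      then have "tri_row a s u (i + l) = 0" using 1 by (simp add: tri_row_def)
      moreover have "k = i + l" if "k \<in> {i..<i + Suc l} - {i..<i + l}" for k using that by auto
      ultimately have "tri_kernel a s {i..<i + Suc l} {i..<i + l} u"
        by (intro tri_kernel_extend[OF u]) auto
      then show ?thesis by blast
    next
      case 2
      obtain u where u: "tri_kernel a s {i..<i + l} {i..<i + l - 1} u" using IH2[OF 2] by blast
      have "u (i + l) = 0" "u (Suc (i + l)) = 0" "u (i + l - 1) = 0"
        using u unfolding tri_kernel_def by auto
      then have "tri_row a s u (i + l) = 0" by (simp add: tri_row_def)
      moreover have "k = i + l" if "k \<in> {i..<i + Suc l} - {i..<i + l}" for k using that by auto
      ultimately have "tri_kernel a s {i..<i + Suc l} {i..<i + l} u"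
        by (intro tri_kernel_extend[OF u]) auto
      then show ?thesis by blast
    qed
  qed
  show ?case
  proof (cases "continuant a s i (Suc l) = 0")
    case True
    then obtain u where "tri_kernel a s {i..<i + Suc l} {i..<i + l} u" using right by blast
    then show ?thesis using tri_kernel_extend[of a s "{i..<i + Suc l}" "{i..<i + l}" u "{i..<i + Suc l}" "{i..<i + Suc l}"]
      by auto
  next
    case False
    let ?u = "adj_last a s i (Suc l)"
    have "?u (i + l) \<noteq> 0" using False by (simp add: adj_last_def Suc_diff_le del: continuant.simps)
    moreover have "\<forall>k\<in>{i..<i + Suc l}. tri_row a s ?u k = 0"
      using adj_last_row[OF assms(1), of _ "Suc l" a s] Suc.prems by (simp del: continuant.simps)
    moreover have "\<forall>k. ?u k \<noteq> 0 \<longrightarrow> k \<in> {i..<i + Suc l}" by (simp add: adj_last_def)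
    ultimately have "tri_kernel a s {i..<i + Suc l} {i..<i + Suc l} ?u" unfolding tri_kernel_def by blast
    then show ?thesis using False by blast
  qed
qed

lemmas tri_kernel_exists = tri_kernel_and_right[THEN conjunct1]
lemmas tri_kernel_exists_right = tri_kernel_and_right[THEN conjunct2, THEN mp]

lemma tri_kernel_extend_left:
  assumes "tri_kernel a s {Suc i..<m} C u" "C \<subseteq> {Suc i..<m}" "s (Suc i) * u (Suc i) = 0"
  shows "tri_kernel a s {i..<m} C u"
proof -
  have "u i = 0" "u (i - 1) = 0" using assms(1,2) unfolding tri_kernel_def by fastforce+
  then have "tri_row a s u i = 0" using assms(3) by (simp add: tri_row_def)
  then show ?thesis
    by (intro tri_kernel_extend[OF assms(1)]) (auto, metis Suc_leI le_neq_implies_less)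
qed

lemma tri_kernel_exists_left:
  fixes s :: "nat \<Rightarrow> 'a::idom"
  assumes "i \<ge> 1" "continuant a s i (Suc l) = 0" "continuant a s (Suc i) l = 0"
  shows "\<exists>u. tri_kernel a s {i..<i + l} {Suc i..<i + l} u"
  using assms
proof (induction l arbitrary: i)
  case 0 then show ?case by simp
next
  case (Suc l)
  have "(s (Suc i))\<^sup>2 * continuant a s (Suc (Suc i)) l = 0"
    using continuant_left[of a s i l] Suc.prems by simp
  then consider "s (Suc i) = 0" | "continuant a s (Suc (Suc i)) l = 0" by auto
  then show ?case
  proof cases
    case 1
    obtain u where "tri_kernel a s {Suc i..<i + Suc l} {Suc i..<i + Suc l} u"
      using tri_kernel_exists[of "Suc i" a s l] Suc.prems(3) by auto
    then have "tri_kernel a s {i..<i + Suc l} {Suc i..<i + Suc l} u"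
      by (rule tri_kernel_extend_left) (use 1 in \<open>auto\<close>)
    then show ?thesis by blast
  next
    case 2
    obtain u where u: "tri_kernel a s {Suc i..<i + Suc l} {Suc (Suc i)..<i + Suc l} u"
      using Suc.IH[of "Suc i"] Suc.prems(3) 2 by auto
    have "u (Suc i) = 0" using u unfolding tri_kernel_def by auto
    then have "tri_kernel a s {i..<i + Suc l} {Suc (Suc i)..<i + Suc l} u"
      by (intro tri_kernel_extend_left[OF u]) auto
    then have "tri_kernel a s {i..<i + Suc l} {Suc i..<i + Suc l} u"
      by (rule tri_kernel_extend) auto
    then show ?thesis by blast
  qed
qed

text \<open>The two continuants that begin at \<open>i\<close> force the first coupling to be zero or the corresponding two of the chain
  shortened on the left to vanish. In the first case a kernel vector of the shorter chain with last entry zero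
  satisfies the first row as well; in the second the claim passes to the shorter chain.\<close>

lemma tri_kernel_exists_inner:
  fixes s :: "nat \<Rightarrow> 'a::idom"
  assumes "i \<ge> 1" "continuant a s i (Suc l) = 0" "continuant a s (Suc i) l = 0"
    "continuant a s i l = 0" "continuant a s (Suc i) (l - 1) = 0"
  shows "\<exists>u. tri_kernel a s {i..<i + l} {Suc i..<i + l - 1} u"
  using assms
proof (induction l arbitrary: i)
  case 0 then show ?case by simp
next
  case (Suc l)
  then obtain l' where l: "l = Suc l'" by (cases l) auto
  have "(s (Suc i))\<^sup>2 * continuant a s (Suc (Suc i)) l = 0"
    using continuant_left[of a s i l] Suc.prems by simp
  moreover have "(s (Suc i))\<^sup>2 * continuant a s (Suc (Suc i)) l' = 0"
    using continuant_left[of a s i l'] Suc.prems l by (simp del: continuant.simps)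
  ultimately consider "s (Suc i) = 0" | "continuant a s (Suc (Suc i)) l = 0" "continuant a s (Suc (Suc i)) (l - 1) = 0"
    using l by auto
  then show ?case
  proof cases
    case 1
    obtain u where "tri_kernel a s {Suc i..<i + Suc l} {Suc i..<i + Suc l - 1} u"
      using tri_kernel_exists_right[of "Suc i" a s l] Suc.prems by auto
    then have "tri_kernel a s {i..<i + Suc l} {Suc i..<i + Suc l - 1} u"
      by (rule tri_kernel_extend_left) (use 1 in \<open>auto\<close>)
    then show ?thesis by blast
  next
    case 2
    obtain u where u: "tri_kernel a s {Suc i..<i + Suc l} {Suc (Suc i)..<i + Suc l - 1} u"
      using Suc.IH[of "Suc i"] Suc.prems 2 by auto
    have "u (Suc i) = 0" using u unfolding tri_kernel_def by auto
    then have "tri_kernel a s {i..<i + Suc l} {Suc (Suc i)..<i + Suc l - 1} u"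
      by (intro tri_kernel_extend_left[OF u]) auto
    then have "tri_kernel a s {i..<i + Suc l} {Suc i..<i + Suc l - 1} u"
      by (rule tri_kernel_extend) auto
    then show ?thesis by blast
  qed
qed

section \<open>Cyclic tridiagonal systems\<close>

lemma tri_row_cong:
  "a k = a' k \<Longrightarrow> s k = s' k \<Longrightarrow> s (Suc k) = s' (Suc k) \<Longrightarrow> c k = c' k \<Longrightarrow> c (k - 1) = c' (k - 1) \<Longrightarrow>
    c (Suc k) = c' (Suc k) \<Longrightarrow> tri_row a s c k = tri_row a' s' c' k"
  by (simp add: tri_row_def)

text \<open>The indices \<open>0\<close> and \<open>n + 1\<close> repeat \<open>n\<close> and \<open>1\<close>, so that the rows of the cyclic system are ordinary rows \<open>1, \<dots>, n\<close>.\<close>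

definition cyclic_solution ::
  "(nat \<Rightarrow> 'a::comm_ring_1) \<Rightarrow> (nat \<Rightarrow> 'a) \<Rightarrow> nat \<Rightarrow> nat set \<Rightarrow> (nat \<Rightarrow> 'a) \<Rightarrow> bool" where
  "cyclic_solution a s n R c \<longleftrightarrow> (\<exists>k\<in>{1..n}. c k \<noteq> 0) \<and> c 0 = c n \<and> c (Suc n) = c 1 \<and>
     (\<forall>k\<in>R. tri_row a s c k = 0)"

lemma cyclic_solution_of_kernel:
  assumes u: "tri_kernel a s {1..<Suc m} {1..<Suc m} u" and m: "m \<ge> 1"
    and closing: "s (Suc m) * u m + s (Suc (Suc m)) * u 1 = 0"
  shows "\<exists>c. cyclic_solution a s (Suc m) {1..Suc m} c"
proof (intro exI[of _ "u(Suc (Suc m) := u 1)"], unfold cyclic_solution_def, intro conjI ballI)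
  let ?c = "u(Suc (Suc m) := u 1)"
  have z: "u 0 = 0" "u (Suc m) = 0" using u unfolding tri_kernel_def by auto
  obtain k where k: "u k \<noteq> 0" "k \<in> {1..<Suc m}" using u unfolding tri_kernel_def by blast
  then show "\<exists>k\<in>{1..Suc m}. ?c k \<noteq> 0" by (intro bexI[of _ k]) auto
  show "?c 0 = ?c (Suc m)" "?c (Suc (Suc m)) = ?c 1" using z m by auto
  fix k assume "k \<in> {1..Suc m}"
  then consider "k \<in> {1..<Suc m}" | "k = Suc m" by fastforce
  then show "tri_row a s ?c k = 0"
  proof cases
    case 1
    then have "tri_row a s ?c k = tri_row a s u k" by (intro tri_row_cong) auto
    then show ?thesis using u 1 unfolding tri_kernel_def by auto
  next
    case 2
    then show ?thesis using closing z m by (simp add: tri_row_def algebra_simps) (metis add.inverse_inverse eq_neg_iff_add_eq_0)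
  qed
qed

text \<open>Index \<open>n = m + 1\<close> is the one called \<open>0\<close> in the introduction; the others form a chain with determinant \<open>P\<close>. If
  \<open>P \<noteq> 0\<close>, Cramer's rule expresses the chain by \<open>c\<^sub>n\<close>, and row \<open>n\<close> is the asserted equation. If \<open>P = 0\<close>, the right side \<open>Q\<close>
  satisfies \<open>A Q = t\<^sup>2\<close> and \<open>B Q = t'\<^sup>2\<close>. When \<open>A \<noteq> 0\<close>, the kernel of the chain is spanned by the first adjugate column,
  which solves row \<open>n\<close> exactly if \<open>t = 0\<close>; likewise for \<open>B\<close>. When \<open>A = B = 0\<close>, then \<open>Q = 0\<close>, and the chain has kernel vectors
  vanishing at its first and at its last place, of which a combination solves row \<open>n\<close>.\<close>

lemma cyclic_singular_iff:
  fixes a s :: "nat \<Rightarrow> 'a::field"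
  assumes m: "m \<ge> 1" and per: "s (Suc (Suc m)) = s 1"
  defines "P \<equiv> continuant a s 1 (Suc m)" and "A \<equiv> continuant a s 2 m" and "B \<equiv> continuant a s 1 m"
    and "pr \<equiv> \<Prod>i=2..<Suc m. s i"
  shows "(\<exists>c. cyclic_solution a s (Suc m) {1..Suc m} c) \<longleftrightarrow>
    P * a (Suc m) = (s 1)\<^sup>2 * A + (s (Suc m))\<^sup>2 * B + (s (Suc m) * s 1 * pr + s (Suc m) * s 1 * pr)"
    (is "?L \<longleftrightarrow> P * a (Suc m) = ?Q")
proof -
  let ?n = "Suc m"
  define t where "t = s 1 * A + s ?n * pr"
  define t' where "t' = s ?n * B + s 1 * pr"
  have cond: "P * continuant a s 2 (m - 1) = A * B - pr\<^sup>2"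
    using continuant_condensation[of a s 1 "m - 1"] m
    by (simp add: P_def A_def B_def pr_def eval_nat_numeral)
  have Q: "?Q = s 1 * t + s ?n * t'"
    by (simp add: t_def t'_def algebra_simps power2_eq_square)
  have AQ: "A * ?Q = t\<^sup>2" "B * ?Q = t'\<^sup>2" if "P = 0"
  proof -
    have AB: "A * B = pr\<^sup>2" using cond that by simp
    have "A * ?Q = (s 1 * A)\<^sup>2 + (s ?n)\<^sup>2 * (A * B) + (s ?n * pr * (s 1 * A) + s ?n * pr * (s 1 * A))"
      by (simp add: algebra_simps power2_eq_square)
    then show "A * ?Q = t\<^sup>2" unfolding AB by (simp add: t_def algebra_simps power2_eq_square)
    have "B * ?Q = (s 1)\<^sup>2 * (A * B) + (s ?n * B)\<^sup>2 + (s ?n * B * (s 1 * pr) + s ?n * B * (s 1 * pr))"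
      by (simp add: algebra_simps power2_eq_square)
    then show "B * ?Q = t'\<^sup>2" unfolding AB by (simp add: t'_def algebra_simps power2_eq_square)
  qed
  have ends: "P * c 1 = t * c ?n" "P * c m = t' * c ?n"
    and inner: "c ?n = 0 \<Longrightarrow> A * c m = pr * c 1" "c ?n = 0 \<Longrightarrow> B * c 1 = pr * c m"
    if c: "cyclic_solution a s ?n {1..?n} c" for c
  proof -
    have rows: "tri_row a s c k = 0" if "1 \<le> k" "k \<le> m" for k
      using c that unfolding cyclic_solution_def by auto
    have c0: "c 0 = c ?n" using c unfolding cyclic_solution_def by blast
    have p1: "(\<Prod>k=Suc 1..<Suc (1 + m). s k) = pr * s ?n"
      using m unfolding pr_def by (simp add: numeral_2_eq_2)
    have p2: "(\<Prod>k=1..<1 + m. s k) = s 1 * pr"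
    proof -
      have "(\<Prod>k=1..<Suc m. s k) = s 1 * (\<Prod>k=Suc 1..<Suc m. s k)"
        by (rule prod.atLeast_Suc_lessThan) (use m in simp)
      then show ?thesis by (simp only: pr_def numeral_2_eq_2 One_nat_def add_Suc add_0)
    qed
    show "P * c 1 = t * c ?n"
      using cramer_left[of 1 m a s c] rows unfolding p1
      by (simp add: P_def A_def t_def c0 numeral_2_eq_2 algebra_simps del: continuant.simps)
    show "P * c m = t' * c ?n"
      using cramer_right[of 1 m a s c] rows unfolding p2
      by (simp add: P_def B_def t'_def c0 algebra_simps del: continuant.simps)
    assume cn: "c ?n = 0"
    show "B * c 1 = pr * c m"
    proof -
      obtain m' where m': "m = Suc m'" using m by (cases m) auto
      have "continuant a s 1 (Suc m') * c 1 =
          s 1 * continuant a s (Suc 1) m' * c 0 + (\<Prod>k=Suc 1..<Suc (1 + m'). s k) * c (1 + m')"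
        using cramer_left[of 1 m' a s c] rows m' by simp
      then show ?thesis
        using cn c0 m' by (simp add: B_def pr_def numeral_2_eq_2 del: continuant.simps)
    qed
    show "A * c m = pr * c 1"
    proof -
      obtain m' where m': "m = Suc m'" using m by (cases m) auto
      have "continuant a s 2 (Suc m') * c (2 + m' - 1) =
          s (2 + m') * continuant a s 2 m' * c (2 + m') + (\<Prod>k=2..<2 + m'. s k) * c (2 - 1)"
        by (rule cramer_right) (use rows m' in auto)
      then show ?thesis
        using cn m' by (simp add: A_def pr_def del: continuant.simps)
    qed
  qed
  have F: "adj_first a s 1 m 1 = A" "adj_first a s 1 m m = pr"
    "adj_last a s 1 m 1 = pr" "adj_last a s 1 m m = B"
    "adj_first a s 1 m 0 = 0" "adj_first a s 1 m ?n = 0" "adj_last a s 1 m 0 = 0" "adj_last a s 1 m ?n = 0"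
    using m by (auto simp: adj_first_def adj_last_def A_def B_def pr_def numeral_2_eq_2)
  have kerF: "tri_kernel a s {1..<Suc m} {1..<Suc m} (adj_first a s 1 m)" if "P = 0" "A \<noteq> 0"
    unfolding tri_kernel_def
  proof (intro conjI allI impI ballI exI[of _ 1])
    fix k assume "k \<in> {1..<Suc m}"
    then show "tri_row a s (adj_first a s 1 m) k = 0"
      using adj_first_row[of 1 k m a s] \<open>P = 0\<close> by (simp add: P_def del: continuant.simps)
  next
    fix k assume "adj_first a s 1 m k \<noteq> 0"
    then show "k \<in> {1..<Suc m}" by (auto simp: adj_first_def split: if_splits)
  qed (use F(1) that in simp)
  have kerL: "tri_kernel a s {1..<Suc m} {1..<Suc m} (adj_last a s 1 m)" if "P = 0" "B \<noteq> 0"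
    unfolding tri_kernel_def
  proof (intro conjI allI impI ballI exI[of _ m])
    fix k assume "k \<in> {1..<Suc m}"
    then show "tri_row a s (adj_last a s 1 m) k = 0"
      using adj_last_row[of 1 k m a s] \<open>P = 0\<close> by (simp add: P_def del: continuant.simps)
  next
    fix k assume "adj_last a s 1 m k \<noteq> 0"
    then show "k \<in> {1..<Suc m}" by (auto simp: adj_last_def split: if_splits)
  qed (use F(4) that in simp)
  show ?thesis
  proof (cases "P = 0")
    case nz: False
    show ?thesis
    proof
      assume ?L
      then obtain c where c: "cyclic_solution a s ?n {1..?n} c" by blast
      have rows: "tri_row a s c k = 0" if "1 \<le> k" "k \<le> ?n" for k
        using c that unfolding cyclic_solution_def by auto
      have cn: "c ?n \<noteq> 0"
      proof
        assume "c ?n = 0"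
        then have "c k = 0" if "1 \<le> k" "k < 1 + m" for k
          by (intro tri_kernel_trivial[of 1 a s m c k])
             (use nz rows c that in \<open>auto simp: P_def cyclic_solution_def\<close>)
        then show False using c \<open>c ?n = 0\<close> unfolding cyclic_solution_def
          by (metis atLeastAtMost_iff le_SucE less_Suc_eq_le plus_1_eq_Suc)
      qed
      have "a ?n * c ?n = s ?n * c m + s 1 * c 1"
        using rows[of ?n] c per by (simp add: tri_row_def cyclic_solution_def algebra_simps)
      then have "P * a ?n * c ?n = s ?n * (P * c m) + s 1 * (P * c 1)"
        by (simp add: algebra_simps)
      also have "\<dots> = ?Q * c ?n" unfolding ends[OF c] Q by (simp add: algebra_simps)
      finally show "P * a ?n = ?Q" using cn by simp
    next
      assume eq: "P * a ?n = ?Q"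
      \<comment> \<open>Cramer's rule with the value \<open>P\<close> at the place \<open>n\<close>, which clears the denominators.\<close>
      define w where "w k = s 1 * adj_first a s 1 m k + s ?n * adj_last a s 1 m k +
        (if k = 0 \<or> k = ?n then P else 0)" for k
      define c where "c = w(Suc ?n := w 1)"
      have w1: "w 1 = t" "w m = t'" "w 0 = P" "w ?n = P"
        using m F unfolding w_def t_def t'_def by (auto simp: algebra_simps)
      have "cyclic_solution a s ?n {1..?n} c"
        unfolding cyclic_solution_def
      proof (intro conjI ballI)
        show "\<exists>k\<in>{1..?n}. c k \<noteq> 0" using nz w1 by (intro bexI[of _ ?n]) (auto simp: c_def)
        show "c 0 = c ?n" "c (Suc ?n) = c 1" using w1 m by (auto simp: c_def)
        fix k assume k: "k \<in> {1..?n}"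
        show "tri_row a s c k = 0"
        proof (cases "k = ?n")
          case True
          have "tri_row a s c ?n = a ?n * P - s ?n * t' - s 1 * t"
            using w1 m per by (simp add: tri_row_def c_def)
          then show ?thesis using True eq Q by (simp add: algebra_simps)
        next
          case False
          then have km: "1 \<le> k" "k < 1 + m" using k by auto
          have "tri_row a s c k = tri_row a s w k"
            by (rule tri_row_cong) (use km in \<open>auto simp: c_def\<close>)
          also have "\<dots> = s 1 * tri_row a s (adj_first a s 1 m) k + s ?n * tri_row a s (adj_last a s 1 m) k -
              (if k = 1 then s 1 * P else 0) - (if k = m then s ?n * P else 0)"
            using km unfolding tri_row_def w_def by (auto simp: algebra_simps)
          also have "\<dots> = 0"
            using adj_first_row[OF _ km, of a s] adj_last_row[OF _ km, of a s] by (simp add: P_def)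
          finally show ?thesis .
        qed
      qed
      then show ?L by blast
    qed
  next
    case P0: True
    show ?thesis
    proof
      assume ?L
      then obtain c where c: "cyclic_solution a s ?n {1..?n} c" by blast
      have rows: "tri_row a s c k = 0" if "1 \<le> k" "k \<le> ?n" for k
        using c that unfolding cyclic_solution_def by auto
      have c0: "c 0 = c ?n" using c unfolding cyclic_solution_def by blast
      have tt: "t = 0" "t' = 0" if "c ?n \<noteq> 0" using ends[OF c] P0 that by auto
      have close: "s ?n * c m + s 1 * c 1 = 0" if "c ?n = 0"
        using rows[of ?n] c per that by (simp add: tri_row_def cyclic_solution_def algebra_simps)
           (metis add.inverse_inverse eq_neg_iff_add_eq_0 mult.commute)
      have zero: "\<exists>k. 1 \<le> k \<and> k < 1 + m \<and> c k \<noteq> 0" if "c ?n = 0"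
        using c that unfolding cyclic_solution_def
        by (metis atLeastAtMost_iff le_SucE less_Suc_eq_le plus_1_eq_Suc)
      have "?Q = 0"
      proof (cases "A = 0")
        case nA: False
        have "t = 0"
        proof (cases "c ?n = 0")
          case cn: True
          have "c 1 \<noteq> 0"
          proof
            assume c1: "c 1 = 0"
            have "c k = 0" if "2 \<le> k" "k < 2 + (m - 1)" for k
              by (rule tri_kernel_trivial[of 2 a s "m - 1"])
                 (use nA c1 cn rows that m in \<open>auto simp: A_def\<close>)
            then show False using zero[OF cn] c1 m by (metis (no_types, lifting) Nat.add_diff_assoc Suc_1 add_2_eq_Suc
                diff_Suc_1 le_antisym not_less_eq_eq numeral_2_eq_2 plus_1_eq_Suc)
          qed
          moreover have "c 1 * t = 0"
          proof -
            have "c 1 * t = A * (s ?n * c m + s 1 * c 1)"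
              using inner(1)[OF c cn] unfolding t_def by (simp add: algebra_simps)
            then show ?thesis using close[OF cn] by simp
          qed
          ultimately show ?thesis by simp
        qed (rule tt)
        then show ?thesis using AQ(1)[OF P0] nA by simp
      next
        case A0: True
        then have pr0: "pr = 0" using cond P0 by simp
        show ?thesis
        proof (cases "B = 0")
          case nB: False
          have "t' = 0"
          proof (cases "c ?n = 0")
            case cn: True
            have "c m \<noteq> 0"
            proof
              assume cm: "c m = 0"
              have "c k = 0" if "1 \<le> k" "k < 1 + (m - 1)" for k
                by (rule tri_kernel_trivial[of 1 a s "m - 1"])
                   (use nB c0 cm cn rows that m in \<open>auto simp: B_def\<close>)
              then show False using zero[OF cn] cm m
                by (metis Suc_diff_1 less_antisym less_eq_Suc_le plus_1_eq_Suc One_nat_def)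
            qed
            moreover have "c m * t' = 0"
            proof -
              have "c m * t' = B * (s ?n * c m + s 1 * c 1)"
                using inner(2)[OF c cn] unfolding t'_def by (simp add: algebra_simps)
              then show ?thesis using close[OF cn] by simp
            qed
            ultimately show ?thesis by simp
          qed (rule tt)
          then show ?thesis using AQ(2)[OF P0] nB by simp
        qed (use A0 pr0 in simp)
      qed
      then show "P * a ?n = ?Q" using P0 by simp
    next
      assume "P * a ?n = ?Q"
      then have Q0: "?Q = 0" using P0 by simp
      consider "A \<noteq> 0" | "B \<noteq> 0" | "A = 0" "B = 0" by blast
      then show ?L
      proof cases
        case 1
        have "t = 0" using AQ(1)[OF P0] Q0 by simp
        then show ?thesis
          by (intro cyclic_solution_of_kernel[OF kerF[OF P0 1] m])
             (simp only: F per, simp add: t_def add.commute)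
      next
        case 2
        have "t' = 0" using AQ(2)[OF P0] Q0 by simp
        then show ?thesis
          by (intro cyclic_solution_of_kernel[OF kerL[OF P0 2] m])
             (simp only: F per, simp add: t'_def)
      next
        case 3
        obtain u where u: "tri_kernel a s {1..<1 + m} {Suc 1..<1 + m} u"
          using tri_kernel_exists_left[of 1 a s m] P0 3 by (auto simp: P_def A_def numeral_2_eq_2)
        obtain v where v: "tri_kernel a s {1..<1 + m} {1..<1 + m - 1} v"
          using tri_kernel_exists_right[of 1 a s m] P0 3 by (auto simp: P_def B_def)
        have uz: "u 1 = 0" "u 0 = 0" "u ?n = 0" "v m = 0" "v 0 = 0" "v ?n = 0"
          using u v unfolding tri_kernel_def by auto
        show ?thesis
        proof (cases "s 1 * v 1 = 0")
          case True
          have "tri_kernel a s {1..<Suc m} {1..<Suc m} v" using v by (intro tri_kernel_extend[OF v]) auto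
          then show ?thesis by (rule cyclic_solution_of_kernel[OF _ m]) (use True uz per in auto)
        next
          case b: False
          \<comment> \<open>This combination solves row \<open>n\<close>, as \<open>u\<close> is zero at \<open>1\<close> and \<open>v\<close> at \<open>m\<close>.\<close>
          define w where "w k = (s 1 * v 1) * u k - (s ?n * u m) * v k" for k
          show ?thesis
          proof (cases "s ?n * u m = 0")
            case True
            have "tri_kernel a s {1..<Suc m} {1..<Suc m} u" using u by (intro tri_kernel_extend[OF u]) auto
            then show ?thesis by (rule cyclic_solution_of_kernel[OF _ m]) (use True uz per in auto)
          next
            case False
            have "w 1 \<noteq> 0" using False b uz by (auto simp: w_def)
            moreover have "tri_row a s w k = 0" if "k \<in> {1..<Suc m}" for k
            proof -
              have "tri_row a s w k = (s 1 * v 1) * tri_row a s u k - (s ?n * u m) * tri_row a s v k"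
                by (simp add: tri_row_def w_def algebra_simps)
              then show ?thesis using u v that unfolding tri_kernel_def by auto
            qed
            moreover have "k \<in> {1..<Suc m}" if "w k \<noteq> 0" for k
            proof -
              have "u k \<noteq> 0 \<or> v k \<noteq> 0" using that by (auto simp: w_def)
              then show ?thesis using u v unfolding tri_kernel_def by fastforce
            qed
            ultimately have "tri_kernel a s {1..<Suc m} {1..<Suc m} w"
              unfolding tri_kernel_def by blast
            then show ?thesis
              by (rule cyclic_solution_of_kernel[OF _ m])
                 (use uz per in \<open>simp add: w_def algebra_simps\<close>)
          qed
        qed
      qed
    qed
  qed
qed

lemma cut_cycle_singular_iff:
  fixes a s :: "nat \<Rightarrow> 'a::field"
  assumes n: "n \<ge> 1" and cut: "s 1 = 0" "s (Suc n) = 0"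
  shows "(\<exists>c. cyclic_solution a s n {1..n} c) \<longleftrightarrow> continuant a s 1 (Suc n) = 0"
proof
  assume "\<exists>c. cyclic_solution a s n {1..n} c"
  then obtain c where c: "cyclic_solution a s n {1..n} c" by blast
  show "continuant a s 1 (Suc n) = 0"
  proof (rule ccontr)
    assume "continuant a s 1 (Suc n) \<noteq> 0"
    then have "c k = 0" if "1 \<le> k" "k < 1 + n" for k
      by (intro tri_kernel_trivial[of 1 a s n c k])
         (use c cut that in \<open>auto simp: cyclic_solution_def\<close>)
    then show False using c by (auto simp: cyclic_solution_def)
  qed
next
  assume "continuant a s 1 (Suc n) = 0"
  then obtain u where u: "tri_kernel a s {1..<1 + n} {1..<1 + n} u"
    using tri_kernel_exists[of 1 a s n] by blast
  define c where "c = u(0 := u n, Suc n := u 1)"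
  have "tri_row a s c k = tri_row a s u k" if "k \<in> {1..<1 + n}" for k
    using that cut by (auto simp: tri_row_def c_def)
  moreover have "\<exists>k\<in>{1..n}. c k \<noteq> 0"
  proof -
    obtain k where "u k \<noteq> 0" "k \<in> {1..<1 + n}" using u unfolding tri_kernel_def by blast
    then show ?thesis by (intro bexI[of _ k]) (auto simp: c_def)
  qed
  ultimately have "cyclic_solution a s n {1..n} c"
    using u n unfolding cyclic_solution_def tri_kernel_def by (auto simp: c_def)
  then show "\<exists>c. cyclic_solution a s n {1..n} c" by blast
qed

text \<open>A chain \<open>1, \<dots>, m\<close> with outer neighbours \<open>0\<close> and \<open>m + 1\<close>, subject to a boundary condition.\<close>

definition chain_solution ::
  "(nat \<Rightarrow> 'a::comm_ring_1) \<Rightarrow> (nat \<Rightarrow> 'a) \<Rightarrow> nat \<Rightarrow> ((nat \<Rightarrow> 'a) \<Rightarrow> bool) \<Rightarrow> bool" where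
  "chain_solution a s m bc \<longleftrightarrow> (\<exists>c. (\<exists>k\<le>Suc m. c k \<noteq> 0) \<and> (\<forall>k\<in>{1..m}. tri_row a s c k = 0) \<and> bc c)"

text \<open>The five boundary conditions are those coming from the five polynomials that define \<open>\<langle>W\<^sub>n\<rangle>\<close>. If the continuant
  conditions hold, one vector supported on the chain with \<open>s\<^sub>1 u\<^sub>1 = s\<^sub>m\<^sub>+\<^sub>1 u\<^sub>m = 0\<close> satisfies all of them. Conversely the second
  condition forces some coupling to be zero, which kills the mixed terms in Cramer's rule; if a continuant condition failed,
  the outer unknowns in one of the other conditions would have to be zero, and then everything. The two forms of the second
  condition arise because the edges at a vertex are numbered by size: which rim edge comes first depends on the vertex.\<close>

lemma chain_solution_iff:
  fixes a s :: "nat \<Rightarrow> 'a::field"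
  assumes m: "m \<ge> 1"
    and bs: "bs = (\<lambda>c. c 0 = 0 \<and> s 1 * c 1 = 0) \<or> bs = (\<lambda>c. c (Suc m) = 0 \<and> s (Suc m) * c m = 0)"
  shows "chain_solution a s m (\<lambda>c. c 0 = 0 \<and> c (Suc m) = 0) \<and> chain_solution a s m bs \<and>
    chain_solution a s m (\<lambda>c. c (Suc m) = c 0 \<and> s 1 * (c 0 - c 1) = 0) \<and>
    chain_solution a s m (\<lambda>c. c (Suc m) = c 0 \<and> s (Suc m) * (c (Suc m) - c m) = 0) \<and>
    chain_solution a s m (\<lambda>c. s 1 * (c 0 - c 1) = 0 \<and> s (Suc m) * (c (Suc m) - c m) = 0) \<longleftrightarrow>
    (continuant a s 1 (Suc m) = 0 \<and> s 1 * continuant a s 2 m = 0) \<and>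
    s (Suc m) * continuant a s 1 m = 0 \<and> s 1 * s (Suc m) * continuant a s 2 (m - 1) = 0"
    (is "?L1 \<and> ?L2 \<and> ?L3 \<and> ?L4 \<and> ?L5 \<longleftrightarrow> ?R")
proof
  assume R: ?R
  have "\<exists>u. tri_kernel a s {1..<1 + m} {1..<1 + m} u \<and> s 1 * u 1 = 0 \<and> s (Suc m) * u m = 0"
  proof (cases "s 1 = 0")
    case s1: True
    show ?thesis
    proof (cases "s (Suc m) = 0")
      case True
      then show ?thesis using tri_kernel_exists[of 1 a s m] R s1 by auto
    next
      case False
      then obtain u where u: "tri_kernel a s {1..<1 + m} {1..<1 + m - 1} u"
        using tri_kernel_exists_right[of 1 a s m] R by auto
      then have "u m = 0" unfolding tri_kernel_def by auto
      moreover have "tri_kernel a s {1..<1 + m} {1..<1 + m} u" by (rule tri_kernel_extend[OF u]) auto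
      ultimately show ?thesis using s1 by auto
    qed
  next
    case s1: False
    show ?thesis
    proof (cases "s (Suc m) = 0")
      case True
      obtain u where u: "tri_kernel a s {1..<1 + m} {Suc 1..<1 + m} u"
        using tri_kernel_exists_left[of 1 a s m] R s1 by (auto simp: numeral_2_eq_2)
      then have "u 1 = 0" unfolding tri_kernel_def by auto
      moreover have "tri_kernel a s {1..<1 + m} {1..<1 + m} u" by (rule tri_kernel_extend[OF u]) auto
      ultimately show ?thesis using True by auto
    next
      case False
      obtain u where u: "tri_kernel a s {1..<1 + m} {Suc 1..<1 + m - 1} u"
        using tri_kernel_exists_inner[of 1 a s m] R s1 False by (auto simp: numeral_2_eq_2)
      then have "u 1 = 0" "u m = 0" unfolding tri_kernel_def by auto
      moreover have "tri_kernel a s {1..<1 + m} {1..<1 + m} u" by (rule tri_kernel_extend[OF u]) auto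
      ultimately show ?thesis by auto
    qed
  qed
  then obtain u where u: "tri_kernel a s {1..<1 + m} {1..<1 + m} u" "s 1 * u 1 = 0" "s (Suc m) * u m = 0"
    by blast
  have z: "u 0 = 0" "u (Suc m) = 0" using u(1) unfolding tri_kernel_def by auto
  have sol: "chain_solution a s m bc" if "bc u" for bc
  proof -
    obtain k where "u k \<noteq> 0" "k \<in> {1..<1 + m}" using u(1) unfolding tri_kernel_def by blast
    then show ?thesis using u(1) that unfolding chain_solution_def tri_kernel_def
      by (intro exI[of _ u] conjI exI[of _ k]) auto
  qed
  have "bs u" using bs z u(2,3) by (elim disjE) simp_all
  then show "?L1 \<and> ?L2 \<and> ?L3 \<and> ?L4 \<and> ?L5"
    by (intro conjI sol) (use z u(2,3) in simp_all)
next
  assume L: "?L1 \<and> ?L2 \<and> ?L3 \<and> ?L4 \<and> ?L5"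
  let ?P = "continuant a s 1 (Suc m)" and ?A = "continuant a s 2 m" and ?B = "continuant a s 1 m"
    and ?D = "continuant a s 2 (m - 1)"
  have P: "?P = 0"
  proof (rule ccontr)
    assume nz: "?P \<noteq> 0"
    obtain c where c: "\<exists>k\<le>Suc m. c k \<noteq> 0" "\<forall>k\<in>{1..m}. tri_row a s c k = 0" "c 0 = 0" "c (Suc m) = 0"
      using L unfolding chain_solution_def by blast
    have "c k = 0" if "1 \<le> k" "k < 1 + m" for k
      by (rule tri_kernel_trivial[of 1 a s m c k]) (use nz c that in auto)
    then show False using c(1,3,4) by (metis One_nat_def Suc_leI le_neq_implies_less less_Suc_eq_le not_gr_zero plus_1_eq_Suc)
  qed
  have pr: "\<exists>j\<in>{1..Suc m}. s j = 0"
  proof (rule ccontr)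
    assume "\<not> (\<exists>j\<in>{1..Suc m}. s j = 0)"
    then have nz: "s j \<noteq> 0" if "1 \<le> j" "j \<le> Suc m" for j using that by auto
    obtain c where c: "\<exists>k\<le>Suc m. c k \<noteq> 0" "\<forall>k\<in>{1..m}. tri_row a s c k = 0" "bs c"
      using L unfolding chain_solution_def by blast
    have rows: "a k * c k = s k * c (k - 1) + s (Suc k) * c (Suc k)" if "1 \<le> k" "k \<le> m" for k
      using c(2) that by (auto simp: tri_row_def algebra_simps)
    from bs show False
    proof
      assume "bs = (\<lambda>c. c 0 = 0 \<and> s 1 * c 1 = 0)"
      then have c0: "c 0 = 0" "c 1 = 0" using c(3) nz[of 1] by auto
      have "k \<le> m \<Longrightarrow> c k = 0 \<and> c (Suc k) = 0" for k
      proof (induction k)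
        case (Suc k)
        then show ?case using rows[of "Suc k"] nz[of "Suc (Suc k)"] by auto
      qed (use c0 in auto)
      then show False using c(1) by (metis le_SucE order_refl)
    next
      assume "bs = (\<lambda>c. c (Suc m) = 0 \<and> s (Suc m) * c m = 0)"
      then have c0: "c (Suc m) = 0" "c m = 0" using c(3) nz[of "Suc m"] by auto
      have "i \<le> m \<Longrightarrow> c (Suc m - i) = 0 \<and> c (m - i) = 0" for i
      proof (induction i)
        case (Suc i)
        define j where "j = m - i"
        have j: "Suc m - Suc i = j" "m - Suc i = j - 1" "1 \<le> j" "j \<le> m" "Suc m - i = Suc j"
          using Suc.prems by (auto simp: j_def)
        have "c j = 0" "c (Suc j) = 0" using Suc.IH Suc.prems unfolding j(5) j_def[symmetric] by auto
        then have "s j * c (j - 1) = 0" using rows[OF j(3,4)] by simp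
        then have "c (j - 1) = 0" using nz[of j] j(3,4) by simp
        then show ?case unfolding j(1,2) using \<open>c j = 0\<close> by blast
      qed (use c0 in auto)
      then have "c (m - i) = 0" if "i \<le> m" for i using that by blast
      then have "c k = 0" if "k \<le> m" for k using that by (metis diff_diff_cancel diff_le_self)
      then show False using c(1) c0(1) by (metis le_SucE)
    qed
  qed
  have p_first: "s 1 * (\<Prod>k=Suc 1..<Suc (1 + m). s k) = 0" and p_last: "(\<Prod>k=1..<1 + m. s k) * s (Suc m) = 0"
  proof -
    have z: "(\<Prod>k=1..<Suc (1 + m). s k) = 0" using pr by (intro prod_zero) auto
    have "(\<Prod>k=1..<Suc (1 + m). s k) = s 1 * (\<Prod>k=Suc 1..<Suc (1 + m). s k)"
      by (rule prod.atLeast_Suc_lessThan) simp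
    then show "s 1 * (\<Prod>k=Suc 1..<Suc (1 + m). s k) = 0" using z by simp
    have "(\<Prod>k=1..<Suc (1 + m). s k) = (\<Prod>k=1..<1 + m. s k) * s (1 + m)"
      by (rule prod.atLeastLessThan_Suc) simp
    then show "(\<Prod>k=1..<1 + m. s k) * s (Suc m) = 0" using z by simp
  qed
  have A: "s 1 * ?A = 0"
  proof (rule ccontr)
    assume nz: "s 1 * ?A \<noteq> 0"
    obtain c where c: "\<exists>k\<le>Suc m. c k \<noteq> 0" "\<forall>k\<in>{1..m}. tri_row a s c k = 0" "c (Suc m) = c 0" "s 1 * (c 0 - c 1) = 0"
      using L unfolding chain_solution_def by blast
    have p0: "(\<Prod>k=Suc 1..<Suc (1 + m). s k) = 0" using p_first nz by auto
    have "?P * c 1 = s 1 * continuant a s (Suc 1) m * c (1 - 1) + (\<Prod>k=Suc 1..<Suc (1 + m). s k) * c (1 + m)"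
      by (rule cramer_left) (use c(2) in auto)
    then have "s 1 * ?A * c 0 = 0" unfolding P p0 by (simp add: numeral_2_eq_2)
    then have c0: "c 0 = 0" "c 1 = 0" "c (Suc m) = 0" using nz c(3,4) by auto
    have "c k = 0" if "2 \<le> k" "k < 2 + (m - 1)" for k
      by (rule tri_kernel_trivial[of 2 a s "m - 1" c k]) (use nz c(2) c0 that m in auto)
    moreover have "k = 0 \<or> k = 1 \<or> k = Suc m \<or> 2 \<le> k \<and> k < 2 + (m - 1)" if "k \<le> Suc m" for k using that by auto
    ultimately show False using c(1) c0 by metis
  qed
  have B: "s (Suc m) * ?B = 0"
  proof (rule ccontr)
    assume nz: "s (Suc m) * ?B \<noteq> 0"
    obtain c where c: "\<exists>k\<le>Suc m. c k \<noteq> 0" "\<forall>k\<in>{1..m}. tri_row a s c k = 0" "c (Suc m) = c 0"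
      "s (Suc m) * (c (Suc m) - c m) = 0"
      using L unfolding chain_solution_def by blast
    have p0: "(\<Prod>k=1..<1 + m. s k) = 0" using p_last nz by auto
    have "?P * c (1 + m - 1) = s (1 + m) * continuant a s 1 m * c (1 + m) + (\<Prod>k=1..<1 + m. s k) * c (1 - 1)"
      by (rule cramer_right) (use c(2) in auto)
    then have "s (Suc m) * ?B * c (Suc m) = 0" unfolding P p0 by simp
    then have c0: "c 0 = 0" "c m = 0" "c (Suc m) = 0" using nz c(3,4) by auto
    have "c k = 0" if "1 \<le> k" "k < 1 + (m - 1)" for k
      by (rule tri_kernel_trivial[of 1 a s "m - 1" c k]) (use nz c(2) c0 that m in auto)
    moreover have "k = 0 \<or> k = m \<or> k = Suc m \<or> 1 \<le> k \<and> k < 1 + (m - 1)" if "k \<le> Suc m" for k using that by auto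
    ultimately show False using c(1) c0 by metis
  qed
  have D: "s 1 * s (Suc m) * ?D = 0"
  proof (rule ccontr)
    assume nz: "s 1 * s (Suc m) * ?D \<noteq> 0"
    then have m2: "m \<ge> 2" using m by (cases "m = 1") auto
    then obtain m' where m': "m = Suc (Suc m')" by (metis add_2_eq_Suc le_Suc_ex)
    have A0: "?A = 0" and B0: "?B = 0" using A B nz by auto
    obtain c where c: "\<exists>k\<le>Suc m. c k \<noteq> 0" "\<forall>k\<in>{1..m}. tri_row a s c k = 0"
      "s 1 * (c 0 - c 1) = 0" "s (Suc m) * (c (Suc m) - c m) = 0"
      using L unfolding chain_solution_def by blast
    have p0: "(\<Prod>k=2..<Suc m. s k) = 0"
    proof -
      have "(\<Prod>k=Suc 1..<Suc (1 + m). s k) = (\<Prod>k=2..<Suc m. s k) * s (Suc m)"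
        using m by (simp add: numeral_2_eq_2)
      then show ?thesis using p_first nz by auto
    qed
    have eq1: "continuant a s 1 (Suc (Suc m')) * c 1 =
        s 1 * continuant a s (Suc 1) (Suc m') * c (1 - 1) + (\<Prod>k=Suc 1..<Suc (1 + Suc m'). s k) * c (1 + Suc m')"
      by (rule cramer_left) (use c(2) m' in auto)
    have "(\<Prod>k=Suc 1..<Suc (1 + Suc m'). s k) = (\<Prod>k=2..<Suc m. s k)"
      by (rule prod.cong) (auto simp: m')
    then have q1: "(\<Prod>k=Suc 1..<Suc (1 + Suc m'). s k) = 0" using p0 by (rule trans)
    have "continuant a s 1 (Suc (Suc m')) = 0" "continuant a s (Suc 1) (Suc m') = ?D"
      using B0 m' by (simp_all only: numeral_2_eq_2 One_nat_def diff_Suc_Suc diff_zero)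
    with eq1 have "s 1 * ?D * c 0 = 0" unfolding q1 by simp
    then have c0: "c 0 = 0" "c 1 = 0" using nz c(3) by auto
    have eq2: "continuant a s 2 (Suc (Suc m')) * c (2 + Suc m' - 1) =
        s (2 + Suc m') * continuant a s 2 (Suc m') * c (2 + Suc m') + (\<Prod>k=2..<2 + Suc m'. s k) * c (2 - 1)"
      by (rule cramer_right) (use c(2) m' in auto)
    have "(\<Prod>k=2..<2 + Suc m'. s k) = (\<Prod>k=2..<Suc m. s k)"
      by (rule prod.cong) (auto simp: m')
    then have q2: "(\<Prod>k=2..<2 + Suc m'. s k) = 0" using p0 by (rule trans)
    have "continuant a s 2 (Suc (Suc m')) = 0" "continuant a s 2 (Suc m') = ?D" "2 + Suc m' = Suc m"
      using A0 m' by (simp_all only: numeral_2_eq_2 One_nat_def diff_Suc_Suc diff_zero add_Suc add_0)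
    with eq2 have "s (Suc m) * ?D * c (Suc m) = 0" unfolding q2 by simp
    then have cm: "c (Suc m) = 0" "c m = 0" using nz c(4) by auto
    have "c k = 0" if "2 \<le> k" "k < 2 + m'" for k
      by (rule tri_kernel_trivial[of 2 a s m' c k]) (use nz c(2) c0 cm that m' in auto)
    moreover have "k = 0 \<or> k = 1 \<or> k = m \<or> k = Suc m \<or> 2 \<le> k \<and> k < 2 + m'" if "k \<le> Suc m" for k
      using that m' by auto
    ultimately show False using c(1) c0 cm by metis
  qed
  show ?R using P A B D by blast
qed

section \<open>Flows on wheels\<close>

lemma sum_inc_verts:
  assumes "wf_graph G" "e \<in> arcs G"
  shows "(\<Sum>v\<in>verts G. inc G e v * f v) = f (head G e) - (f (tail G e) :: 'a::comm_ring_1)"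
proof -
  have "(\<Sum>v\<in>verts G. inc G e v * f v) =
      (\<Sum>v\<in>verts G. if v = head G e then f v else 0) - (\<Sum>v\<in>verts G. if v = tail G e then f v else 0)"
    unfolding sum_subtractf[symmetric] by (rule sum.cong) (auto simp: inc_def)
  then show ?thesis using assms by (simp add: wf_graph_def)
qed

text \<open>The rows of an incidence matrix add up to zero.\<close>

lemma flow_conservation_last:
  fixes Y :: "nat \<Rightarrow> 'a::comm_ring_1"
  assumes wf: "wf_graph G" and w: "w \<in> verts G"
    and rest: "\<And>v. v \<in> verts G - {w} \<Longrightarrow> (\<Sum>e\<in>arcs G. inc G e v * Y e) = 0"
  shows "(\<Sum>e\<in>arcs G. inc G e w * Y e) = 0"
proof -
  have fin: "finite (verts G)" using wf by (simp add: wf_graph_def)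
  have "(\<Sum>v\<in>verts G. \<Sum>e\<in>arcs G. inc G e v * Y e) = (\<Sum>e\<in>arcs G. \<Sum>v\<in>verts G. inc G e v * Y e)"
    by (rule sum.swap)
  also have "\<dots> = 0"
    by (rule sum.neutral) (use sum_inc_verts[OF wf, of _ "\<lambda>_. Y _"] in simp)
  finally show ?thesis
    using sum.remove[OF fin w, of "\<lambda>v. \<Sum>e\<in>arcs G. inc G e v * Y e"] rest by simp
qed

text \<open>\<open>Y\<close> is the flow and \<open>\<phi>\<close> the potential, normalised at \<open>v0\<close>; \<open>Dr\<close> and \<open>Dc\<close> are the edges whose equation,
  respectively whose unknown, is left out.\<close>

definition network_solution ::
  "mgraph \<Rightarrow> (nat \<Rightarrow> 'a::comm_ring_1) \<Rightarrow> nat set \<Rightarrow> nat set \<Rightarrow> nat \<Rightarrow> (nat \<Rightarrow> 'a) \<Rightarrow> (nat \<Rightarrow> 'a) \<Rightarrow> bool" where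
  "network_solution G x Dr Dc v0 Y \<phi> \<longleftrightarrow> \<phi> v0 = 0 \<and> (\<forall>e\<in>Dc. Y e = 0) \<and>
     ((\<exists>e\<in>arcs G. Y e \<noteq> 0) \<or> (\<exists>v\<in>verts G. \<phi> v \<noteq> 0)) \<and>
     (\<forall>e\<in>arcs G - Dr. x e * Y e + \<phi> (head G e) - \<phi> (tail G e) = 0) \<and>
     (\<forall>v\<in>verts G. (\<Sum>e\<in>arcs G. inc G e v * Y e) = 0)"

lemma graph_minor_zero_iff:
  fixes x :: "nat \<Rightarrow> 'a::field"
  assumes wf: "wf_graph G" and v0: "v0 \<in> verts G" and Dc: "Dc \<subseteq> arcs G"
    and rs: "set rs = Inl ` (arcs G - Dr) \<union> Inr ` (verts G - {v0})"
    and cs: "distinct cs" "set cs = Inl ` (arcs G - Dc) \<union> Inr ` (verts G - {v0})"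
    and len: "length rs = length cs"
  shows "det (label_mat (graph_entry G x) rs cs) = 0 \<longleftrightarrow> (\<exists>Y \<phi>. network_solution G x Dr Dc v0 Y \<phi>)"
proof -
  have fin: "finite (arcs G)" "finite (verts G)" using wf by (auto simp: wf_graph_def)
  have sum_cs: "(\<Sum>c\<in>set cs. graph_entry G x r c * y c) =
      (\<Sum>e\<in>arcs G. graph_entry G x r (Inl e) * (if e \<in> Dc then 0 else y (Inl e))) +
      (\<Sum>v\<in>verts G. graph_entry G x r (Inr v) * (if v = v0 then 0 else y (Inr v)))" for r y
  proof -
    have "(\<Sum>c\<in>set cs. graph_entry G x r c * y c) =
        (\<Sum>c\<in>Inl ` (arcs G - Dc). graph_entry G x r c * y c) + (\<Sum>c\<in>Inr ` (verts G - {v0}). graph_entry G x r c * y c)"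
      unfolding cs(2) by (rule sum.union_disjoint) (use fin in auto)
    also have "(\<Sum>c\<in>Inl ` (arcs G - Dc). graph_entry G x r c * y c) =
        (\<Sum>e\<in>arcs G - Dc. graph_entry G x r (Inl e) * y (Inl e))"
      by (subst sum.reindex) auto
    also have "\<dots> = (\<Sum>e\<in>arcs G. graph_entry G x r (Inl e) * (if e \<in> Dc then 0 else y (Inl e)))"
      by (rule sum.mono_neutral_cong_left) (use fin in auto)
    also have "(\<Sum>c\<in>Inr ` (verts G - {v0}). graph_entry G x r c * y c) =
        (\<Sum>v\<in>verts G - {v0}. graph_entry G x r (Inr v) * y (Inr v))"
      by (subst sum.reindex) auto
    also have "\<dots> = (\<Sum>v\<in>verts G. graph_entry G x r (Inr v) * (if v = v0 then 0 else y (Inr v)))"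
      by (rule sum.mono_neutral_cong_left) (use fin in auto)
    finally show ?thesis .
  qed
  have row_e: "(\<Sum>e'\<in>arcs G. graph_entry G x (Inl e) (Inl e') * Y e') + (\<Sum>v\<in>verts G. graph_entry G x (Inl e) (Inr v) * \<phi> v) =
      x e * Y e + \<phi> (head G e) - \<phi> (tail G e)" if "e \<in> arcs G" for e Y \<phi>
  proof -
    have "(\<Sum>e'\<in>arcs G. graph_entry G x (Inl e) (Inl e') * Y e') = (\<Sum>e'\<in>arcs G. if e = e' then x e * Y e else 0)"
      by (rule sum.cong) auto
    then show ?thesis using that fin sum_inc_verts[OF wf that, of \<phi>] by simp
  qed
  have row_v: "(\<Sum>e\<in>arcs G. graph_entry G x (Inr v) (Inl e) * Y e) + (\<Sum>w\<in>verts G. graph_entry G x (Inr v) (Inr w) * \<phi> w) =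
      - (\<Sum>e\<in>arcs G. inc G e v * Y e)" for v Y \<phi>
    by (simp add: sum_negf)
  show ?thesis
    unfolding det_label_mat_eq_0_iff[OF len cs(1)]
  proof
    assume "\<exists>y. (\<exists>c\<in>set cs. y c \<noteq> 0) \<and> (\<forall>r\<in>set rs. (\<Sum>c\<in>set cs. graph_entry G x r c * y c) = 0)"
    then obtain y where y: "\<exists>c\<in>set cs. y c \<noteq> 0" "\<forall>r\<in>set rs. (\<Sum>c\<in>set cs. graph_entry G x r c * y c) = 0"
      by blast
    define Y where "Y = (\<lambda>e. if e \<in> Dc then 0 else y (Inl e))"
    define \<phi> where "\<phi> = (\<lambda>v. if v = v0 then 0 else y (Inr v))"
    have s: "(\<Sum>c\<in>set cs. graph_entry G x r c * y c) =
      (\<Sum>e\<in>arcs G. graph_entry G x r (Inl e) * Y e) + (\<Sum>v\<in>verts G. graph_entry G x r (Inr v) * \<phi> v)" for r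
      unfolding Y_def \<phi>_def by (rule sum_cs)
    have re: "x e * Y e + \<phi> (head G e) - \<phi> (tail G e) = 0" if "e \<in> arcs G - Dr" for e
      using y(2) rs that row_e[of e Y \<phi>] s[of "Inl e"] by auto
    have rv: "(\<Sum>e\<in>arcs G. inc G e v * Y e) = 0" if "v \<in> verts G - {v0}" for v
    proof -
      have "Inr v \<in> set rs" using that unfolding rs by blast
      then show ?thesis using y(2) row_v[of v Y \<phi>] s[of "Inr v"] by simp
    qed
    have "(\<Sum>e\<in>arcs G. inc G e v * Y e) = 0" if "v \<in> verts G" for v
      using rv flow_conservation_last[OF wf v0 rv] that by (cases "v = v0") auto
    moreover have "(\<exists>e\<in>arcs G. Y e \<noteq> 0) \<or> (\<exists>v\<in>verts G. \<phi> v \<noteq> 0)"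
      using y(1) unfolding cs(2) by (auto simp: Y_def \<phi>_def)
    ultimately show "\<exists>Y \<phi>. network_solution G x Dr Dc v0 Y \<phi>"
      unfolding network_solution_def using re by (intro exI[of _ Y] exI[of _ \<phi>]) (auto simp: Y_def \<phi>_def)
  next
    assume "\<exists>Y \<phi>. network_solution G x Dr Dc v0 Y \<phi>"
    then obtain Y \<phi> where Y: "network_solution G x Dr Dc v0 Y \<phi>" by blast
    define y where "y = case_sum Y \<phi>"
    have s: "(\<Sum>c\<in>set cs. graph_entry G x r c * y c) =
      (\<Sum>e\<in>arcs G. graph_entry G x r (Inl e) * Y e) + (\<Sum>v\<in>verts G. graph_entry G x r (Inr v) * \<phi> v)" for r
      unfolding sum_cs using Y unfolding network_solution_def y_def
      by (intro arg_cong2[of _ _ _ _ "(+)"] sum.cong) auto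
    have "(\<Sum>c\<in>set cs. graph_entry G x r c * y c) = 0" if "r \<in> set rs" for r
    proof (cases r)
      case (Inl e)
      then have "e \<in> arcs G - Dr" using that unfolding rs by auto
      then show ?thesis using Y row_e[of e Y \<phi>] unfolding s Inl network_solution_def by auto
    next
      case (Inr v)
      then have "v \<in> verts G" using that unfolding rs by auto
      then show ?thesis using Y unfolding s Inr row_v network_solution_def by auto
    qed
    moreover have "\<exists>c\<in>set cs. y c \<noteq> 0"
    proof -
      have "(\<exists>e\<in>arcs G - Dc. Y e \<noteq> 0) \<or> (\<exists>v\<in>verts G - {v0}. \<phi> v \<noteq> 0)"
        using Y unfolding network_solution_def by auto
      then show ?thesis
      proof (elim disjE bexE)
        fix e assume "e \<in> arcs G - Dc" "Y e \<noteq> 0"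
        then show ?thesis by (intro bexI[of _ "Inl e"]) (auto simp: cs(2) y_def)
      next
        fix v assume "v \<in> verts G - {v0}" "\<phi> v \<noteq> 0"
        then show ?thesis by (intro bexI[of _ "Inr v"]) (auto simp: cs(2) y_def)
      qed
    qed
    ultimately show "\<exists>y. (\<exists>c\<in>set cs. y c \<noteq> 0) \<and> (\<forall>r\<in>set rs. (\<Sum>c\<in>set cs. graph_entry G x r c * y c) = 0)"
      by blast
  qed
qed

lemma wheel_simps [simp]:
  "verts (wheel n) = {..n}" "arcs (wheel n) = {..<2 * n}"
  "tail (wheel n) e = (if e < n then e else e - n)" "head (wheel n) e = (if e < n then (e + 1) mod n else n)"
  by (simp_all add: wheel_def)

lemma wf_wheel: "n \<ge> 1 \<Longrightarrow> wf_graph (wheel n)"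
  by (auto simp: wf_graph_def intro: less_imp_le)

lemma wheel_rim_flow:
  fixes Y :: "nat \<Rightarrow> 'a::comm_ring_1"
  assumes n: "n \<ge> 2" and q: "q < n"
  shows "(\<Sum>e\<in>arcs (wheel n). inc (wheel n) e q * Y e) = Y ((q + n - 1) mod n) - Y q - Y (n + q)"
proof -
  have pre: "(e + 1) mod n = q \<longleftrightarrow> e = (q + n - 1) mod n" if "e < n" for e
    using that q by (cases "e + 1 = n"; cases "q = 0") (auto simp: mod_if)
  have split: "{..<2 * n} = {..<n} \<union> (\<lambda>j. n + j) ` {..<n}"
  proof -
    have "e \<in> (\<lambda>j. n + j) ` {..<n}" if "e < 2 * n" "\<not> e < n" for e
      using that by (intro image_eqI[of _ _ "e - n"]) auto
    then show ?thesis by auto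
  qed
  have "(\<Sum>e\<in>arcs (wheel n). inc (wheel n) e q * Y e) =
      (\<Sum>e<n. inc (wheel n) e q * Y e) + (\<Sum>e\<in>(\<lambda>j. n + j) ` {..<n}. inc (wheel n) e q * Y e)"
    unfolding wheel_simps split by (rule sum.union_disjoint) auto
  also have "(\<Sum>e\<in>(\<lambda>j. n + j) ` {..<n}. inc (wheel n) e q * Y e) = (\<Sum>j<n. inc (wheel n) (n + j) q * Y (n + j))"
    by (subst sum.reindex) (auto simp: inj_on_def)
  also have "\<dots> = (\<Sum>j<n. if j = q then - Y (n + j) else 0)"
    by (rule sum.cong) (use q in \<open>auto simp: inc_def\<close>)
  also have "(\<Sum>e<n. inc (wheel n) e q * Y e) =
      (\<Sum>e<n. if e = (q + n - 1) mod n then Y e else 0) - (\<Sum>e<n. if e = q then Y e else 0)"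
    unfolding sum_subtractf[symmetric]
  proof (rule sum.cong)
    fix e assume "e \<in> {..<n}"
    then have "inc (wheel n) e q = (if e = (q + n - 1) mod n then 1 else 0 :: 'a) - (if e = q then 1 else 0)"
      using pre[of e] by (simp only: inc_def wheel_simps eq_commute[of q]) simp
    then show "inc (wheel n) e q * Y e = (if e = (q + n - 1) mod n then Y e else 0) - (if e = q then Y e else 0)"
      by (simp only: left_diff_distrib) simp
  qed simp
  finally show ?thesis using n q by simp
qed

text \<open>Spoke variables, and the diagonal entries of the cyclic system, counted from the rim vertex \<open>p\<close>. The latter is
  the sum of the variables on the triangle that contains the \<open>k\<close>-th rim edge.\<close>

definition spoke_at :: "nat \<Rightarrow> nat \<Rightarrow> (nat \<Rightarrow> 'a) \<Rightarrow> nat \<Rightarrow> 'a" where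
  "spoke_at n p x k = x (n + (p + k) mod n)"

definition triangle_at :: "nat \<Rightarrow> nat \<Rightarrow> (nat \<Rightarrow> 'a::comm_ring_1) \<Rightarrow> nat \<Rightarrow> 'a" where
  "triangle_at n p x k = x ((p + k) mod n) + spoke_at n p x k + spoke_at n p x (Suc k)"

text \<open>Conservation at the rim vertex \<open>j\<close> gives the flow \<open>Y\<^sub>j\<^sub>-\<^sub>1 - Y\<^sub>j\<close> on its spoke, and the equation of the spoke gives the
  potential at \<open>j\<close> in terms of that at the hub. Substituting both into the equation of the rim edge at \<open>j\<close> yields the row of
  the tridiagonal system. Spoke equations are needed for this, so only rim edges may be in \<open>Dr\<close>.\<close>

lemma network_solution_wheel_iff:
  fixes x :: "nat \<Rightarrow> 'a::field"
  assumes n: "n \<ge> 2" and p: "p < n" and Dr: "Dr \<subseteq> {..<n}" and Dc: "Dc \<subseteq> {..<2 * n}"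
  shows "(\<exists>Y \<phi>. network_solution (wheel n) x Dr Dc 0 Y \<phi>) \<longleftrightarrow>
    (\<exists>c. cyclic_solution (triangle_at n p x) (spoke_at n p x) n {k\<in>{1..n}. (p + k) mod n \<notin> Dr} c \<and>
      (\<forall>k\<in>{1..n}. (p + k) mod n \<in> Dc \<longrightarrow> c k = 0) \<and>
      (\<forall>k\<in>{1..n}. n + (p + k) mod n \<in> Dc \<longrightarrow> c (k - 1) = c k))"
proof -
  let ?W = "wheel n"
  have wf: "wf_graph ?W" using n by (intro wf_wheel) simp
  define nx where "nx q = (q + 1) mod n" for q
  define pv where "pv q = (q + n - 1) mod n" for q
  have rng: "nx q < n" "pv q < n" for q using n by (auto simp: nx_def pv_def)
  have pn: "pv (nx q) = q" "nx (pv q) = q" if "q < n" for q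
    using that n by (cases "q + 1 = n"; cases "q = 0"; auto simp: nx_def pv_def mod_if)+
  define q where "q k = (p + k) mod n" for k
  have qr: "q k < n" for k using n by (auto simp: q_def)
  have q_Suc: "q (Suc k) = nx (q k)" for k by (simp add: q_def nx_def mod_Suc_eq)
  have q_pred: "q (k - 1) = pv (q k)" if "k \<ge> 1" for k
    using q_Suc[of "k - 1"] pn(1)[OF qr, of "k - 1"] that by simp
  have q_n: "q n = q 0" "q (Suc n) = q 1"
    by (simp_all add: q_def) (metis add_Suc mod_add_self2)
  define idx where "idx j = (if j > p then j - p else j + n - p)" for j
  have idx: "idx j \<in> {1..n}" "q (idx j) = j" if "j < n" for j
    using that p by (auto simp: idx_def q_def)
  have idx_q: "idx (q k) = k" if "k \<in> {1..n}" for k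
    using that p by (cases "p + k < n") (auto simp: idx_def q_def mod_if)
  have arcs_cases: "(\<exists>j<n. e = j) \<or> (\<exists>j<n. e = n + j)" if "e < 2 * n" for e
    using that by (cases "e < n") (auto intro: exI[of _ "e - n"])
  let ?a = "triangle_at n p x" and ?s = "spoke_at n p x"
  have row_eq: "tri_row ?a ?s c k = x (q k) * c k + x (n + nx (q k)) * (c k - c (Suc k)) - x (n + q k) * (c (k - 1) - c k)"
    for c k
    by (simp add: tri_row_def triangle_at_def spoke_at_def q_Suc[symmetric]) (simp add: q_def algebra_simps)
  show ?thesis
  proof
    assume "\<exists>Y \<phi>. network_solution ?W x Dr Dc 0 Y \<phi>"
    then obtain Y \<phi> where Y: "network_solution ?W x Dr Dc 0 Y \<phi>" by blast
    have spoke_Y: "Y (n + j) = Y (pv j) - Y j" if "j < n" for j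
    proof -
      have "(\<Sum>e\<in>arcs ?W. inc ?W e j * Y e) = 0" using Y that unfolding network_solution_def by simp
      then show ?thesis using wheel_rim_flow[OF n that, of Y] by (simp add: pv_def algebra_simps)
    qed
    have edges: "x e * Y e + \<phi> (head ?W e) - \<phi> (tail ?W e) = 0" if "e < 2 * n" "e \<notin> Dr" for e
      using Y that unfolding network_solution_def by (simp del: wheel_simps(3,4))
    have \<phi>_spoke: "\<phi> j = \<phi> n + x (n + j) * (Y (pv j) - Y j)" if "j < n" for j
    proof -
      have "n + j \<notin> Dr" using Dr by auto
      then have "x (n + j) * Y (n + j) + \<phi> n - \<phi> j = 0" using edges[of "n + j"] that by simp
      then show ?thesis unfolding spoke_Y[OF that] by (simp add: algebra_simps)
    qed
    define c where "c k = Y (q k)" for k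
    have "tri_row ?a ?s c k = 0" if k: "k \<in> {1..n}" "q k \<notin> Dr" for k
    proof -
      have "x (q k) * Y (q k) + \<phi> (nx (q k)) - \<phi> (q k) = 0"
        using edges[of "q k"] k qr[of k] by (simp add: nx_def)
      then show ?thesis
        unfolding row_eq c_def \<phi>_spoke[OF qr] \<phi>_spoke[OF rng(1)] pn(1)[OF qr] q_Suc
        using q_pred[of k] k(1) by (simp add: algebra_simps)
    qed
    moreover have "\<exists>k\<in>{1..n}. c k \<noteq> 0"
    proof (rule ccontr)
      assume "\<not> (\<exists>k\<in>{1..n}. c k \<noteq> 0)"
      then have Y0: "Y j = 0" if "j < n" for j using idx[OF that] unfolding c_def by metis
      have Ys: "Y (n + j) = 0" if "j < n" for j using spoke_Y[OF that] Y0 rng that by simp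
      have all: "Y e = 0" if "e < 2 * n" for e using arcs_cases[OF that] Y0 Ys by auto
      have "\<phi> j = \<phi> n" if "j < n" for j using \<phi>_spoke[OF that] Y0 rng that by simp
      moreover have "\<phi> 0 = 0" using Y unfolding network_solution_def by simp
      ultimately have "\<phi> v = 0" if "v \<le> n" for v using n that by (metis le_neq_implies_less less_le_trans pos2)
      then show False using Y all unfolding network_solution_def by auto
    qed
    moreover have "c (k - 1) = c k" if "k \<in> {1..n}" "n + q k \<in> Dc" for k
    proof -
      have "Y (n + q k) = 0" using Y that unfolding network_solution_def by blast
      then show ?thesis using spoke_Y[OF qr, of k] q_pred[of k] that by (simp add: c_def)
    qed
    moreover have "c k = 0" if "q k \<in> Dc" for k
      using Y that unfolding network_solution_def c_def by blast
    moreover have "c 0 = c n" "c (Suc n) = c 1" by (simp_all only: c_def q_n)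
    ultimately show "\<exists>c. cyclic_solution ?a ?s n {k\<in>{1..n}. (p + k) mod n \<notin> Dr} c \<and>
      (\<forall>k\<in>{1..n}. (p + k) mod n \<in> Dc \<longrightarrow> c k = 0) \<and>
      (\<forall>k\<in>{1..n}. n + (p + k) mod n \<in> Dc \<longrightarrow> c (k - 1) = c k)"
      unfolding cyclic_solution_def q_def[symmetric] by (intro exI[of _ c]) auto
  next
    assume "\<exists>c. cyclic_solution ?a ?s n {k\<in>{1..n}. (p + k) mod n \<notin> Dr} c \<and>
      (\<forall>k\<in>{1..n}. (p + k) mod n \<in> Dc \<longrightarrow> c k = 0) \<and>
      (\<forall>k\<in>{1..n}. n + (p + k) mod n \<in> Dc \<longrightarrow> c (k - 1) = c k)"
    then obtain c where c: "cyclic_solution ?a ?s n {k\<in>{1..n}. q k \<notin> Dr} c"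
      and cr: "\<And>k. k \<in> {1..n} \<Longrightarrow> q k \<in> Dc \<Longrightarrow> c k = 0"
      and csp: "\<And>k. k \<in> {1..n} \<Longrightarrow> n + q k \<in> Dc \<Longrightarrow> c (k - 1) = c k"
      unfolding q_def[symmetric] by blast
    have per: "c 0 = c n" "c (Suc n) = c 1" using c unfolding cyclic_solution_def by auto
    define C where "C j = c (idx j)" for j
    have Cq: "C (q k) = c k" if "k \<in> {1..n}" for k using idx_q[OF that] by (simp add: C_def)
    have Cpv: "C (pv (q k)) = c (k - 1)" if k: "k \<in> {1..n}" for k
    proof (cases "k = 1")
      case True
      have "pv (q k) = q n" using q_pred[of k] True q_n(1) by simp
      then show ?thesis using Cq[of n] n per(1) True by simp
    next
      case False
      then have "k - 1 \<in> {1..n}" using k by auto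
      then show ?thesis using q_pred[of k] Cq[of "k - 1"] k by simp
    qed
    have Cnx: "C (nx (q k)) = c (Suc k)" if k: "k \<in> {1..n}" for k
    proof (cases "k = n")
      case True
      have "nx (q k) = q 1" using q_Suc[of k] True q_n(2) by simp
      then show ?thesis using Cq[of 1] n per(2) True by simp
    next
      case False
      then have "Suc k \<in> {1..n}" using k by auto
      then show ?thesis using q_Suc[of k] Cq[of "Suc k"] k by simp
    qed
    define Y where "Y e = (if e < n then C e else C (pv (e - n)) - C (e - n))" for e
    \<comment> \<open>The potential relative to the hub, shifted below so that it is zero at the vertex \<open>0\<close>.\<close>
    define \<psi> where "\<psi> j = x (n + j) * (C (pv j) - C j)" for j
    define \<phi> where "\<phi> v = (if v < n then \<psi> v else 0) - \<psi> 0" for v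
    have "network_solution ?W x Dr Dc 0 Y \<phi>"
      unfolding network_solution_def
    proof (intro conjI ballI)
      show "\<phi> 0 = 0" using n by (simp add: \<phi>_def)
    next
      fix e assume e: "e \<in> Dc"
      then have "e < 2 * n" using Dc by auto
      from arcs_cases[OF this] show "Y e = 0"
      proof (elim disjE exE conjE)
        fix j assume j: "j < n" "e = j"
        then show ?thesis using cr[OF idx(1)[OF j(1)]] idx(2)[OF j(1)] e by (simp add: Y_def C_def)
      next
        fix j assume j: "j < n" "e = n + j"
        then show ?thesis using csp[OF idx(1)[OF j(1)]] Cpv[OF idx(1)[OF j(1)]] idx(2)[OF j(1)] e
          by (simp add: Y_def) (simp add: C_def)
      qed
    next
      obtain k where k: "k \<in> {1..n}" "c k \<noteq> 0" using c unfolding cyclic_solution_def by blast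
      then have "Y (q k) \<noteq> 0" using Cq qr by (simp add: Y_def)
      then show "(\<exists>e\<in>arcs ?W. Y e \<noteq> 0) \<or> (\<exists>v\<in>verts ?W. \<phi> v \<noteq> 0)"
        using qr[of k] by (intro disjI1 bexI[of _ "q k"]) auto
    next
      fix e assume "e \<in> arcs ?W - Dr"
      then have e: "e < 2 * n" "e \<notin> Dr" by auto
      from arcs_cases[OF e(1)] show "x e * Y e + \<phi> (head ?W e) - \<phi> (tail ?W e) = 0"
      proof (elim disjE exE conjE)
        fix j assume j: "j < n" "e = j"
        define k where "k = idx j"
        have k: "k \<in> {1..n}" "q k = j" using idx[OF j(1)] by (simp_all add: k_def)
        have row: "tri_row ?a ?s c k = 0" using c k j e unfolding cyclic_solution_def by auto
        have d: "\<phi> (nx j) - \<phi> j = x (n + nx j) * (C j - C (nx j)) - x (n + j) * (C (pv j) - C j)"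
          using j rng pn(1)[OF j(1)] by (simp add: \<phi>_def \<psi>_def)
        have "x e * Y e + \<phi> (head ?W e) - \<phi> (tail ?W e) = x j * C j + (\<phi> (nx j) - \<phi> j)"
          using j by (simp add: Y_def nx_def)
        also have "\<dots> = tri_row ?a ?s c k"
          using Cq[OF k(1)] Cpv[OF k(1)] Cnx[OF k(1)] unfolding d row_eq k(2) by simp
        finally show ?thesis using row by simp
      next
        fix j assume j: "j < n" "e = n + j"
        then show ?thesis by (simp add: Y_def \<phi>_def \<psi>_def)
      qed
    next
      have rim: "(\<Sum>e\<in>arcs ?W. inc ?W e j * Y e) = 0" if "j < n" for j
        using wheel_rim_flow[OF n that, of Y, folded pv_def] rng that by (simp add: Y_def)
      fix v assume v: "v \<in> verts ?W"
      have "(\<Sum>e\<in>arcs ?W. inc ?W e n * Y e) = 0"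
        by (rule flow_conservation_last[OF wf]) (use rim in auto)
      then show "(\<Sum>e\<in>arcs ?W. inc ?W e v * Y e) = 0"
        using rim v by (cases "v = n") (auto simp del: wheel_simps(2))
    qed
    then show "\<exists>Y \<phi>. network_solution ?W x Dr Dc 0 Y \<phi>" by blast
  qed
qed

section \<open>The zero loci of the wheel polynomials\<close>

lemma loc_subst:
  assumes "loc_closed_pred \<Theta>" "\<And>i. polyfun (\<lambda>x. \<phi> x i)"
  shows "loc_closed_pred (\<lambda>x. \<Theta> (\<phi> x))"
proof -
  obtain F g where F: "finite F" "\<forall>f\<in>F. polyfun f" "polyfun g"
    "\<forall>x. \<Theta> x \<longleftrightarrow> (\<forall>f\<in>F. f x = 0) \<and> g x \<noteq> 0" using assms(1) unfolding loc_closed_pred_def by blast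
  show ?thesis unfolding loc_closed_pred_def
  proof (intro exI conjI)
    show "finite ((\<lambda>f x. f (\<phi> x)) ` F)" using F by simp
    show "\<forall>f\<in>(\<lambda>f x. f (\<phi> x)) ` F. polyfun f" using F(2) polyfun_subst[of _ \<phi>, OF _ assms(2)] by auto
    show "polyfun (\<lambda>x. g (\<phi> x))" by (rule polyfun_subst[OF F(3) assms(2)])
    show "\<forall>x. \<Theta> (\<phi> x) \<longleftrightarrow> (\<forall>f\<in>(\<lambda>f x. f (\<phi> x)) ` F. f x = 0) \<and> g (\<phi> x) \<noteq> 0" using F(4) by simp
  qed
qed

definition chain_coords :: "nat \<Rightarrow> nat \<Rightarrow> nat set \<Rightarrow> (nat \<Rightarrow> 'a::comm_ring_1) \<Rightarrow> nat \<Rightarrow> 'a" where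
  "chain_coords n p E' x i = (if i \<in> E' then (if even i then triangle_at n p x (i div 2) else spoke_at n p x (i div 2)) else 0)"

text \<open>The linear change of coordinates between the edge variables of a wheel and the entries of the tridiagonal
  system, restricted to the edges of \<open>E\<close>. The indices run through a window of length \<open>n\<close>, whose start \<open>w\<close> is \<open>0\<close> for the full wheel
  and \<open>1\<close> for chains. The entries \<open>a\<^sub>k\<close> with \<open>k \<in> Ka\<close> and \<open>s\<^sub>k\<close> with \<open>k \<in> Ks\<close> occur; a spoke outside \<open>E\<close> has the value zero.\<close>

locale wheel_coordinates =
  fixes n p w :: nat and Ka Ks E E' :: "nat set"
  assumes n: "n \<ge> 2" and K: "Ka \<subseteq> {w..<w + n}" "Ks \<subseteq> {w..<w + n}"
    and E: "E = (\<lambda>k. (p + k) mod n) ` Ka \<union> (\<lambda>k. n + (p + k) mod n) ` Ks"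
    and E': "E' = (\<lambda>k. 2 * k) ` Ka \<union> (\<lambda>k. 2 * k + 1) ` Ks"
begin

abbreviation "pos k \<equiv> (p + k) mod n"
abbreviation "coords \<equiv> chain_coords n p E'"

definition wrap :: "nat \<Rightarrow> nat" where "wrap k = (if k = w + n then w else k)"

lemma pos_inj: "inj_on pos {w..<w + n}"
proof (rule inj_onI)
  have *: "j = k" if "j \<le> k" "k < w + n" "w \<le> j" "pos j = pos k" for j k
  proof -
    have "n dvd (p + k) - (p + j)" using that by (intro mod_eq_dvd_iff_nat[THEN iffD1]) auto
    then have "n dvd k - j" by simp
    moreover have "k - j < n" using that by auto
    ultimately show ?thesis using that(1) by (auto dest: dvd_imp_le)
  qed
  fix j k assume "j \<in> {w..<w + n}" "k \<in> {w..<w + n}" "pos j = pos k"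
  then show "j = k" using *[of j k] *[of k j] by (cases "j \<le> k") auto
qed

lemma pos_less: "pos k < n"
  using n by simp

lemma pos_wrap: "pos (wrap k) = pos k"
  by (simp add: wrap_def) (metis add.assoc mod_add_self2)

lemma wrap_window: "k \<in> {w..<w + n} \<Longrightarrow> wrap (Suc k) \<in> {w..<w + n}"
  using n by (auto simp: wrap_def)

lemma rim_in_E: "k \<in> {w..<w + n} \<Longrightarrow> pos k \<in> E \<longleftrightarrow> k \<in> Ka"
proof -
  assume k: "k \<in> {w..<w + n}"
  have "pos k \<noteq> n + pos j" for j using pos_less[of k] by simp
  then have "pos k \<in> E \<longleftrightarrow> pos k \<in> pos ` Ka" unfolding E by auto
  also have "\<dots> \<longleftrightarrow> k \<in> Ka" using inj_on_image_mem_iff[OF pos_inj k K(1)] by blast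
  finally show ?thesis .
qed

lemma spoke_in_E: "k \<in> {w..<w + n} \<Longrightarrow> n + pos k \<in> E \<longleftrightarrow> k \<in> Ks"
proof -
  assume k: "k \<in> {w..<w + n}"
  have "n + pos k \<noteq> pos j" for j using pos_less[of j] by simp
  then have "n + pos k \<in> E \<longleftrightarrow> pos k \<in> pos ` Ks" unfolding E by auto
  also have "\<dots> \<longleftrightarrow> k \<in> Ks" using inj_on_image_mem_iff[OF pos_inj k K(2)] by blast
  finally show ?thesis .
qed

lemma even_in_E': "2 * k \<in> E' \<longleftrightarrow> k \<in> Ka" and odd_in_E': "2 * k + 1 \<in> E' \<longleftrightarrow> k \<in> Ks"
proof -
  have ne: "2 * i \<noteq> 2 * j + 1" for i j :: nat by presburger
  show "2 * k \<in> E' \<longleftrightarrow> k \<in> Ka" unfolding E' using ne by auto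
  show "2 * k + 1 \<in> E' \<longleftrightarrow> k \<in> Ks" unfolding E' using ne[symmetric] by auto
qed

lemma coords_even: "k \<in> Ka \<Longrightarrow> coords x (2 * k) = triangle_at n p x k"
  by (simp add: chain_coords_def even_in_E')

lemma coords_odd:
  assumes "x \<in> affine_points E" "k \<in> {w..<w + n}"
  shows "coords x (2 * k + 1) = spoke_at n p x k"
proof (cases "k \<in> Ks")
  case True
  then have "2 * k + 1 \<in> E'" using odd_in_E' by blast
  then show ?thesis by (simp add: chain_coords_def)
next
  case False
  then have "2 * k + 1 \<notin> E'" "n + pos k \<notin> E" using odd_in_E' spoke_in_E[OF assms(2)] by auto
  then show ?thesis using assms(1) by (simp add: chain_coords_def spoke_at_def affine_points_def)
qed

lemma spoke_at_wrap: "spoke_at n p x (wrap k) = spoke_at n p x k"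
  by (simp only: spoke_at_def pos_wrap)

theorem class_in_chain_coordinates:
  fixes \<Phi> \<Theta> :: "'k::field point \<Rightarrow> bool"
  assumes loc: "loc_closed_pred \<Theta>" and eq: "\<And>x. x \<in> affine_points E \<Longrightarrow> \<Phi> x \<longleftrightarrow> \<Theta> (coords x)"
  shows "cond_class E \<Phi> = cond_class E' \<Theta>"
proof -
  define idx where "idx j = inv_into {w..<w + n} pos j" for j
  have idx: "idx (pos k) = k" if "k \<in> {w..<w + n}" for k
    unfolding idx_def by (rule inv_into_f_f[OF pos_inj that])
  define \<psi> :: "'k point \<Rightarrow> 'k point" where "\<psi> y e = (if e \<in> E then
      (if e < n then y (2 * idx e) - y (2 * idx e + 1) - y (2 * wrap (Suc (idx e)) + 1)
       else y (2 * idx (e - n) + 1)) else 0)" for y e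
  have fin: "finite Ka" "finite Ks" using K finite_subset by blast+
  have finE: "finite E" "finite E'" unfolding E E' using fin by auto
  have poly\<phi>: "polyfun (\<lambda>x. coords x i)" for i
    unfolding chain_coords_def triangle_at_def spoke_at_def by (intro polyfun_intros)
  have poly\<psi>: "polyfun (\<lambda>y. \<psi> y e)" for e
    unfolding \<psi>_def by (intro polyfun_intros)
  have \<psi>_rim: "\<psi> y (pos k) = y (2 * k) - y (2 * k + 1) - y (2 * wrap (Suc k) + 1)" if "k \<in> Ka" for y k
    using that K rim_in_E[of k] idx[of k] pos_less[of k] by (auto simp: \<psi>_def)
  have \<psi>_spoke: "\<psi> y (n + pos k) = y (2 * k + 1)" if "k \<in> {w..<w + n}" "y \<in> affine_points E'" for y k
  proof (cases "k \<in> Ks")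
    case True
    then show ?thesis using that spoke_in_E[of k] idx[of k] by (simp add: \<psi>_def)
  next
    case False
    then have "2 * k + 1 \<notin> E'" "n + pos k \<notin> E" using odd_in_E' spoke_in_E[OF that(1)] by auto
    then show ?thesis using that(2) by (simp add: \<psi>_def affine_points_def)
  qed
  have aff: "coords x \<in> affine_points E'" "\<psi> y \<in> affine_points E" for x y :: "'k point"
    by (auto simp: chain_coords_def \<psi>_def affine_points_def)
  have \<psi>\<phi>: "\<psi> (coords x) = x" if x: "x \<in> affine_points E" for x
  proof
    fix e
    consider k where "k \<in> Ka" "e = pos k" | k where "k \<in> Ks" "e = n + pos k" | "e \<notin> E" unfolding E by auto
    then show "\<psi> (coords x) e = x e"
    proof cases
      case 1
      then have k: "k \<in> {w..<w + n}" using K by auto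
      show ?thesis unfolding 1(2) \<psi>_rim[OF 1(1)] coords_even[OF 1(1)] coords_odd[OF x k]
          coords_odd[OF x wrap_window[OF k]] spoke_at_wrap
        by (simp add: triangle_at_def)
    next
      case 2
      then have k: "k \<in> {w..<w + n}" using K by auto
      show ?thesis unfolding 2(2) \<psi>_spoke[OF k aff(1)] coords_odd[OF x k] by (simp add: spoke_at_def)
    next
      case 3
      then show ?thesis using x by (simp add: \<psi>_def affine_points_def)
    qed
  qed
  have \<phi>\<psi>: "coords (\<psi> y) = y" if y: "y \<in> affine_points E'" for y
  proof
    fix i
    consider k where "k \<in> Ka" "i = 2 * k" | k where "k \<in> Ks" "i = 2 * k + 1" | "i \<notin> E'" unfolding E' by auto
    then show "coords (\<psi> y) i = y i"
    proof cases
      case 1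
      then have k: "k \<in> {w..<w + n}" using K by auto
      have "spoke_at n p (\<psi> y) k = y (2 * k + 1)"
        "spoke_at n p (\<psi> y) (Suc k) = y (2 * wrap (Suc k) + 1)"
        using \<psi>_spoke[OF k y] \<psi>_spoke[OF wrap_window[OF k] y] pos_wrap[of "Suc k"]
        by (simp_all only: spoke_at_def)
      then show ?thesis unfolding 1(2) coords_even[OF 1(1)] by (simp add: triangle_at_def \<psi>_rim[OF 1(1)])
    next
      case 2
      then have k: "k \<in> {w..<w + n}" using K by auto
      show ?thesis unfolding 2(2) coords_odd[OF aff(2) k] spoke_at_def by (rule \<psi>_spoke[OF k y])
    next
      case 3
      then show ?thesis using y by (simp add: chain_coords_def affine_points_def)
    qed
  qed
  have "cond_class E \<Phi> = cond_class E (\<lambda>x. \<Theta> (coords x))"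
    by (rule cond_class_cong) (rule eq)
  also have "\<dots> = cond_class E' \<Theta>"
    by (rule cond_class_isomorphic[where \<phi> = coords and \<psi> = \<psi>, OF finE loc_subst[OF loc poly\<phi>] loc])
       (use aff \<psi>\<phi> \<phi>\<psi> ratfun_polyfun[OF poly\<phi>] ratfun_polyfun[OF poly\<psi>] in auto)
  finally show ?thesis .
qed

end

subsection \<open>Reduction to cyclic systems\<close>

lemma tree_sum_cong: "(\<And>e. e \<in> arcs G \<Longrightarrow> x e = y e) \<Longrightarrow> tree_sum G x = tree_sum G y"
  unfolding tree_sum_def by (intro sum.cong prod.cong) auto

text \<open>Contraction sets a variable to zero; this includes the zero graph, because contracting one edge may turn another one
  into a loop.\<close>

lemma tree_sum_contract:
  assumes wf: "wf_graph G" and e: "e \<in> arcs G \<or> G = zero_graph"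
  shows "tree_sum (contract G e) x = tree_sum G (x(e := 0))"
proof (cases "G = zero_graph")
  case True
  have "contract zero_graph e = zero_graph" by (simp add: contract_def zero_graph_def)
  then show ?thesis using True by simp
next
  case False
  then have "tree_sum G (x(e := 0)) = tree_sum (contract G e) (x(e := 0))"
    using tree_sum_deletion_contraction[OF wf, of e "x(e := 0)"] e by simp
  also have "\<dots> = tree_sum (contract G e) x"
    by (rule tree_sum_cong)
       (cases "tail G e = head G e"; auto simp: contract_simps; simp add: contract_def zero_graph_def)
  finally show ?thesis by simp
qed

lemma arcs_contract: "f \<in> arcs G \<Longrightarrow> f \<noteq> e \<Longrightarrow> f \<in> arcs (contract G e) \<or> contract G e = zero_graph"
  by (cases "tail G e = head G e") (simp_all add: contract_simps, simp add: contract_def)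

lemma contract_zero_graph: "contract zero_graph e = zero_graph"
  by (simp add: contract_def zero_graph_def)

lemma tree_sum_same_graph:
  assumes "wf_graph G" "wf_graph H" "verts G = verts H" "arcs G = arcs H"
    and "\<And>e. e \<in> arcs G \<Longrightarrow> tail G e = tail H e \<and> head G e = head H e"
  shows "tree_sum G x = tree_sum H x"
proof -
  have ends: "ends G T = ends H T" if "T \<subseteq> arcs G" for T
    unfolding ends_def using assms(5) that by (intro SUP_cong) auto
  have "T \<in> spanning_trees G \<longleftrightarrow> T \<in> spanning_trees H" for T
  proof (cases "T \<subseteq> arcs G")
    case True
    have "ends G (T - {e}) = ends H (T - {e})" for e by (rule ends) (use True in blast)
    moreover have "ends G T = ends H T" by (rule ends[OF True])
    ultimately show ?thesis unfolding spanning_trees_iff[OF assms(1)] spanning_trees_iff[OF assms(2)]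
      using assms(3,4,5) True by (auto simp: subset_iff)
  qed (use assms(4) in \<open>simp add: spanning_trees_def\<close>)
  then have "spanning_trees G = spanning_trees H" by blast
  then show ?thesis by (simp add: tree_sum_def assms(4))
qed

lemma wheel_tree_sum_zero_iff:
  fixes x :: "'k::field point"
  assumes n: "n \<ge> 2" and p: "p < n"
  shows "tree_sum (wheel n) x = 0 \<longleftrightarrow>
    (\<exists>c. cyclic_solution (triangle_at n p x) (spoke_at n p x) n {1..n} c)"
proof -
  have wf: "wf_graph (wheel n)" using n by (intro wf_wheel) simp
  obtain xs where xs: "distinct xs" "set xs = Inl ` arcs (wheel n) \<union> Inr ` (verts (wheel n) - {0})"
    using distinct_list_of_set[of "Inl ` arcs (wheel n) \<union> Inr ` (verts (wheel n) - {0})"] by auto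
  have "tree_sum (wheel n) x = det (label_mat (graph_entry (wheel n) x) xs xs)"
    by (rule matrix_tree[OF wf _ xs]) simp
  moreover have S: "{k\<in>{1..n}. (p + k) mod n \<notin> {}} = {1..n}" by auto
  ultimately show ?thesis
    using graph_minor_zero_iff[OF wf, of 0 "{}" xs "{}" xs x] xs
      network_solution_wheel_iff[OF n p, of "{}" "{}" x, unfolded S] by simp
qed

lemma continuant_coords:
  fixes x :: "'k::field point"
  assumes "\<And>k. j \<le> k \<Longrightarrow> k + 1 < j + l \<Longrightarrow> y (2 * k) = a k" "\<And>k. j < k \<Longrightarrow> k + 1 < j + l \<Longrightarrow> y (2 * k + 1) = s k"
  shows "kont j l y = continuant a s j l"
  unfolding kont_def by (rule continuant_cong) (use assms in auto)

lemma spoke_at_period: "spoke_at n p x (n + k) = spoke_at n p x k"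
  by (simp add: spoke_at_def) (metis add.left_commute mod_add_self1)

lemma triangle_at_period: "triangle_at n p x (n + k) = triangle_at n p x k"
proof -
  have "(p + (n + k)) mod n = (p + k) mod n" by (metis add.left_commute mod_add_self1)
  then show ?thesis using spoke_at_period[of n p x k] spoke_at_period[of n p x "Suc k"]
    by (simp add: triangle_at_def)
qed

lemma graph_class_eq_cond_class:
  "wf_graph G \<Longrightarrow> graph_class G = cond_class (arcs G) (\<lambda>x :: 'k::field point. tree_sum G x = 0)"
  by (simp add: graph_class_def locus_class_eq_set_class zero_set_def mp_eval_graph_poly)

lemma wheel_class:
  assumes m: "m \<ge> 1"
  shows "graph_class (wheel (Suc m)) =
    (lefschetz :: 'k::field K0) ^ (2 * m + 1) + lefschetz * lefschetz * (lefschetz - 1) * cls_e m"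
proof -
  let ?n = "Suc m" and ?E' = "insert 0 (insert 1 (insert 3 (chain_vars m)))"
  have arcs: "{..<2 * ?n} = (\<lambda>k. (0 + k) mod ?n) ` {..<?n} \<union> (\<lambda>k. ?n + (0 + k) mod ?n) ` {..<?n}"
  proof -
    have "e \<in> (\<lambda>k. ?n + (0 + k) mod ?n) ` {..<?n}" if "e < 2 * ?n" "\<not> e < ?n" for e
      using that by (intro image_eqI[of _ _ "e - ?n"]) auto
    moreover have "e \<in> (\<lambda>k. (0 + k) mod ?n) ` {..<?n}" if "e < ?n" for e
      using that by (intro image_eqI[of _ _ e]) auto
    ultimately show ?thesis by (auto intro: less_trans[OF mod_less_divisor])
  qed
  have E': "?E' = (\<lambda>k. 2 * k) ` {..<?n} \<union> (\<lambda>k. 2 * k + 1) ` {..<?n}"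
  proof -
    have eq1: "{..<?n} = insert 0 {1..m}" by auto
    have eq2: "{..<?n} = insert 0 (insert 1 {2..m})" using m by auto
    have "(\<lambda>k. 2 * k) ` {..<?n} = insert 0 ((\<lambda>k. 2 * k) ` {1..m})"
      by (simp only: eq1 image_insert mult_0_right)
    moreover have "(\<lambda>k. 2 * k + 1) ` {..<?n} = insert 1 (insert 3 ((\<lambda>k. 2 * k + 1) ` {2..m}))"
      by (simp only: eq2 image_insert) simp
    ultimately show ?thesis unfolding chain_vars_def by auto
  qed
  interpret wheel_coordinates ?n 0 0 "{..<?n}" "{..<?n}" "{..<2 * ?n}" ?E'
    by unfold_locales (use m arcs E' in auto)
  let ?pr = "\<lambda>x :: 'k point. \<Prod>i=2..<Suc m. x (2 * i + 1)"
  let ?\<Theta> = "\<lambda>x :: 'k point. kont 1 (Suc m) x * x 0 =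
        (x 3)\<^sup>2 * kont 2 m x + (x 1)\<^sup>2 * kont 1 m x + (x 1 * x 3 * ?pr x + x 1 * x 3 * ?pr x)"
  have "graph_class (wheel ?n) = cond_class {..<2 * ?n} (\<lambda>x :: 'k point. tree_sum (wheel ?n) x = 0)"
    using graph_class_eq_cond_class[OF wf_wheel[of ?n]] by simp
  also have "\<dots> = cond_class ?E' ?\<Theta>"
  proof (rule class_in_chain_coordinates)
    show "loc_closed_pred ?\<Theta>" by (intro loc_intros polyfun_intros)
    fix x :: "'k point" assume x: "x \<in> affine_points {..<2 * ?n}"
    let ?a = "triangle_at ?n 0 x" and ?s = "spoke_at ?n 0 x"
    have odd: "coords x (2 * k + 1) = ?s k" if "k < ?n" for k using coords_odd[OF x] that by simp
    have c: "coords x 0 = ?a ?n" "coords x 1 = ?s ?n" "coords x 3 = ?s 1"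
      using coords_even[of 0 x] odd[of 0] odd[of 1] m
        triangle_at_period[of ?n 0 x 0] spoke_at_period[of ?n 0 x 0] by (simp_all del: mod_Suc_eq)
    have k: "kont j l (coords x) = continuant ?a ?s j l" if "j + l \<le> Suc ?n" for j l
    proof (rule continuant_coords)
      fix k assume "k + 1 < j + l"
      then have "k < ?n" using that by linarith
      then show "coords x (2 * k) = ?a k" "coords x (2 * k + 1) = ?s k"
        using coords_even[of k x] odd[of k] by simp_all
    qed
    have p: "?pr (coords x) = (\<Prod>i=2..<Suc m. ?s i)"
      by (rule prod.cong) (use odd in auto)
    have per: "?s (Suc ?n) = ?s 1" using spoke_at_period[of ?n 0 x 1] by simp
    show "tree_sum (wheel ?n) x = 0 \<longleftrightarrow> ?\<Theta> (coords x)"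
      unfolding c p k[of 1 "Suc m", simplified] k[of 2 m, simplified] k[of 1 m, simplified]
      using wheel_tree_sum_zero_iff[of ?n 0 x] cyclic_singular_iff[of m ?s ?a, OF m per] m k
      by simp
  qed
  also have "\<dots> = (lefschetz :: 'k K0) ^ (2 * m + 1) + lefschetz * lefschetz * (lefschetz - 1) * cls_e m"
    by (rule periodic_class[OF m])
  finally show ?thesis .
qed

lemma contracted_wheel_class:
  assumes n: "n \<ge> 2"
  shows "graph_class (contracted_wheel n) = (cls_b n :: 'k::field K0)"
proof -
  let ?B = "contracted_wheel n"
  have wfW: "wf_graph (wheel n)" using n by (intro wf_wheel) simp
  have arcsB: "arcs ?B = {..<2 * n} - {n}" by (simp add: contracted_wheel_def)
  have n1: "n \<ge> 1" using n by simp
  have wfB: "wf_graph ?B" using n by (auto simp: wf_graph_def contracted_wheel_def)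
  have val: "tree_sum ?B x = tree_sum (wheel n) x" if "x \<in> affine_points ({..<2 * n} - {n})" for x :: "'k point"
  proof -
    have "tree_sum ?B x = tree_sum (contract (wheel n) n) x"
      by (rule tree_sum_same_graph[OF wfB wf_contract[OF wfW]])
         (use contracted_wheel_eq_contract[OF n1] in auto)
    also have "\<dots> = tree_sum (wheel n) (x(n := 0))"
      by (rule tree_sum_contract[OF wfW]) (use n in simp)
    also have "x(n := 0) = x" using that by (auto simp: affine_points_def)
    finally show ?thesis .
  qed
  have pos: "(n - 1 + k) mod n = k - 1" if "k \<in> {1..n}" for k
  proof -
    have "n - 1 + k = (k - 1) + n" using that n by auto
    then have "(n - 1 + k) mod n = (k - 1) mod n" by (simp only: mod_add_self2)
    also have "\<dots> = k - 1" by (rule mod_less) (use that in auto)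
    finally show ?thesis .
  qed
  have arcs: "{..<2 * n} - {n} = (\<lambda>k. (n - 1 + k) mod n) ` {1..n} \<union> (\<lambda>k. n + (n - 1 + k) mod n) ` {2..n}"
  proof -
    have "(\<lambda>k. (n - 1 + k) mod n) ` {1..n} = (\<lambda>k. k - 1) ` {1..n}"
      by (rule image_cong) (use pos in auto)
    also have "\<dots> = {..<n}"
    proof -
      have "j \<in> (\<lambda>k. k - 1) ` {1..n}" if "j < n" for j using that by (intro image_eqI[of _ _ "Suc j"]) auto
      then show ?thesis by auto
    qed
    finally have 1: "(\<lambda>k. (n - 1 + k) mod n) ` {1..n} = {..<n}" .
    have "(\<lambda>k. n + (n - 1 + k) mod n) ` {2..n} = (\<lambda>k. n + (k - 1)) ` {2..n}"
      by (rule image_cong) (use pos in auto)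
    also have "\<dots> = {n<..<2 * n}"
    proof -
      have "j \<in> (\<lambda>k. n + (k - 1)) ` {2..n}" if "n < j" "j < 2 * n" for j
        using that by (intro image_eqI[of _ _ "Suc j - n"]) auto
      then show ?thesis by auto
    qed
    finally have 2: "(\<lambda>k. n + (n - 1 + k) mod n) ` {2..n} = {n<..<2 * n}" .
    show ?thesis unfolding 1 2 using n by auto
  qed
  interpret wheel_coordinates n "n - 1" 1 "{1..n}" "{2..n}" "{..<2 * n} - {n}" "chain_vars n"
    by unfold_locales (use n arcs in \<open>auto simp: chain_vars_def\<close>)
  have "graph_class ?B = cond_class ({..<2 * n} - {n}) (\<lambda>x :: 'k point. tree_sum ?B x = 0)"
    using graph_class_eq_cond_class[OF wfB] arcsB by simp
  also have "\<dots> = cls_b n"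
    unfolding cls_b_def
  proof (rule class_in_chain_coordinates)
    show "loc_closed_pred (\<lambda>x :: 'k point. kont 1 (Suc n) x = 0)" by (intro loc_intros polyfun_intros)
    fix x :: "'k point" assume x: "x \<in> affine_points ({..<2 * n} - {n})"
    let ?a = "triangle_at n (n - 1) x" and ?s = "spoke_at n (n - 1) x"
    have k: "kont 1 (Suc n) (coords x) = continuant ?a ?s 1 (Suc n)"
      by (rule continuant_coords) (use coords_even[of _ x] coords_odd[OF x] in auto)
    have cut: "?s 1 = 0" using x pos[of 1] n by (simp add: spoke_at_def affine_points_def)
    moreover have "?s (Suc n) = ?s 1" using spoke_at_period[of n "n - 1" x 1] by simp
    ultimately show "tree_sum ?B x = 0 \<longleftrightarrow> kont 1 (Suc n) (coords x) = 0"
      unfolding k val[OF x] using wheel_tree_sum_zero_iff[OF n, of "n - 1" x] cut_cycle_singular_iff[OF n1, of ?s ?a] n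
      by simp
  qed
  finally show ?thesis .
qed

lemma locus_class_eq_cond_class: "locus_class E F = cond_class E (\<lambda>x. \<forall>f\<in>F. mp_eval f x = 0)"
  by (simp add: locus_class_eq_set_class zero_set_def)

lemma chain_solution_cong:
  "(\<And>c. bc c \<longleftrightarrow> bc' c) \<Longrightarrow> chain_solution a s m bc \<longleftrightarrow> chain_solution a s m bc'"
  unfolding chain_solution_def by simp

text \<open>At the vertex between the places \<open>m + 1\<close> and \<open>m + 2\<close> all three edge variables are zero, as they are not coordinates
  of the locus. The diagonal entries at these two places are then the couplings to the chain, and the two rows become
  differences of neighbouring unknowns.\<close>

lemma cyclic_iff_chain_solution:
  fixes a s :: "nat \<Rightarrow> 'a::comm_ring_1"
  assumes R: "{1..m} \<subseteq> R" "R \<subseteq> {1..m + 2}"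
    and s: "s (m + 2) = 0" "s (Suc (m + 2)) = s 1" and a: "a (m + 2) = s 1" "a (Suc m) = s (Suc m)"
    and local: "\<And>c c'. (\<forall>k\<le>Suc m. c k = c' k) \<Longrightarrow> D c \<longleftrightarrow> D c'"
    and D: "\<And>c. c 0 = c (m + 2) \<Longrightarrow> D' c \<longleftrightarrow> D c"
  shows "(\<exists>c. cyclic_solution a s (m + 2) R c \<and> D' c) \<longleftrightarrow>
    chain_solution a s m (\<lambda>c. (m + 2 \<in> R \<longrightarrow> s 1 * (c 0 - c 1) = 0) \<and>
      (Suc m \<in> R \<longrightarrow> s (Suc m) * (c (Suc m) - c m) = 0) \<and> D c)"
proof -
  have rows: "(\<forall>k\<in>R. tri_row a s c k = 0) \<longleftrightarrow> (\<forall>k\<in>{1..m}. tri_row a s c k = 0) \<and>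
      (m + 2 \<in> R \<longrightarrow> s 1 * (c 0 - c 1) = 0) \<and> (Suc m \<in> R \<longrightarrow> s (Suc m) * (c (Suc m) - c m) = 0)"
    if "c 0 = c (m + 2)" "c (Suc (m + 2)) = c 1" for c
  proof -
    have "tri_row a s c (m + 2) = s 1 * (c 0 - c 1)" "tri_row a s c (Suc m) = s (Suc m) * (c (Suc m) - c m)"
      using that s a by (simp_all add: tri_row_def algebra_simps)
    moreover have "k \<in> {1..m} \<or> k = m + 2 \<or> k = Suc m" if "k \<in> R" for k using R(2) that by fastforce
    ultimately show ?thesis using R(1) by (metis subsetD)
  qed
  show ?thesis
  proof
    assume "\<exists>c. cyclic_solution a s (m + 2) R c \<and> D' c"
    then obtain c where c: "cyclic_solution a s (m + 2) R c" "D' c" by blast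
    have per: "c 0 = c (m + 2)" "c (Suc (m + 2)) = c 1" using c(1) unfolding cyclic_solution_def by auto
    have "\<exists>k\<le>Suc m. c k \<noteq> 0"
    proof -
      obtain k where k: "k \<in> {1..m + 2}" "c k \<noteq> 0" using c(1) unfolding cyclic_solution_def by blast
      show ?thesis
      proof (cases "k = m + 2")
        case True
        then show ?thesis using k per by (intro exI[of _ 0]) auto
      next
        case False
        then show ?thesis using k by (intro exI[of _ k]) auto
      qed
    qed
    then show "chain_solution a s m (\<lambda>c. (m + 2 \<in> R \<longrightarrow> s 1 * (c 0 - c 1) = 0) \<and>
        (Suc m \<in> R \<longrightarrow> s (Suc m) * (c (Suc m) - c m) = 0) \<and> D c)"
      using c rows[OF per] D[OF per(1)] unfolding chain_solution_def cyclic_solution_def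
      by (intro exI[of _ c]) blast
  next
    assume "chain_solution a s m (\<lambda>c. (m + 2 \<in> R \<longrightarrow> s 1 * (c 0 - c 1) = 0) \<and>
        (Suc m \<in> R \<longrightarrow> s (Suc m) * (c (Suc m) - c m) = 0) \<and> D c)"
    then obtain u where u: "\<exists>k\<le>Suc m. u k \<noteq> 0" "\<forall>k\<in>{1..m}. tri_row a s u k = 0"
      "m + 2 \<in> R \<longrightarrow> s 1 * (u 0 - u 1) = 0" "Suc m \<in> R \<longrightarrow> s (Suc m) * (u (Suc m) - u m) = 0" "D u"
      unfolding chain_solution_def by blast
    define c where "c = u(m + 2 := u 0, Suc (m + 2) := u 1)"
    have cu: "c k = u k" if "k \<le> Suc m" for k using that by (simp add: c_def)
    have per: "c 0 = c (m + 2)" "c (Suc (m + 2)) = c 1" by (simp_all add: c_def)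
    have "tri_row a s c k = tri_row a s u k" if "k \<in> {1..m}" for k
      by (rule tri_row_cong) (use that cu in auto)
    then have "\<forall>k\<in>R. tri_row a s c k = 0" unfolding rows[OF per] using u(2,3,4) cu by simp
    moreover have "\<exists>k\<in>{1..m + 2}. c k \<noteq> 0"
    proof -
      obtain k where k: "k \<le> Suc m" "u k \<noteq> 0" using u(1) by blast
      show ?thesis
      proof (cases "k = 0")
        case True
        then show ?thesis using k by (intro bexI[of _ "m + 2"]) (auto simp: c_def)
      next
        case False
        then show ?thesis using k cu by (intro bexI[of _ k]) auto
      qed
    qed
    moreover have "D c" using u(5) local[of c u] cu by simp
    ultimately show "\<exists>c. cyclic_solution a s (m + 2) R c \<and> D' c"
      using per D[OF per(1)] unfolding cyclic_solution_def by (intro exI[of _ c]) blast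
  qed
qed

lemma comm_ring_hom_mp_eval: "comm_ring_hom (\<lambda>p :: 'k::field mpoly. mp_eval p x)"
  by unfold_locales simp_all

lemma graph_matrix_labels_wheel:
  "graph_matrix_labels (wheel n) = map Inl [0..<2 * n] @ map Inr [1..<Suc n]"
proof -
  have "sorted_list_of_set {..<2 * n} = [0..<2 * n]" by (simp add: lessThan_atLeast0)
  moreover have "sorted_list_of_set {..n} = [0..<Suc n]"
    by (simp only: atLeast0AtMost[symmetric] atLeastLessThanSuc_atLeastAtMost[symmetric] sorted_list_of_set_range)
  moreover have "tl [0..<Suc n] = [1..<Suc n]" by (simp add: upt_rec)
  ultimately show ?thesis by (simp add: graph_matrix_labels_def del: upt_Suc)
qed

lemma dodgson_wheel_zero_iff:
  fixes x :: "'k::field point"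
  assumes n: "n \<ge> 1" and ij: "i < 2 * n" "j < 2 * n" and l: "x l = 0"
  shows "mp_eval (dodgson (wheel n) i j l) x = 0 \<longleftrightarrow>
    (\<exists>Y \<phi>. network_solution (wheel n) x {i} {j} 0 Y \<phi>)"
proof -
  let ?W = "wheel n"
  define ls where "ls = graph_matrix_labels ?W"
  have d: "distinct ls" unfolding ls_def graph_matrix_labels_wheel
    by (auto simp: distinct_map inj_on_def simp del: upt_Suc)
  have set: "set ls = Inl ` arcs ?W \<union> Inr ` (verts ?W - {0})"
    unfolding ls_def graph_matrix_labels_wheel by (auto simp del: upt_Suc)
  have mem: "Inl i \<in> set ls" "Inl j \<in> set ls" using ij unfolding set by auto
  let ?R = "remove1 (Inl i) ls" and ?C = "remove1 (Inl j) ls"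
  have R: "set ?R = Inl ` (arcs ?W - {i}) \<union> Inr ` (verts ?W - {0})"
    and C: "set ?C = Inl ` (arcs ?W - {j}) \<union> Inr ` (verts ?W - {0})"
    unfolding set_remove1_eq[OF d] set by auto
  have len: "length ?R = length ?C" using mem by (simp add: length_remove1)
  interpret comm_ring_hom "\<lambda>p :: 'k mpoly. mp_eval p x" by (rule comm_ring_hom_mp_eval)
  have "mp_eval (dodgson ?W i j l) x = det (map_mat (\<lambda>p. mp_eval p x)
      (mat (length ?R) (length ?C) (\<lambda>(r, c). graph_matrix_entry ?W (mvar(l := 0)) (?R ! r) (?C ! c))))"
    unfolding dodgson_def Let_def ls_def[symmetric] by (rule hom_det[symmetric])
  also have "map_mat (\<lambda>p. mp_eval p x)
      (mat (length ?R) (length ?C) (\<lambda>(r, c). graph_matrix_entry ?W (mvar(l := 0)) (?R ! r) (?C ! c))) =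
      label_mat (graph_entry ?W x) ?R ?C"
  proof -
    have "(\<lambda>e. mp_eval ((mvar(l := 0)) e) x) = x" using l by (auto simp: fun_eq_iff)
    then show ?thesis unfolding label_mat_def
      by (intro eq_matI) (simp_all add: mp_eval_graph_matrix_entry)
  qed
  finally show ?thesis
    using graph_minor_zero_iff[OF wf_wheel[OF n] _ _ R _ C len, of x] ij distinct_remove1[OF d]
    by simp
qed

lemma incident_edges_wheel:
  assumes n: "n \<ge> 3" and p: "p < n"
  shows "incident_edges (wheel n) p = {(p + n - 1) mod n, p, n + p}"
proof -
  have A: "tail (wheel n) e = p \<or> head (wheel n) e = p \<longleftrightarrow> e = (p + n - 1) mod n \<or> e = p \<or> e = n + p"
    if "e < 2 * n" for e
  proof (cases "e < n")
    case True
    then have "(e + 1) mod n = p \<longleftrightarrow> e = (p + n - 1) mod n"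
      using p by (cases "e + 1 = n"; cases "p = 0") (auto simp: mod_if)
    then show ?thesis using True by auto
  next
    case False
    have "(p + n - 1) mod n < n" using n by simp
    then show ?thesis using False p by auto
  qed
  have B: "(p + n - 1) mod n < 2 * n" using mod_less_divisor[of n "p + n - 1"] n by linarith
  show ?thesis
  proof (rule Set.set_eqI)
    fix e
    have "e \<in> incident_edges (wheel n) p \<longleftrightarrow> e < 2 * n \<and> (tail (wheel n) e = p \<or> head (wheel n) e = p)"
      by (simp add: incident_edges_def del: wheel_simps(3,4))
    also have "\<dots> \<longleftrightarrow> e < 2 * n \<and> (e = (p + n - 1) mod n \<or> e = p \<or> e = n + p)" using A by blast
    also have "\<dots> \<longleftrightarrow> e = (p + n - 1) mod n \<or> e = p \<or> e = n + p" using B p by linarith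
    finally show "e \<in> incident_edges (wheel n) p \<longleftrightarrow> e \<in> {(p + n - 1) mod n, p, n + p}" by simp
  qed
qed

lemma graph_entry_delete: "graph_entry (delete G e) x = graph_entry G x"
proof (intro ext)
  fix r c show "graph_entry (delete G e) x r c = graph_entry G x r c"
    by (cases r; cases c) (simp_all add: inc_def)
qed

lemma pos_bij:
  fixes p n :: nat
  assumes "p < n"
  shows "bij_betw (\<lambda>k. (p + k) mod n) {1..n} {..<n}"
  by (rule bij_betw_byWitness[where f' = "\<lambda>j. if j > p then j - p else j + n - p"])
     (use assms in \<open>auto simp: mod_if\<close>)

text \<open>The edges at \<open>p\<close> are the rim edges \<open>X\<close> and \<open>p\<close> and the spoke \<open>Z\<close>. As the points of the locus have the value zero at
  these edges, deletion and contraction only decide which unknowns and equations are present: each of the five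
  polynomials is a minor of the matrix of the wheel at the same point \<open>x\<close>.\<close>

lemma vertex_class_wheel:
  fixes m p :: nat
  assumes m: "m \<ge> 1" and p: "p < m + 2"
  shows "vertex_class (wheel (m + 2)) p = (cls_b m + (lefschetz - 1) * cls_c m +
    (lefschetz - 1) * (cls_c m + (lefschetz - 1) * cls_d m) :: 'k::field K0)"
proof -
  define n where "n = m + 2"
  have n: "n \<ge> 3" "n \<ge> 2" "n \<ge> 1" "p < n" using m p by (auto simp: n_def)
  let ?W = "wheel n"
  have wf: "wf_graph ?W" using n by (intro wf_wheel) simp
  define X where "X = (p + n - 1) mod n"
  define Z where "Z = n + p"
  have X: "X < n" "X \<noteq> p" using n by (cases "p = 0"; auto simp: X_def mod_if)+
  define pos where "pos k = (p + k) mod n" for k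
  have bij: "bij_betw pos {1..n} {..<n}" unfolding pos_def by (rule pos_bij[OF n(4)])
  have inj: "inj_on pos {1..n}" and img: "pos ` {1..n} = {..<n}" using bij by (auto simp: bij_betw_def)
  have posX: "pos (Suc m) = X" by (simp add: pos_def X_def n_def)
  have posY: "pos (m + 2) = p" using n unfolding pos_def n_def[symmetric] by simp
  have pos_lt: "pos k < n" for k using n by (simp add: pos_def)
  have isX: "pos k = X \<longleftrightarrow> k = Suc m" and isY: "pos k = p \<longleftrightarrow> k = m + 2" if "k \<in> {1..n}" for k
    using inj_on_eq_iff[OF inj that, of "Suc m"] inj_on_eq_iff[OF inj that, of "m + 2"] posX posY
    by (auto simp: n_def)
  obtain e1 e2 where e12: "e1 < e2" "e2 < n" "{e1, e2} = {X, p}"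
    and cases: "e1 = X \<and> e2 = p \<or> e1 = p \<and> e2 = X"
  proof (cases "X < p")
    case True
    then show ?thesis using that[of X p] n by auto
  next
    case False
    then show ?thesis using that[of p X] X by auto
  qed
  have es: "sorted_list_of_set (incident_edges ?W p) = [e1, e2, Z]"
  proof -
    have "incident_edges ?W p = set [e1, e2, Z]"
      using e12(3) by (auto simp: incident_edges_wheel[OF n(1,4)] X_def Z_def)
    moreover have "sorted_list_of_set (set [e1, e2, Z]) = [e1, e2, Z]"
      by (rule sorted_list_of_set.idem_if_sorted_distinct) (use e12 in \<open>auto simp: Z_def\<close>)
    ultimately show ?thesis by (simp only:)
  qed
  define E where "E = {..<2 * n} - {e1, e2, Z}"
  have E_eq: "E = (\<lambda>k. (p + k) mod n) ` {1..m} \<union> (\<lambda>k. n + (p + k) mod n) ` {1..Suc m}"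
  proof -
    have "pos ` {1..m} = pos ` ({1..n} - {Suc m, m + 2})"
      by (rule arg_cong[of _ _ "image pos"]) (auto simp: n_def)
    also have "\<dots> = {..<n} - {X, p}"
      using inj_on_image_set_diff[OF inj, of "{1..n}" "{Suc m, m + 2}"]
      by (simp only: img image_insert image_empty posX posY) (simp add: n_def)
    finally have 1: "pos ` {1..m} = {..<n} - {X, p}" .
    have "pos ` {1..Suc m} = pos ` ({1..n} - {m + 2})"
      by (rule arg_cong[of _ _ "image pos"]) (auto simp: n_def)
    also have "\<dots> = {..<n} - {p}"
      using inj_on_image_set_diff[OF inj, of "{1..n}" "{m + 2}"]
      by (simp only: img image_insert image_empty posY) (simp add: n_def)
    finally have 2: "(\<lambda>k. n + pos k) ` {1..Suc m} = (\<lambda>j. n + j) ` ({..<n} - {p})"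
      by (simp only: image_image[symmetric, of "\<lambda>j. n + j" pos])
    have "(\<lambda>j. n + j) ` ({..<n} - {p}) = {n..<2 * n} - {Z}"
    proof (intro equalityI subsetI)
      fix e assume "e \<in> {n..<2 * n} - {Z}"
      then show "e \<in> (\<lambda>j. n + j) ` ({..<n} - {p})"
        by (intro image_eqI[of _ _ "e - n"]) (auto simp: Z_def)
    qed (auto simp: Z_def)
    then show ?thesis
      unfolding E_def pos_def[symmetric] 1 2 using e12 X by (auto simp: Z_def)
  qed
  let ?E' = "insert 3 (insert (2 * Suc m + 1) (chain_vars m))"
  have E'_eq: "?E' = (\<lambda>k. 2 * k) ` {1..m} \<union> (\<lambda>k. 2 * k + 1) ` {1..Suc m}"
  proof -
    have eq: "{1..Suc m} = insert 1 (insert (Suc m) {2..m})" using m by auto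
    have "(\<lambda>k. 2 * k + 1) ` {1..Suc m} = insert 3 (insert (2 * Suc m + 1) ((\<lambda>k. 2 * k + 1) ` {2..m}))"
      by (simp only: eq image_insert) simp
    then show ?thesis unfolding chain_vars_def by auto
  qed
  interpret WC: wheel_coordinates n p 1 "{1..m}" "{1..Suc m}" E ?E'
    by unfold_locales (use n E_eq E'_eq in \<open>auto simp: n_def\<close>)
  let ?f0 = "graph_poly (contract (delete (delete ?W e1) e2) Z) :: 'k mpoly"
  let ?f123 = "graph_poly (contract (contract (contract ?W e1) e2) Z) :: 'k mpoly"
  let ?F = "{?f0, dodgson ?W e2 Z e1, dodgson ?W e1 Z e2, dodgson ?W e1 e2 Z, ?f123}"
  let ?\<Theta> = "\<lambda>x :: 'k point. (kont 1 (Suc m) x = 0 \<and> x 3 * kont 2 m x = 0) \<and>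
        x (2 * Suc m + 1) * kont 1 m x = 0 \<and> x 3 * x (2 * Suc m + 1) * kont 2 (m - 1) x = 0"
  have "vertex_class ?W p = locus_class E ?F"
    unfolding vertex_class_def es by (simp add: Let_def E_def insert_commute)
  also have "\<dots> = cond_class E (\<lambda>x. \<forall>f\<in>?F. mp_eval f x = 0)" by (rule locus_class_eq_cond_class)
  also have "\<dots> = cond_class ?E' ?\<Theta>"
  proof (rule WC.class_in_chain_coordinates)
    show "loc_closed_pred ?\<Theta>" by (intro loc_intros polyfun_intros)
    fix x :: "'k point" assume x: "x \<in> affine_points E"
    then have x0: "x e1 = 0" "x e2 = 0" "x Z = 0" "x X = 0" "x p = 0"
      using cases by (auto simp: affine_points_def E_def)
    have upd: "x(e1 := 0) = x" "x(e2 := 0) = x" "x(Z := 0) = x" using x0 by auto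
    let ?a = "triangle_at n p x" and ?s = "spoke_at n p x"
    have s: "?s (m + 2) = 0" "?s (Suc (m + 2)) = ?s 1"
      using x0 posY spoke_at_period[of n p x 1] by (simp_all add: spoke_at_def pos_def Z_def n_def)
    have a: "?a (m + 2) = ?s 1" "?a (Suc m) = ?s (Suc m)"
      using x0 posX posY s by (simp_all add: triangle_at_def pos_def)
    define bs where "bs = (if e1 = X then (\<lambda>c :: nat \<Rightarrow> 'k alg_closure. c 0 = 0 \<and> ?s 1 * c 1 = 0)
      else (\<lambda>c. c (Suc m) = 0 \<and> ?s (Suc m) * c m = 0))"
    have net: "(\<exists>Y \<phi>. network_solution ?W x Dr Dc 0 Y \<phi>) \<longleftrightarrow>
        chain_solution ?a ?s m (\<lambda>c. (m + 2 \<in> R \<longrightarrow> ?s 1 * (c 0 - c 1) = 0) \<and>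
          (Suc m \<in> R \<longrightarrow> ?s (Suc m) * (c (Suc m) - c m) = 0) \<and> D c)"
      if Dr: "Dr \<subseteq> {X, p}" and Dc: "Dc \<subseteq> {X, p, Z}" and R: "R = {1..n} - (if X \<in> Dr then {Suc m} else {}) - (if p \<in> Dr then {m + 2} else {})"
        and D: "D = (\<lambda>c. (X \<in> Dc \<longrightarrow> c (Suc m) = 0) \<and> (p \<in> Dc \<longrightarrow> c 0 = 0) \<and> (Z \<in> Dc \<longrightarrow> c (Suc m) = c 0))"
      for Dr Dc R D
    proof -
      have R': "{k\<in>{1..n}. pos k \<notin> Dr} = R"
      proof (rule Set.set_eqI)
        fix k
        have "pos k \<in> Dr \<longleftrightarrow> k = Suc m \<and> X \<in> Dr \<or> k = m + 2 \<and> p \<in> Dr" if "k \<in> {1..n}"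
        proof -
          have "pos k \<in> Dr \<longrightarrow> pos k = X \<or> pos k = p" using Dr by auto
          then show ?thesis using isX[OF that] isY[OF that] by metis
        qed
        then show "k \<in> {k\<in>{1..n}. pos k \<notin> Dr} \<longleftrightarrow> k \<in> R" unfolding R by auto
      qed
      have Dc': "(\<forall>k\<in>{1..n}. pos k \<in> Dc \<longrightarrow> c k = 0) \<and> (\<forall>k\<in>{1..n}. n + pos k \<in> Dc \<longrightarrow> c (k - 1) = c k) \<longleftrightarrow> D c"
        if "c 0 = c (m + 2)" for c :: "nat \<Rightarrow> 'k alg_closure"
      proof -
        have "(\<forall>k\<in>{1..n}. pos k \<in> Dc \<longrightarrow> c k = 0) \<longleftrightarrow> (X \<in> Dc \<longrightarrow> c (Suc m) = 0) \<and> (p \<in> Dc \<longrightarrow> c 0 = 0)"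
        proof -
          have "pos k \<in> Dc \<longleftrightarrow> k = Suc m \<and> X \<in> Dc \<or> k = m + 2 \<and> p \<in> Dc" if "k \<in> {1..n}" for k
          proof -
            have "pos k \<noteq> Z" using pos_lt[of k] by (simp add: Z_def)
            then have "pos k \<in> Dc \<longrightarrow> pos k = X \<or> pos k = p" using Dc by auto
            then show ?thesis using isX[OF that] isY[OF that] by metis
          qed
          moreover have "Suc m \<in> {1..n}" "m + 2 \<in> {1..n}" by (auto simp: n_def)
          ultimately show ?thesis unfolding that by (metis (no_types, lifting))
        qed
        moreover have "(\<forall>k\<in>{1..n}. n + pos k \<in> Dc \<longrightarrow> c (k - 1) = c k) \<longleftrightarrow> (Z \<in> Dc \<longrightarrow> c (Suc m) = c 0)"
        proof -
          have "n + pos k \<in> Dc \<longleftrightarrow> k = m + 2 \<and> Z \<in> Dc" if "k \<in> {1..n}" for k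
          proof -
            have "n + pos k \<in> Dc \<longrightarrow> n + pos k = Z" using Dc X(1) n(4) by auto
            moreover have "n + pos k = Z \<longleftrightarrow> k = m + 2" using isY[OF that] by (simp add: Z_def)
            ultimately show ?thesis by metis
          qed
          moreover have "m + 2 \<in> {1..n}" "m + 2 - 1 = Suc m" by (auto simp: n_def)
          ultimately show ?thesis unfolding that by metis
        qed
        ultimately show ?thesis unfolding D by blast
      qed
      have "(\<exists>Y \<phi>. network_solution ?W x Dr Dc 0 Y \<phi>) \<longleftrightarrow> (\<exists>c. cyclic_solution ?a ?s (m + 2) R c \<and>
          ((\<forall>k\<in>{1..n}. pos k \<in> Dc \<longrightarrow> c k = 0) \<and> (\<forall>k\<in>{1..n}. n + pos k \<in> Dc \<longrightarrow> c (k - 1) = c k)))"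
        unfolding n_def[symmetric] R'[symmetric] pos_def
        by (rule network_solution_wheel_iff[OF n(2,4)]) (use Dr Dc X(1) n in \<open>auto simp: Z_def\<close>)
      also have "\<dots> \<longleftrightarrow> chain_solution ?a ?s m (\<lambda>c. (m + 2 \<in> R \<longrightarrow> ?s 1 * (c 0 - c 1) = 0) \<and>
          (Suc m \<in> R \<longrightarrow> ?s (Suc m) * (c (Suc m) - c m) = 0) \<and> D c)"
      proof (rule cyclic_iff_chain_solution[OF _ _ s a _ Dc'])
        show "{1..m} \<subseteq> R" "R \<subseteq> {1..m + 2}" unfolding R n_def by auto
        show "D c \<longleftrightarrow> D c'" if "\<forall>k\<le>Suc m. c k = c' k" for c c' using that unfolding D by simp
      qed
      finally show ?thesis .
    qed
    have mem: "Suc m \<in> {1..n}" "m + 2 \<in> {1..n}" by (auto simp: n_def)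
    have Zne: "Z \<noteq> X" "Z \<noteq> p" using X n by (auto simp: Z_def)
    have f0: "mp_eval ?f0 x = 0 \<longleftrightarrow> chain_solution ?a ?s m (\<lambda>c. c 0 = 0 \<and> c (Suc m) = 0)"
    proof -
      let ?H = "delete (delete ?W e1) e2"
      have wfH: "wf_graph ?H" by (intro wf_delete wf)
      obtain xs where xs: "distinct xs" "set xs = Inl ` (arcs ?W - {e1, e2}) \<union> Inr ` (verts ?W - {0})"
        using distinct_list_of_set[of "Inl ` (arcs ?W - {e1, e2}) \<union> Inr ` (verts ?W - {0})"] by auto
      have arcsH: "arcs ?H = arcs ?W - {e1, e2}" by auto
      have "mp_eval ?f0 x = tree_sum (contract ?H Z) x" by (rule mp_eval_graph_poly[OF wf_contract[OF wfH]])
      also have "\<dots> = tree_sum ?H (x(Z := 0))"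
        by (rule tree_sum_contract[OF wfH]) (use e12 n in \<open>auto simp: Z_def\<close>)
      also have "\<dots> = det (label_mat (graph_entry ?H x) xs xs)"
        unfolding upd by (rule matrix_tree[OF wfH _ xs(1)]) (use xs(2) arcsH in auto)
      finally have "mp_eval ?f0 x = 0 \<longleftrightarrow> (\<exists>Y \<phi>. network_solution ?W x {e1, e2} {e1, e2} 0 Y \<phi>)"
        using graph_minor_zero_iff[OF wf, of 0 "{e1, e2}" xs "{e1, e2}" xs x] xs e12 X n by (simp add: graph_entry_delete)
      also have "\<dots> \<longleftrightarrow> chain_solution ?a ?s m (\<lambda>c. c 0 = 0 \<and> c (Suc m) = 0)"
        unfolding e12(3)
        by (subst net[OF _ _ refl refl]) (use Zne X mem in \<open>auto intro!: chain_solution_cong\<close>)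
      finally show ?thesis .
    qed
    have f123: "mp_eval ?f123 x = 0 \<longleftrightarrow>
        chain_solution ?a ?s m (\<lambda>c. ?s 1 * (c 0 - c 1) = 0 \<and> ?s (Suc m) * (c (Suc m) - c m) = 0)"
    proof -
      let ?G1 = "contract ?W e1" and ?G2 = "contract (contract ?W e1) e2"
      have mem1: "e2 \<in> arcs ?G1 \<or> ?G1 = zero_graph" by (rule arcs_contract) (use e12 in auto)
      have mem2: "Z \<in> arcs ?G2 \<or> ?G2 = zero_graph"
      proof -
        have "Z \<in> arcs ?G1 \<or> ?G1 = zero_graph" by (rule arcs_contract) (use e12 n in \<open>auto simp: Z_def\<close>)
        then show ?thesis using arcs_contract[of Z ?G1 e2] e12 contract_zero_graph by (auto simp: Z_def)
      qed
      have "mp_eval ?f123 x = tree_sum (contract ?G2 Z) x" by (intro mp_eval_graph_poly wf_contract wf)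
      also have "\<dots> = tree_sum ?G2 (x(Z := 0))" by (rule tree_sum_contract[OF _ mem2]) (intro wf_contract wf)
      also have "\<dots> = tree_sum ?G1 (x(e2 := 0))" unfolding upd(3) by (rule tree_sum_contract[OF _ mem1]) (intro wf_contract wf)
      also have "\<dots> = tree_sum ?W (x(e1 := 0))" unfolding upd(2) by (rule tree_sum_contract[OF wf]) (use e12 in auto)
      finally have "mp_eval ?f123 x = tree_sum ?W x" unfolding upd .
      then have "mp_eval ?f123 x = 0 \<longleftrightarrow> (\<exists>c. cyclic_solution ?a ?s (m + 2) {1..m + 2} c \<and> True)"
        using wheel_tree_sum_zero_iff[OF n(2,4), of x] by (simp add: n_def)
      also have "\<dots> \<longleftrightarrow> chain_solution ?a ?s m (\<lambda>c. (m + 2 \<in> {1..m + 2} \<longrightarrow> ?s 1 * (c 0 - c 1) = 0) \<and>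
          (Suc m \<in> {1..m + 2} \<longrightarrow> ?s (Suc m) * (c (Suc m) - c m) = 0) \<and> True)"
        by (rule cyclic_iff_chain_solution[OF _ _ s a]) auto
      finally show ?thesis by simp
    qed
    have dX: "(\<exists>Y \<phi>. network_solution ?W x {X} {Z} 0 Y \<phi>) \<longleftrightarrow>
        chain_solution ?a ?s m (\<lambda>c. c (Suc m) = c 0 \<and> ?s 1 * (c 0 - c 1) = 0)"
      by (subst net[OF _ _ refl refl]) (use Zne X mem in \<open>auto intro!: chain_solution_cong\<close>)
    have dY: "(\<exists>Y \<phi>. network_solution ?W x {p} {Z} 0 Y \<phi>) \<longleftrightarrow>
        chain_solution ?a ?s m (\<lambda>c. c (Suc m) = c 0 \<and> ?s (Suc m) * (c (Suc m) - c m) = 0)"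
      by (subst net[OF _ _ refl refl]) (use Zne X mem in \<open>auto intro!: chain_solution_cong\<close>)
    have dS: "(\<exists>Y \<phi>. network_solution ?W x {e1} {e2} 0 Y \<phi>) \<longleftrightarrow> chain_solution ?a ?s m bs"
    proof (cases "e1 = X")
      case True
      then have e2: "e2 = p" using cases X by auto
      show ?thesis unfolding True e2 bs_def
        by (subst net[OF _ _ refl refl]) (use Zne X mem in \<open>auto intro!: chain_solution_cong\<close>)
    next
      case False
      then have e: "e1 = p" "e2 = X" using cases by auto
      show ?thesis unfolding e bs_def
        by (subst net[OF _ _ refl refl]) (use Zne X mem in \<open>auto intro!: chain_solution_cong\<close>)
    qed
    have lt: "e1 < 2 * n" "e2 < 2 * n" "Z < 2 * n" using e12 n by (auto simp: Z_def)
    have D: "(\<forall>f\<in>?F. mp_eval f x = 0) \<longleftrightarrow> mp_eval ?f0 x = 0 \<and>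
        (\<exists>Y \<phi>. network_solution ?W x {e1} {e2} 0 Y \<phi>) \<and>
        ((\<exists>Y \<phi>. network_solution ?W x {e1} {Z} 0 Y \<phi>) \<and> (\<exists>Y \<phi>. network_solution ?W x {e2} {Z} 0 Y \<phi>)) \<and>
        mp_eval ?f123 x = 0"
      using dodgson_wheel_zero_iff[where x = x and l = e1, OF n(3) lt(2,3) x0(1)]
        dodgson_wheel_zero_iff[where x = x and l = e2, OF n(3) lt(1,3) x0(2)]
        dodgson_wheel_zero_iff[where x = x and l = Z, OF n(3) lt(1,2) x0(3)] by auto
    have swap: "(\<exists>Y \<phi>. network_solution ?W x {e1} {Z} 0 Y \<phi>) \<and> (\<exists>Y \<phi>. network_solution ?W x {e2} {Z} 0 Y \<phi>) \<longleftrightarrow>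
        (\<exists>Y \<phi>. network_solution ?W x {X} {Z} 0 Y \<phi>) \<and> (\<exists>Y \<phi>. network_solution ?W x {p} {Z} 0 Y \<phi>)"
      using cases by auto
    have "(\<forall>f\<in>?F. mp_eval f x = 0) \<longleftrightarrow>
        (continuant ?a ?s 1 (Suc m) = 0 \<and> ?s 1 * continuant ?a ?s 2 m = 0) \<and>
        ?s (Suc m) * continuant ?a ?s 1 m = 0 \<and> ?s 1 * ?s (Suc m) * continuant ?a ?s 2 (m - 1) = 0"
      unfolding D swap f0 dS dX dY f123 conj_assoc
      by (rule chain_solution_iff[OF m, unfolded conj_assoc]) (simp add: bs_def)
    also have "\<dots> \<longleftrightarrow> ?\<Theta> (WC.coords x)"
    proof -
      have odd: "WC.coords x (2 * k + 1) = ?s k" if "k \<in> {1..Suc m}" for k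
        using WC.coords_odd[OF x, of k] that by (simp add: n_def)
      have k: "kont j l (WC.coords x) = continuant ?a ?s j l" if "1 \<le> j" "j + l \<le> m + 2" for j l
      proof (rule continuant_coords)
        fix k assume "j \<le> k" "k + 1 < j + l"
        then have "k \<in> {1..m}" using that by auto
        then show "WC.coords x (2 * k) = ?a k" by (rule WC.coords_even)
      next
        fix k assume "j < k" "k + 1 < j + l"
        then have "k \<in> {1..Suc m}" using that by auto
        then show "WC.coords x (2 * k + 1) = ?s k" by (rule odd)
      qed
      have "WC.coords x 3 = ?s 1" "WC.coords x (2 * Suc m + 1) = ?s (Suc m)"
        using odd[of 1] odd[of "Suc m"] by (simp_all add: numeral_3_eq_3)
      moreover have "kont 1 (Suc m) (WC.coords x) = continuant ?a ?s 1 (Suc m)"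
        "kont 2 m (WC.coords x) = continuant ?a ?s 2 m" "kont 1 m (WC.coords x) = continuant ?a ?s 1 m"
        "kont 2 (m - 1) (WC.coords x) = continuant ?a ?s 2 (m - 1)"
        by (rule k; use m in simp)+
      ultimately show ?thesis by presburger
    qed
    finally show "(\<forall>f\<in>?F. mp_eval f x = 0) \<longleftrightarrow> ?\<Theta> (WC.coords x)" .
  qed
  also have "\<dots> = cls_b m + (lefschetz - 1) * cls_c m + (lefschetz - 1) * (cls_c m + (lefschetz - 1) * cls_d m)"
    by (rule vertex_locus_class[OF m])
  finally show ?thesis by (simp add: n_def)
qed

section \<open>The generating series\<close>

text \<open>The coefficient of the generating function identity at \<open>n = m + 2\<close>, with \<open>b, c, d, e\<close> the classes for \<open>m\<close>, those with
  suffix \<open>1\<close> and \<open>2\<close> the classes for \<open>m + 1\<close> and \<open>m + 2\<close>, and \<open>u = L\<^sup>2\<^sup>m\<^sup>-\<^sup>1\<close>.\<close>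

lemma wheel_recurrence_algebra:
  fixes L b c d e u :: "'a::{comm_ring, comm_monoid_mult}"
  assumes c1: "c1 = L * (b + (L - 1) * c)" and d1: "d1 = L * (c + (L - 1) * d)"
    and b1: "b1 = L * (u - b) + c1"
    and e1: "e1 = b - c + (L - 1) * (c - e) + L * (c + (L - 1) * d)"
    and c2: "c2 = L * (b1 + (L - 1) * c1)"
    and b2: "b2 = L * (L * L * u - b1) + c2"
    and e2: "e2 = b1 - c1 + (L - 1) * (c1 - e1) + L * (c1 + (L - 1) * d1)"
  shows "L * L * L * L * L * L * u + L * L * (L - 1) * e2 + (L - 1) * (L * L * L * L * u + L * L * (L - 1) * e1) =
    L * ((L * L * L * L - L * L * L) * (b + (L - 1) * c + (L - 1) * (c + (L - 1) * d)) +
      (L - 1) * (b2 - L * L * b) +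
      (L * L * L * L * L * u + (L * L - L) * (L * u)))"
  unfolding b2 e2 c2 e1 b1 c1 d1
  by (simp add: algebra_simps)

text \<open>Read off from the coefficients, since the type classes of rings with unit include \<open>0 \<noteq> 1\<close>, which is not established for \<open>K0\<close>.\<close>

lemma fps_one_mult_K0: "1 * f = (f :: 'k::field K0 fps)" "f * 1 = (f :: 'k::field K0 fps)"
proof -
  show *: "1 * f = f"
  proof (rule fps_ext)
    fix n
    have "fps_nth (1 * f) n = (\<Sum>i=0..n. if i = 0 then fps_nth f n else 0)"
      unfolding fps_mult_nth by (rule sum.cong) auto
    then show "fps_nth (1 * f) n = fps_nth f n" by simp
  qed
  show "f * 1 = f" using * by (simp only: mult.commute)
qed

lemma fps_nth_geometric_K0:
  fixes q :: "'k::field K0"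
  shows "fps_nth (fps_right_inverse (1 - fps_const q * fps_X) 1) n = q ^ n"
proof -
  let ?I = "fps_right_inverse (1 - fps_const q * fps_X) 1"
  have "(1 - fps_const q * fps_X) * ?I = 1"
    by (rule fps_right_inverse_K0) simp
  then have eq: "?I - fps_const q * (fps_X * ?I) = 1"
    by (simp add: left_diff_distrib mult.assoc fps_one_mult_K0)
  have nth: "fps_nth ?I n - q * fps_nth (fps_X * ?I) n = fps_nth 1 n" for n
    using arg_cong[OF eq, of "\<lambda>f. fps_nth f n"] by simp
  show ?thesis
  proof (induction n)
    case 0
    then show ?case using nth[of 0] by simp
  next
    case (Suc n)
    then show ?case using nth[of "Suc n"] by simp
  qed
qed

theorem proposition49:
  fixes v :: "nat \<Rightarrow> nat"
  assumes "\<And>n. n \<ge> 3 \<Longrightarrow> v n < n"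
  shows "(w_series :: 'k::field K0 fps) =
    (let L = lefschetz; c = fps_const; t = fps_X in
      (c (L^4 - L^3) * w_hat_series v
        + c (L - 1) * (1 - c (L^2) * (t * t)) * b_series
        + (1 - c L * (t * t) + c (L^2) * (t * t)) * fps_right_inverse (1 - c (L^2) * t) 1)
      * fps_right_inverse (1 + c (L - 1) * t) 1
      * (c L * t))"
proof -
  let ?L = "lefschetz :: 'k K0" and ?t = "fps_X :: 'k K0 fps"
  define I where "I = fps_right_inverse (1 - fps_const (?L^2) * ?t) 1"
  have I_nth: "fps_nth I n = (?L^2) ^ n" for n
    unfolding I_def by (rule fps_nth_geometric_K0)
  let ?D = "1 + fps_const (?L - 1) * ?t"
  let ?J = "fps_right_inverse ?D 1"
  define N where "N = fps_const (?L^4 - ?L^3) * w_hat_series v +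
    fps_const (?L - 1) * (1 - fps_const (?L^2) * (?t * ?t)) * b_series +
    (1 - fps_const ?L * (?t * ?t) + fps_const (?L^2) * (?t * ?t)) * I"
  define w where "w n = fps_nth (w_series :: 'k K0 fps) n" for n
  define b where "b n = fps_nth (b_series :: 'k K0 fps) n" for n
  define h where "h n = fps_nth (w_hat_series v :: 'k K0 fps) n" for n
  have w_eq: "w 0 = 0" "w 1 = ?L" "w 2 = ?L ^ 3"
    and wS: "m \<ge> 2 \<Longrightarrow> w (Suc m) = ?L ^ (2 * m + 1) + ?L * ?L * (?L - 1) * cls_e m" for m
    using wheel_class[of m, where 'k = 'k] by (simp_all add: w_def w_series_def)
  have b_eq: "b 0 = 0" "m \<ge> 1 \<Longrightarrow> b m = cls_b m" for m
    using contracted_wheel_class[of m, where 'k = 'k] cls_base(1)[where 'a = 'k]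
    by (auto simp: b_def b_series_def)
  have h_eq: "n \<le> 2 \<Longrightarrow> h n = 0"
    "m \<ge> 1 \<Longrightarrow> h (m + 2) = cls_b m + (?L - 1) * cls_c m + (?L - 1) * (cls_c m + (?L - 1) * cls_d m)" for n m
  proof -
    show "n \<le> 2 \<Longrightarrow> h n = 0" by (simp add: h_def w_hat_series_def)
    assume m: "m \<ge> 1"
    then have "v (m + 2) < m + 2" by (intro assms) simp
    then show "h (m + 2) = cls_b m + (?L - 1) * cls_c m + (?L - 1) * (cls_c m + (?L - 1) * cls_d m)"
      using vertex_class_wheel[OF m, of "v (m + 2)", where 'k = 'k] m by (simp add: h_def w_hat_series_def)
  qed
  have coeff: "fps_nth N n = (?L^4 - ?L^3) * h n + (?L - 1) * (b n - ?L^2 * (if n < 2 then 0 else b (n - 2))) +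
      ((?L^2) ^ n + (?L^2 - ?L) * (if n < 2 then 0 else (?L^2) ^ (n - 2)))" for n
  proof -
    have sq: "fps_nth (?t * ?t * f) n = (if n < 2 then 0 else fps_nth f (n - 2))" for f :: "'k K0 fps"
      by (cases n; cases "n - 1") (auto simp: mult.assoc)
    have "N = fps_const (?L^4 - ?L^3) * w_hat_series v +
        fps_const (?L - 1) * (b_series - fps_const (?L^2) * (?t * ?t * b_series)) +
        (I + (fps_const (?L^2) * (?t * ?t * I) - fps_const ?L * (?t * ?t * I)))"
      unfolding N_def by (simp add: algebra_simps fps_one_mult_K0 del: fps_const_sub)
    then show ?thesis
      by (simp add: sq I_nth h_def b_def left_diff_distrib del: fps_const_sub)
  qed
  have step: "w (Suc n) + (?L - 1) * w n = ?L * fps_nth N n" for n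
  proof -
    consider "n = 0" | "n = 1" | "n = 2" | m where "n = m + 2" "m \<ge> 1"
      by (metis One_nat_def add_2_eq_Suc' less_2_cases_iff not_less nat_less_le le_Suc_ex add.commute Suc_leI gr0I add_0)
    then show ?thesis
    proof cases
      case 1
      then show ?thesis using w_eq b_eq h_eq(1)[of 0] by (simp add: coeff)
    next
      case 2
      then show ?thesis using w_eq b_eq(1) b_eq(2)[of 1] h_eq(1)[of 1] cls_base(1)[where 'a = 'k]
        by (simp add: coeff algebra_simps eval_nat_numeral)
    next
      case 3
      have "cls_e 2 = (1 :: 'k K0)" "cls_b 2 = ?L * ?L"
        using cls_e_Suc[of 1, where 'a = 'k] cls_b_Suc[of 1, where 'a = 'k] cls_c_Suc[of 1, where 'a = 'k]
        by (simp_all add: cls_base[simplified] eval_nat_numeral algebra_simps)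
      then show ?thesis using 3 w_eq wS[of 2] b_eq(1) b_eq(2)[of 2] h_eq(1)[of 2]
        by (simp add: coeff algebra_simps eval_nat_numeral)
    next
      case (4 m)
      define u where "u = ?L ^ (2 * m - 1)"
      have Lu: "?L ^ (2 * m + k) = ?L * u * ?L ^ k" for k
      proof -
        obtain m' where "m = Suc m'" using 4 by (cases m) auto
        then show ?thesis by (simp add: u_def power_add algebra_simps)
      qed
      have LL: "?L ^ m * ?L ^ m = ?L * u" using Lu[of 0] by (simp add: mult_2 power_add)
      have pw: "?L ^ (2 * Suc m - 1) = ?L * ?L * u" "?L ^ (2 * n + 1) = ?L * ?L * ?L * ?L * ?L * ?L * u"
        "?L ^ (2 * Suc m + 1) = ?L * ?L * ?L * ?L * u" "(?L ^ 2) ^ n = ?L * ?L * ?L * ?L * ?L * u" "(?L ^ 2) ^ (n - 2) = ?L * u"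
        using Lu[of 1] Lu[of 5] Lu[of 3] Lu[of 4] Lu[of 0] 4
        by (simp_all add: power_mult[symmetric] eval_nat_numeral algebra_simps LL)
      have m1: "1 \<le> m" and m2: "1 \<le> Suc m" using 4 by auto
      have n: "n = Suc (Suc m)" using 4 by simp
      have "w (Suc n) + (?L - 1) * w n = ?L * ?L * ?L * ?L * ?L * ?L * u + ?L * ?L * (?L - 1) * cls_e (Suc (Suc m)) +
          (?L - 1) * (?L * ?L * ?L * ?L * u + ?L * ?L * (?L - 1) * cls_e (Suc m))"
        using wS[of n] wS[of "Suc m"] 4 n pw by simp
      also have "\<dots> = ?L * ((?L * ?L * ?L * ?L - ?L * ?L * ?L) *
            (cls_b m + (?L - 1) * cls_c m + (?L - 1) * (cls_c m + (?L - 1) * cls_d m)) +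
          (?L - 1) * (cls_b (Suc (Suc m)) - ?L * ?L * cls_b m) +
          (?L * ?L * ?L * ?L * ?L * u + (?L * ?L - ?L) * (?L * u)))"
        by (rule wheel_recurrence_algebra[OF cls_c_Suc[OF m1] cls_d_Suc[OF m1] cls_b_Suc[OF m1, where 'a = 'k, folded u_def]
              cls_e_Suc[OF m1] cls_c_Suc[OF m2] cls_b_Suc[OF m2, where 'a = 'k, unfolded pw(1)] cls_e_Suc[OF m2]])
      also have "\<dots> = ?L * fps_nth N n"
        unfolding coeff pw using 4 b_eq(2)[of m] b_eq(2)[of n] h_eq(2)[of m] n
        by (simp add: eval_nat_numeral mult.assoc)
      finally show ?thesis .
    qed
  qed
  have "w_series * ?D = N * (fps_const ?L * ?t)"
  proof (rule fps_ext)
    fix n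
    have l: "w_series * ?D = w_series + fps_const (?L - 1) * (?t * w_series)"
      by (simp add: algebra_simps fps_one_mult_K0 del: fps_const_sub)
    have r: "N * (fps_const ?L * ?t) = fps_const ?L * (?t * N)" by (simp add: mult_ac)
    show "fps_nth (w_series * ?D) n = fps_nth (N * (fps_const ?L * ?t)) n"
      unfolding l r using w_eq(1) step by (cases n) (simp_all add: w_def del: fps_const_sub)
  qed
  moreover have "?D * ?J = 1" by (rule fps_right_inverse_K0) simp
  ultimately have "w_series * 1 = N * (fps_const ?L * ?t) * ?J"
    by (metis mult.assoc)
  then have "w_series = N * (fps_const ?L * ?t) * ?J" by (simp only: fps_one_mult_K0)
  also have "\<dots> = N * ?J * (fps_const ?L * ?t)" by (simp only: mult_ac)
  finally show ?thesis by (simp only: N_def I_def Let_def)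
qed

end
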